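(* Let $G=(V,E,\omega,m)$ be a finite connected weighted graph, $n$ a positive integer, $f_1,\dots,f_n:V\to\mathbb{R}$ with $f_n$ not identically zero, and $c\in\mathbb{R}$. Consider the equation $$-\Delta u(x)=\sum_{i=1}^n f_i(x)e^{iu(x)}+c,\qquad x\in V,$$ and assume that $\overline{f_1}\neq0$ in the case $c=0$. Then the Brouwer degree $d_{f_n,\dots,f_1,c}$ associated with this equation is $$d_{f_n,\dots,f_1,c}=\begin{cases}1, & q(F_n)<+\infty,\ \text{with either } c>0,\ \text{or } c=0 \text{ and } \overline{f_1}>0,\\ -1, & q(F_n)=+\infty,\ \text{with either } c<0,\ \text{or } c=0 \text{ and } \overline{f_1}<0,\\ 0, & \text{otherwise.}\end{cases}$$
   Context: A finite connected weighted graph $G=(V,E,\omega,m)$ consists of a finite connected graph $(V,E)$, a positive vertex weight $m:V\to(0,\infty)$, and a symmetric edge weight $\omega:V\times V\to[0,\infty)$, $\omega_{xy}=\omega_{yx}$, with $\omega_{xy}>0$ if and only if $\{x,y\}\in E$ (written $x\sim y$). The graph Laplacian is $\Delta u(x)=\frac{1}{m(x)}\sum_{y\sim x}\omega_{xy}(u(y)-u(x))$. The average of $f:V\to\mathbb{R}$ is $\overline f=\frac{\sum_{x\in V}m(x)f(x)}{\sum_{x\in V}m(x)}$. Put $F_n(x,y)=\sum_{i=1}^n f_i(x)e^{iy}+c$ for $x\in V$, $y\in\mathbb{R}$, and $q(F_n)=\max_{x\in V}\lim_{y\to+\infty}F_n(x,y)\in[-\infty,+\infty]$. Degree: let $X=l^\infty(V)$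 be the space of real functions on $V$ with the sup norm, $B_R=\{u\in X:\|u\|_{l^\infty}\leqslant R\}$, and $$H_{f_n,\dots,f_1,c}:X\to X,\qquad H_{f_n,\dots,f_1,c}(u)=-\Delta u-\sum_{i=1}^n f_ie^{iu}-c.$$ Under the assumption on $\overline{f_1}$, the zeros of $H_{f_n,\dots,f_1,c}$ (the solutions of the equation) are uniformly bounded, so the Brouwer degree $\deg(H_{f_n,\dots,f_1,c},B_R,0)$ is well defined and constant for large $R$; set $d_{f_n,\dots,f_1,c}=\lim_{R\to+\infty}\deg(H_{f_n,\dots,f_1,c},B_R,0)$. *)

theory Defs
  imports "HOL-Analysis.Analysis"
begin

section \<open>The Brouwer degree in Euclidean space\<close>

definition C2_on :: "(real^'n::finite) set \<Rightarrow> (real^'n \<Rightarrow> real^'n) \<Rightarrow> bool" where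
  "C2_on U g \<longleftrightarrow>
     (\<exists>(g' :: real^'n \<Rightarrow> ((real^'n) \<Rightarrow>\<^sub>L (real^'n)))
      (g'' :: real^'n \<Rightarrow> ((real^'n) \<Rightarrow>\<^sub>L ((real^'n) \<Rightarrow>\<^sub>L (real^'n)))).
        (\<forall>x\<in>U. (g has_derivative blinfun_apply (g' x)) (at x)) \<and>
        (\<forall>x\<in>U. (g' has_derivative blinfun_apply (g'' x)) (at x)) \<and>
        continuous_on U g'')"

definition regular_value_on :: "(real^'n::finite) set \<Rightarrow> (real^'n \<Rightarrow> real^'n) \<Rightarrow> real^'n \<Rightarrow> bool" where
  "regular_value_on U g p \<longleftrightarrow> (\<forall>x\<in>U. g x = p \<longrightarrow> det (jacobian g (at x)) \<noteq> 0)"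

text \<open>
  The usual analytic definition of the degree of a continuous map \<open>h\<close> on the closure of a bounded
  open set \<open>U\<close>, with \<open>p\<close> not in \<open>h ` frontier U\<close>: it is the signed number of preimages of \<open>p\<close>
  under any twice continuously differentiable \<open>g\<close> whose uniform distance from \<open>h\<close> is less than the
  distance from \<open>p\<close> to \<open>h ` frontier U\<close> and for which \<open>p\<close> is a regular value. Such a \<open>g\<close> exists,
  has only finitely many preimages of \<open>p\<close>, and the count does not depend on its choice. If \<open>p\<close> lies
  in \<open>h ` frontier U\<close>, the degree is not defined: no \<open>g\<close> qualifies and the value is unspecified.
\<close>

definition brouwer_degree :: "(real^'n::finite \<Rightarrow> real^'n) \<Rightarrow> (real^'n) set \<Rightarrow> real^'n \<Rightarrow> int" where
  "brouwer_degree h U p =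
     (THE d. \<forall>g. continuous_on (closure U) g \<longrightarrow> C2_on U g \<longrightarrow>
        (\<forall>x\<in>closure U. dist (g x) (h x) < infdist p (h ` frontier U)) \<longrightarrow>
        regular_value_on U g p \<longrightarrow>
        real_of_int d = (\<Sum>x\<in>{x\<in>U. g x = p}. sgn (det (jacobian g (at x)))))"


section \<open>Weighted graphs\<close>

text \<open>
  The vertex set \<open>V\<close> is the finite type \<open>'v\<close>, and an edge is a set \<open>{x, y}\<close>. Loops are not excluded;
  they do not contribute to the Laplacian.
\<close>

locale finite_connected_weighted_graph =
  fixes E :: "'v::finite set set" and \<omega> :: "'v \<Rightarrow> 'v \<Rightarrow> real" and m :: "'v \<Rightarrow> real"
  assumes edges: "\<And>e. e \<in> E \<Longrightarrow> \<exists>x y. e = {x, y}"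
    and connected: "\<And>x y. (x, y) \<in> {(a, b). {a, b} \<in> E}\<^sup>*"
    and vertex_weight_pos: "\<And>x. m x > 0"
    and edge_weight_nonneg: "\<And>x y. \<omega> x y \<ge> 0"
    and edge_weight_sym: "\<And>x y. \<omega> x y = \<omega> y x"
    and edge_weight_pos_iff: "\<And>x y. \<omega> x y > 0 \<longleftrightarrow> {x, y} \<in> E"

definition laplacian ::
  "'v::finite set set \<Rightarrow> ('v \<Rightarrow> 'v \<Rightarrow> real) \<Rightarrow> ('v \<Rightarrow> real) \<Rightarrow> ('v \<Rightarrow> real) \<Rightarrow> 'v \<Rightarrow> real" where
  "laplacian E \<omega> m u x = 1 / m x * (\<Sum>y | {x, y} \<in> E. \<omega> x y * (u y - u x))"

definition average :: "('v::finite \<Rightarrow> real) \<Rightarrow> ('v \<Rightarrow> real) \<Rightarrow> real" where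
  "average m f = (\<Sum>x\<in>UNIV. m x * f x) / (\<Sum>x\<in>UNIV. m x)"


section \<open>The equation and its degree\<close>

definition exp_sum :: "nat \<Rightarrow> (nat \<Rightarrow> 'v \<Rightarrow> real) \<Rightarrow> real \<Rightarrow> 'v \<Rightarrow> real \<Rightarrow> real" where
  "exp_sum n f c x y = (\<Sum>i=1..n. f i x * exp (real i * y)) + c"

definition q_max :: "('v::finite \<Rightarrow> real \<Rightarrow> real) \<Rightarrow> ereal" where
  "q_max G = (MAX x\<in>UNIV. Lim at_top (\<lambda>y. ereal (G x y)))"

definition kw_map ::
  "'v::finite set set \<Rightarrow> ('v \<Rightarrow> 'v \<Rightarrow> real) \<Rightarrow> ('v \<Rightarrow> real) \<Rightarrow>
   nat \<Rightarrow> (nat \<Rightarrow> 'v \<Rightarrow> real) \<Rightarrow> real \<Rightarrow> real^'v \<Rightarrow> real^'v" where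
  "kw_map E \<omega> m n f c u =
     (\<chi> x. - laplacian E \<omega> m (($) u) x - (\<Sum>i=1..n. f i x * exp (real i * u $ x)) - c)"

text \<open>
  On \<open>real^'v\<close> the sup norm is \<open>infnorm\<close>; the norm of the type is the Euclidean one.
\<close>

definition sup_ball :: "real \<Rightarrow> (real^'v::finite) set" where
  "sup_ball R = {u. infnorm u \<le> R}"

text \<open>
  The degree over the closed ball \<open>sup_ball R\<close> is, as usual, the degree over its interior.
\<close>

definition kw_degree ::
  "'v::finite set set \<Rightarrow> ('v \<Rightarrow> 'v \<Rightarrow> real) \<Rightarrow> ('v \<Rightarrow> real) \<Rightarrow>
   nat \<Rightarrow> (nat \<Rightarrow> 'v \<Rightarrow> real) \<Rightarrow> real \<Rightarrow> int" where
  "kw_degree E \<omega> m n f c = Lim at_top (\<lambda>R. brouwer_degree (kw_map E \<omega> m n f c) (interior (sup_ball R)) 0)"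

end

(*
The degree is computed by Heinz's integral: for a C2 map g without zeros on the frontier of U, the
integral over U of prod_i phi(g_i) * det Dg, with phi a bump function at 0, counts the regular zeros of
g with signs (change of variables near each zero). It does not change when one coordinate of g is changed
slightly, because the difference of the integrands is a null Lagrangian; hence it is invariant under
straight line homotopies without zeros on the frontier. Together with Sard's theorem this shows that the
degree is well defined and homotopy invariant.

Let s = 1 if c > 0, or c = 0 and the average of f_1 is positive, and s = -1 otherwise. The map
u |-> -Delta u - F(x, u(x)) is deformed linearly in the nonlinearity F, first replacing c = 0 by c = s.
If no vertex has a positive leading coefficient, F is deformed to the point source (s - e^y) at a vertex
with negative leading coefficient. Otherwise F is deformed to s + e^y on the set P of vertices with
positive leading coefficient and s elsewhere; for s = 1 this has no solution, and for s = -1 it is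
deformed further to the point source e^y - 1 at a vertex of P. A point source k + r e^y at x1 has no
solution if k and r have the same sign, and u = 0 as its only solution if k = -r, with
Jacobian -Delta - r delta_{x1}, whose determinant has the sign of -r.

The solutions stay bounded along these deformations, because one-sided bounds of -Delta u bound the
oscillation of u; apply this to u, to min(u, 0) and to max(u, Y).
*)
theory Submission
  imports Defs
begin

section \<open>Integrals of directional derivatives and symmetry of second derivatives\<close>

text \<open>The bump is applied coordinatewise because the bump of g_i times the gradient of g_i is
  the gradient of an antiderivative composed with g_i. Heinz's integrand is then itself a Jacobian
  determinant, linear in each row, and a homotopy can be carried out in small steps, one coordinate
  at a time, without differentiating in the homotopy parameter. The bounds from below rest on one
  identity: the sum of m (-Delta u) over the vertices is zero, so the m-weighted sum of F(x, u(x))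
  vanishes for a solution. For u near -infinity everywhere this sum behaves like c times the total
  mass or, if c = 0 and u is a solution, like e^u times the weighted sum of f_1; its sign is s. A
  deformation that changed this sign could let zeros escape to -infinity, so every target carries
  the constant s, and the nonzero average of f_1 secures a sign when c = 0. Near +infinity the
  leading coefficient decides, that is, at each vertex the last nonzero f_i(x), as f_n may vanish at
  some vertices. Vertices of opposite behaviour coexist, which is why several criteria for upper
  bounds are needed.\<close>

lemma integrable_continuous_bounded_support:
  fixes v :: "'a::euclidean_space \<Rightarrow> real"
  assumes "continuous_on UNIV v" "bounded K" "\<And>x. x \<notin> K \<Longrightarrow> v x = 0"
  shows "integrable lborel v"
proof -
  obtain r where r: "K \<subseteq> cball 0 r"
    using assms(2) unfolding bounded_iff by (metis mem_cball_0 subsetI)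
  have "integrable lborel (\<lambda>x. indicator (cball 0 r) x *\<^sub>R v x)"
    by (rule borel_integrable_compact) (use assms(1) continuous_on_subset in auto)
  moreover have "(\<lambda>x. indicator (cball 0 r) x *\<^sub>R v x) = v"
    using assms(3) r by (force simp: indicator_def fun_eq_iff)
  ultimately show ?thesis by simp
qed

text \<open>Translation invariance of the Lebesgue measure replaces the divergence theorem: the integrals of
  all difference quotients of \<open>v\<close> vanish.\<close>

lemma integral_directional_derivative_eq_0:
  fixes v :: "'a::euclidean_space \<Rightarrow> real"
  assumes der: "\<And>x. (v has_derivative D x) (at x)"
    and cont': "continuous_on UNIV (\<lambda>x. D x e)"
    and K: "bounded K" "\<And>x. x \<notin> K \<Longrightarrow> v x = 0" "\<And>x. x \<notin> K \<Longrightarrow> D x e = 0"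
  shows "integrable lborel (\<lambda>x. D x e)" "integral\<^sup>L lborel (\<lambda>x. D x e) = 0"
proof -
  have contv: "continuous_on UNIV v"
    using der by (auto intro!: continuous_at_imp_continuous_on has_derivative_continuous)
  show "integrable lborel (\<lambda>x. D x e)"
    using cont' K(1,3) by (rule integrable_continuous_bounded_support)
  have intv: "integrable lborel v"
    using contv K(1,2) by (rule integrable_continuous_bounded_support)
  obtain r where r: "K \<subseteq> cball 0 r"
    using K(1) unfolding bounded_iff by (metis mem_cball_0 subsetI)
  \<comment> \<open>The difference quotients use steps of at most 1, so from a point outside
    \<open>B\<close> they see only points outside \<open>cball 0 r\<close>, where \<open>v\<close>
    is 0. \<open>B\<close> carries the dominating function.\<close>
  define B where "B = cball (0::'a) (r + norm e)"
  have "continuous_on (cball 0 r) (\<lambda>x. D x e)"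
    using cont' continuous_on_subset by blast
  then have "bounded ((\<lambda>x. D x e) ` cball 0 r)"
    using compact_imp_bounded[OF compact_continuous_image] compact_cball by blast
  then obtain b where "b > 0" and "\<forall>y\<in>(\<lambda>x. D x e) ` cball 0 r. norm y \<le> b"
    using bounded_pos by metis
  then have b: "\<And>x. x \<in> cball 0 r \<Longrightarrow> \<bar>D x e\<bar> \<le> b" by simp
  have bb: "\<bar>D x e\<bar> \<le> b" for x
    using b[of x] K(3)[of x] \<open>b > 0\<close> subsetD[OF r, of x] by fastforce
  define q where "q = (\<lambda>(i::nat) x. (v (x + inverse (Suc i) *\<^sub>R e) - v x) / inverse (Suc i))"
  have s: "0 < inverse (real (Suc i))" "inverse (real (Suc i)) \<le> 1" for i
    by (auto simp: field_simps)
  have der1: "((\<lambda>s. v (x + s *\<^sub>R e)) has_real_derivative D (x + s *\<^sub>R e) e) (at s)" for x s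
  proof -
    have "((\<lambda>s. v (x + s *\<^sub>R e)) has_derivative (\<lambda>h. D (x + s *\<^sub>R e) (h *\<^sub>R e))) (at s)"
      by (rule has_derivative_compose[of "\<lambda>s. x + s *\<^sub>R e", OF _ der[of "x + s *\<^sub>R e"]]) (auto intro!: derivative_eq_intros)
    moreover have "D (x + s *\<^sub>R e) (h *\<^sub>R e) = h * D (x + s *\<^sub>R e) e" for h
      using has_derivative_bounded_linear[OF der[of "x + s *\<^sub>R e"]]
      by (simp add: linear_simps)
    ultimately have "((\<lambda>s. v (x + s *\<^sub>R e)) has_derivative (\<lambda>h. h * D (x + s *\<^sub>R e) e)) (at s)"
      by simp
    then show ?thesis
      by (simp add: has_field_derivative_def mult_commute_abs)
  qed
  \<comment> \<open>By the mean value theorem every quotient is a value of the derivative, so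
    \<open>b\<close> bounds it uniformly in the step.\<close>
  have qb: "norm (q i x) \<le> indicator B x *\<^sub>R b" for i x
  proof -
    define h where "h = inverse (real (Suc i))"
    have h: "0 < h" "h \<le> 1" using s h_def by auto
    obtain z where "v (x + h *\<^sub>R e) - v (x + 0 *\<^sub>R e) = (h - 0) * D (x + z *\<^sub>R e) e"
      using MVT2[OF h(1), of "\<lambda>s. v (x + s *\<^sub>R e)" "\<lambda>s. D (x + s *\<^sub>R e) e"] der1 by blast
    then have "q i x = D (x + z *\<^sub>R e) e"
      unfolding q_def h_def[symmetric] using h by simp
    moreover have "q i x = 0" if "x \<notin> B"
    proof -
      have nx: "norm x > r + norm e" using that by (simp add: B_def)
      have "norm x \<le> norm (x + h *\<^sub>R e) + norm (h *\<^sub>R e)"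
        by (metis add_diff_cancel_right' norm_triangle_ineq4)
      moreover have "norm (h *\<^sub>R e) \<le> norm e"
        using h by (simp add: mult_left_le_one_le)
      ultimately have "norm (x + h *\<^sub>R e) > r" using nx by linarith
      then have "v (x + h *\<^sub>R e) = 0" using K(2) r by (metis mem_cball_0 not_le subset_iff)
      moreover have "norm x > r" using nx norm_ge_zero[of e] by linarith
      then have "v x = 0" using K(2) r by (metis mem_cball_0 not_le subset_iff)
      ultimately show ?thesis by (simp add: q_def h_def)
    qed
    ultimately show ?thesis using bb by (auto simp: indicator_def)
  qed
  have q0: "integral\<^sup>L lborel (q i) = 0" for i
  proof -
    define h where "h = inverse (real (Suc i)) *\<^sub>R e"
    have m: "(\<lambda>x::'a. h + x) \<in> measurable lborel borel" by simp
    have mv: "v \<in> borel_measurable borel" using intv by auto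
    have i2: "integrable lborel (\<lambda>x. v (h + x))"
      using integrable_distr_eq[OF m mv] intv by (simp add: lborel_distr_plus)
    have "integral\<^sup>L lborel (\<lambda>x. v (h + x)) = integral\<^sup>L lborel v"
      using integral_distr[OF m mv] by (simp add: lborel_distr_plus)
    then have "integral\<^sup>L lborel (\<lambda>x. v (h + x) - v x) = 0"
      using i2 intv by simp
    then have "integral\<^sup>L lborel (\<lambda>x. (v (h + x) - v x) / inverse (Suc i)) = 0"
      by (subst integral_divide_zero) simp
    then show ?thesis unfolding q_def h_def by (simp add: add.commute)
  qed
  have "(\<lambda>i. integral\<^sup>L lborel (q i)) \<longlonglongrightarrow> integral\<^sup>L lborel (\<lambda>x. D x e)"
  proof (rule integral_dominated_convergence[where w="\<lambda>x. indicator B x *\<^sub>R b"])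
    show "integrable lborel (\<lambda>x. indicator B x *\<^sub>R b)"
      by (rule borel_integrable_compact) (auto simp: B_def)
    show "(\<lambda>x. D x e) \<in> borel_measurable lborel"
      using cont' by (simp add: borel_measurable_continuous_onI)
    show "q i \<in> borel_measurable lborel" for i
    proof -
      have "continuous_on UNIV (q i)"
        unfolding q_def by (intro continuous_intros continuous_on_compose2[OF contv]) (use s in auto)
      then show ?thesis by (simp add: borel_measurable_continuous_onI)
    qed
    show "AE x in lborel. (\<lambda>i. q i x) \<longlonglongrightarrow> D x e"
    proof (rule AE_I2)
      fix x
      have "(\<lambda>h. (v (x + h *\<^sub>R e) - v x) / h) \<midarrow>0\<rightarrow> D x e"
        using der1[of x 0] unfolding DERIV_def by simp
      moreover have "filterlim (\<lambda>i. inverse (real (Suc i))) (at 0) sequentially"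
        unfolding filterlim_at using LIMSEQ_inverse_real_of_nat by auto
      ultimately show "(\<lambda>i. q i x) \<longlonglongrightarrow> D x e"
        unfolding q_def by (rule filterlim_compose)
    qed
    show "AE x in lborel. norm (q i x) \<le> indicator B x *\<^sub>R b" for i
      using qb by simp
  qed
  then show "integral\<^sup>L lborel (\<lambda>x. D x e) = 0"
    using q0 by (simp add: LIMSEQ_const_iff)
qed

text \<open>The mean value theorem is applied twice: in the direction \<open>a\<close> to the
  difference of \<open>w\<close> across the step in \<open>b\<close>, then in the direction
  \<open>b\<close> to the resulting derivative. The mixed difference is symmetric in
  \<open>a\<close> and \<open>b\<close>, which is the point of the formula.\<close>

lemma mixed_difference_eq_second_derivative:
  fixes w :: "'a::real_inner \<Rightarrow> real"
  assumes ball: "\<And>r t. 0 \<le> r \<Longrightarrow> r \<le> s \<Longrightarrow> 0 \<le> t \<Longrightarrow> t \<le> s \<Longrightarrow> x + r *\<^sub>R a + t *\<^sub>R b \<in> U"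
    and w: "\<And>x. x \<in> U \<Longrightarrow> (w has_derivative (\<lambda>h. D x \<bullet> h)) (at x)"
    and D: "\<And>x. x \<in> U \<Longrightarrow> (D has_derivative H x) (at x)"
    and s: "s > 0"
  shows "\<exists>p. norm (p - x) \<le> s * (norm a + norm b) \<and>
     w (x + s *\<^sub>R a + s *\<^sub>R b) - w (x + s *\<^sub>R a) - w (x + s *\<^sub>R b) + w x = s * s * (H p b \<bullet> a)"
proof -
  have 1: "((\<lambda>r. w (x + r *\<^sub>R a + t *\<^sub>R b)) has_real_derivative (D (x + r *\<^sub>R a + t *\<^sub>R b) \<bullet> a)) (at r)"
    if "0 \<le> r" "r \<le> s" "0 \<le> t" "t \<le> s" for r t
  proof -
    have "((\<lambda>r. w (x + r *\<^sub>R a + t *\<^sub>R b)) has_derivative (\<lambda>h. D (x + r *\<^sub>R a + t *\<^sub>R b) \<bullet> (h *\<^sub>R a))) (at r)"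
      by (rule has_derivative_compose[of "\<lambda>r. x + r *\<^sub>R a + t *\<^sub>R b", OF _ w[OF ball]])
        (use that in \<open>auto intro!: derivative_eq_intros\<close>)
    then show ?thesis by (simp add: has_field_derivative_def mult_commute_abs)
  qed
  have 2: "((\<lambda>t. D (x + r *\<^sub>R a + t *\<^sub>R b) \<bullet> a) has_real_derivative (H (x + r *\<^sub>R a + t *\<^sub>R b) b \<bullet> a)) (at t)"
    if "0 \<le> r" "r \<le> s" "0 \<le> t" "t \<le> s" for r t
  proof -
    let ?p = "x + r *\<^sub>R a + t *\<^sub>R b"
    have "((\<lambda>t. D (x + r *\<^sub>R a + t *\<^sub>R b)) has_derivative (\<lambda>h. H ?p (h *\<^sub>R b))) (at t)"
      by (rule has_derivative_compose[of "\<lambda>t. x + r *\<^sub>R a + t *\<^sub>R b", OF _ D[OF ball]])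
        (use that in \<open>auto intro!: derivative_eq_intros\<close>)
    moreover have "H ?p (h *\<^sub>R b) = h *\<^sub>R H ?p b" for h
      using has_derivative_bounded_linear[OF D[OF ball[OF that]]] by (simp add: linear_simps)
    ultimately have "((\<lambda>t. D (x + r *\<^sub>R a + t *\<^sub>R b)) has_derivative (\<lambda>h. h *\<^sub>R H ?p b)) (at t)"
      by simp
    then have "((\<lambda>t. D (x + r *\<^sub>R a + t *\<^sub>R b) \<bullet> a) has_derivative (\<lambda>h. (h *\<^sub>R H ?p b) \<bullet> a)) (at t)"
      by (rule has_derivative_inner_left)
    then show ?thesis by (simp add: has_field_derivative_def mult_commute_abs)
  qed
  obtain r where r: "0 < r" "r < s" and wr:
    "(w (x + s *\<^sub>R a + s *\<^sub>R b) - w (x + s *\<^sub>R a + 0 *\<^sub>R b)) - (w (x + 0 *\<^sub>R a + s *\<^sub>R b) - w (x + 0 *\<^sub>R a + 0 *\<^sub>R b))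
      = (s - 0) * (D (x + r *\<^sub>R a + s *\<^sub>R b) \<bullet> a - D (x + r *\<^sub>R a + 0 *\<^sub>R b) \<bullet> a)"
    using MVT2[OF s, of "\<lambda>r. w (x + r *\<^sub>R a + s *\<^sub>R b) - w (x + r *\<^sub>R a + 0 *\<^sub>R b)"
        "\<lambda>r. D (x + r *\<^sub>R a + s *\<^sub>R b) \<bullet> a - D (x + r *\<^sub>R a + 0 *\<^sub>R b) \<bullet> a", OF DERIV_diff, OF 1 1] s
    by auto
  obtain t where t: "0 < t" "t < s" and
    "D (x + r *\<^sub>R a + s *\<^sub>R b) \<bullet> a - D (x + r *\<^sub>R a + 0 *\<^sub>R b) \<bullet> a = (s - 0) * (H (x + r *\<^sub>R a + t *\<^sub>R b) b \<bullet> a)"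
    using MVT2[OF s, of "\<lambda>t. D (x + r *\<^sub>R a + t *\<^sub>R b) \<bullet> a" "\<lambda>t. H (x + r *\<^sub>R a + t *\<^sub>R b) b \<bullet> a", OF 2] r
    by auto
  with wr have eq: "w (x + s *\<^sub>R a + s *\<^sub>R b) - w (x + s *\<^sub>R a) - w (x + s *\<^sub>R b) + w x
      = s * s * (H (x + r *\<^sub>R a + t *\<^sub>R b) b \<bullet> a)" by (simp add: algebra_simps)
  have "norm (r *\<^sub>R a + t *\<^sub>R b) \<le> r * norm a + t * norm b"
    using r t by (metis abs_of_pos norm_scaleR norm_triangle_ineq)
  also have "\<dots> \<le> s * (norm a + norm b)"
    using r t by (simp add: distrib_left add_mono mult_right_mono)
  finally show ?thesis using eq by (intro exI[of _ "x + r *\<^sub>R a + t *\<^sub>R b"]) (simp add: add.assoc)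
qed

text \<open>Evaluating the mixed difference in both orders gives
  \<open>H p b \<bullet> a = H p' a \<bullet> b\<close> at two points near \<open>x\<close>;
  continuity of \<open>H\<close> carries this to \<open>x\<close>.\<close>

lemma second_derivative_symmetric:
  fixes w :: "'a::real_inner \<Rightarrow> real"
  assumes U: "open U" "x \<in> U"
    and w: "\<And>x. x \<in> U \<Longrightarrow> (w has_derivative (\<lambda>h. D x \<bullet> h)) (at x)"
    and D: "\<And>x. x \<in> U \<Longrightarrow> (D has_derivative H x) (at x)"
    and H: "\<And>h. continuous_on U (\<lambda>x. H x h)"
  shows "H x a \<bullet> b = H x b \<bullet> a"
proof (rule ccontr)
  assume ne: "H x a \<bullet> b \<noteq> H x b \<bullet> a"
  \<comment> \<open>Two errors below half of the gap cannot close it.\<close>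
  define \<epsilon> where "\<epsilon> = \<bar>H x a \<bullet> b - H x b \<bullet> a\<bar> / 2"
  have "\<epsilon> > 0" using ne by (simp add: \<epsilon>_def)
  have near: "\<exists>d>0. ball x d \<subseteq> U \<and> (\<forall>p\<in>ball x d. \<bar>H p a \<bullet> b - H x a \<bullet> b\<bar> < \<epsilon>)" for a b
  proof -
    have "continuous_on U (\<lambda>x. H x a \<bullet> b)" by (intro continuous_intros H)
    then have "isCont (\<lambda>x. H x a \<bullet> b) x" using U by (simp add: continuous_on_eq_continuous_at)
    then obtain d where d: "d > 0" "\<And>p. dist p x < d \<Longrightarrow> dist (H p a \<bullet> b) (H x a \<bullet> b) < \<epsilon>"
      using \<open>\<epsilon> > 0\<close> unfolding continuous_at by (auto simp: tendsto_iff eventually_at; smt (verit) dist_self)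
    obtain d' where d': "d' > 0" "ball x d' \<subseteq> U" using U open_contains_ball by blast
    show ?thesis
      using d d' by (intro exI[of _ "min d d'"]) (auto simp: dist_commute dist_real_def[symmetric])
  qed
  obtain d1 where d1: "d1 > 0" "ball x d1 \<subseteq> U" "\<And>p. p \<in> ball x d1 \<Longrightarrow> \<bar>H p a \<bullet> b - H x a \<bullet> b\<bar> < \<epsilon>"
    using near[of a b] by blast
  obtain d2 where d2: "d2 > 0" "\<And>p. p \<in> ball x d2 \<Longrightarrow> \<bar>H p b \<bullet> a - H x b \<bullet> a\<bar> < \<epsilon>"
    using near[of b a] by blast
  define s where "s = min d1 d2 / (norm a + norm b + 1)"
  have na: "norm a + norm b + 1 > 0"
    using norm_ge_zero[of a] norm_ge_zero[of b] by linarith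
  have s: "s > 0" using d1 d2 na by (simp add: s_def)
  have sab: "s * (norm a + norm b) < min d1 d2"
  proof -
    have "s * (norm a + norm b) < s * (norm a + norm b + 1)" using s by simp
    then show ?thesis using na by (simp add: s_def)
  qed
  have inU: "x + r *\<^sub>R a + t *\<^sub>R b \<in> U" if "0 \<le> r" "r \<le> s" "0 \<le> t" "t \<le> s" for r t
  proof -
    have "norm (r *\<^sub>R a + t *\<^sub>R b) \<le> r * norm a + t * norm b"
      using that by (metis abs_of_nonneg norm_scaleR norm_triangle_ineq)
    also have "\<dots> \<le> s * (norm a + norm b)"
      using that by (simp add: distrib_left add_mono mult_right_mono)
    finally have "dist x (x + r *\<^sub>R a + t *\<^sub>R b) < d1"
      using sab norm_minus_cancel[of "r *\<^sub>R a + t *\<^sub>R b"] by (simp add: dist_norm)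
    then show ?thesis using d1(2) by auto
  qed
  obtain p where p: "norm (p - x) \<le> s * (norm a + norm b)"
    "w (x + s *\<^sub>R a + s *\<^sub>R b) - w (x + s *\<^sub>R a) - w (x + s *\<^sub>R b) + w x = s * s * (H p b \<bullet> a)"
    using mixed_difference_eq_second_derivative[of s x a b U w D H, OF inU w D s] by blast
  have "x + r *\<^sub>R b + t *\<^sub>R a \<in> U" if "0 \<le> r" "r \<le> s" "0 \<le> t" "t \<le> s" for r t
    using inU[of t r] that by (simp add: algebra_simps)
  then obtain p' where p': "norm (p' - x) \<le> s * (norm b + norm a)"
    "w (x + s *\<^sub>R b + s *\<^sub>R a) - w (x + s *\<^sub>R b) - w (x + s *\<^sub>R a) + w x = s * s * (H p' a \<bullet> b)"
    using mixed_difference_eq_second_derivative[of s x b a U w D H, OF _ w D s] by blast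
  have "s * s * (H p b \<bullet> a) = s * s * (H p' a \<bullet> b)"
    using p(2) p'(2) by (simp add: algebra_simps)
  then have "H p b \<bullet> a = H p' a \<bullet> b" using s by simp
  moreover have "p \<in> ball x d2" "p' \<in> ball x d1"
    using p(1) p'(1) sab by (auto simp: dist_norm norm_minus_commute add.commute)
  ultimately show False
    using d1(3)[of p'] d2(2)[of p] unfolding \<epsilon>_def by (simp add: field_simps abs_if split: if_splits)
qed

section \<open>Null Lagrangians\<close>

text \<open>Gradient and Hessian are explicit data: the gradients of several functions become the
  rows of a determinant, and the Hessians give the derivatives of these rows.\<close>

definition grad2 :: "(real^'n) set \<Rightarrow> (real^'n \<Rightarrow> real) \<Rightarrow> (real^'n \<Rightarrow> real^'n) \<Rightarrow> (real^'n \<Rightarrow> real^'n^'n) \<Rightarrow> bool"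
  where "grad2 U w D H \<longleftrightarrow>
    (\<forall>x\<in>U. (w has_derivative (\<lambda>h. D x \<bullet> h)) (at x)) \<and>
    (\<forall>x\<in>U. (D has_derivative (\<lambda>h. H x *v h)) (at x)) \<and> continuous_on U H"

lemma grad2D:
  assumes "grad2 U w D H"
  shows "x \<in> U \<Longrightarrow> (w has_derivative (\<lambda>h. D x \<bullet> h)) (at x)"
    and "x \<in> U \<Longrightarrow> (D has_derivative (\<lambda>h. H x *v h)) (at x)"
    and "continuous_on U H" "continuous_on U D" "continuous_on U w"
  using assms unfolding grad2_def
  by (auto intro!: continuous_at_imp_continuous_on dest: has_derivative_continuous)

lemma continuous_on_matrix_vector_mult_left:
  fixes H :: "'a::topological_space \<Rightarrow> real^'n^'m"
  assumes "continuous_on U H"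
  shows "continuous_on U (\<lambda>x. H x *v h)"
  unfolding matrix_vector_mult_def by (intro continuous_intros assms)

lemma grad2_symmetric:
  assumes "grad2 U w D H" "open U" "x \<in> U"
  shows "(H x *v a) \<bullet> b = (H x *v b) \<bullet> a"
  by (rule second_derivative_symmetric[OF assms(2,3), of w D "\<lambda>x h. H x *v h"])
    (auto intro: grad2D[OF assms(1)] continuous_on_matrix_vector_mult_left)

lemma continuous_on_det_rows:
  fixes A :: "'n::finite \<Rightarrow> 'a::topological_space \<Rightarrow> real^'n"
  assumes "\<And>i. continuous_on U (A i)"
  shows "continuous_on U (\<lambda>x. det (\<chi> i. A i x))"
  unfolding det_def by (simp, intro continuous_intros assms)

lemma has_derivative_det_rows:
  fixes A :: "'n::finite \<Rightarrow> 'a::real_normed_vector \<Rightarrow> real^'n"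
  assumes "\<And>i. (A i has_derivative A' i) (at x within S)"
  shows "((\<lambda>x. det (\<chi> i. A i x)) has_derivative
     (\<lambda>h. \<Sum>i\<in>UNIV. det (\<chi> l. if l = i then A' i h else A l x))) (at x within S)"
proof -
  have c: "((\<lambda>x. A i x $ j) has_derivative (\<lambda>h. A' i h $ j)) (at x within S)" for i j
    by (rule bounded_linear.has_derivative[OF bounded_linear_vec_nth assms])
  have "((\<lambda>x. \<Sum>p | p permutes (UNIV :: 'n set). of_int (sign p) * (\<Prod>i\<in>UNIV. A i x $ p i)) has_derivative
     (\<lambda>h. \<Sum>p | p permutes (UNIV :: 'n set). of_int (sign p) *
        (\<Sum>i\<in>UNIV. A' i h $ p i * (\<Prod>j\<in>UNIV - {i}. A j x $ p j)))) (at x within S)"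
    by (intro has_derivative_sum has_derivative_mult_right has_derivative_prod c)
  also have "(\<lambda>h. \<Sum>p | p permutes (UNIV :: 'n set). of_int (sign p) *
        (\<Sum>i\<in>UNIV. A' i h $ p i * (\<Prod>j\<in>UNIV - {i}. A j x $ p j)))
    = (\<lambda>h. \<Sum>i\<in>UNIV. det (\<chi> l. if l = i then A' i h else A l x))"
  proof
    fix h
    have "A' i h $ p i * (\<Prod>j\<in>UNIV - {i}. A j x $ p j) = (\<Prod>l\<in>UNIV. (if l = i then A' i h else A l x) $ p l)"
      for i :: 'n and p
    proof -
      have "(\<Prod>l\<in>UNIV. (if l = i then A' i h else A l x) $ p l) =
        A' i h $ p i * (\<Prod>l\<in>UNIV - {i}. (if l = i then A' i h else A l x) $ p l)"
        by (subst prod.remove[of UNIV i]) auto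
      also have "(\<Prod>l\<in>UNIV - {i}. (if l = i then A' i h else A l x) $ p l) = (\<Prod>j\<in>UNIV - {i}. A j x $ p j)"
        by (rule prod.cong) auto
      finally show ?thesis by simp
    qed
    then have "(\<Sum>p | p permutes (UNIV :: 'n set). of_int (sign p) *
        (\<Sum>i\<in>UNIV. A' i h $ p i * (\<Prod>j\<in>UNIV - {i}. A j x $ p j)))
      = (\<Sum>p | p permutes (UNIV :: 'n set). \<Sum>i\<in>UNIV. of_int (sign p) *
          (\<Prod>l\<in>UNIV. (if l = i then A' i h else A l x) $ p l))"
      by (simp add: sum_distrib_left)
    also have "\<dots> = (\<Sum>i\<in>UNIV. \<Sum>p | p permutes (UNIV :: 'n set). of_int (sign p) *
          (\<Prod>l\<in>UNIV. (if l = i then A' i h else A l x) $ p l))"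
      by (rule sum.swap)
    also have "\<dots> = (\<Sum>i\<in>UNIV. det (\<chi> l. if l = i then A' i h else A l x))"
      by (simp add: det_def)
    finally show "(\<Sum>p | p permutes (UNIV :: 'n set). of_int (sign p) *
        (\<Sum>i\<in>UNIV. A' i h $ p i * (\<Prod>j\<in>UNIV - {i}. A j x $ p j)))
      = (\<Sum>i\<in>UNIV. det (\<chi> l. if l = i then A' i h else A l x))" .
  qed
  finally show ?thesis by (simp add: det_def)
qed

lemma det_swap_rows:
  fixes a b :: "real^'n::finite"
  assumes "i \<noteq> k"
  shows "det (\<chi> r. if r = i then a else if r = k then b else C r)
    = - det (\<chi> r. if r = i then b else if r = k then a else C r)"
proof -
  let ?A = "\<chi> r. if r = i then b else if r = k then a else C r"
  have "(\<chi> r. if r = i then a else if r = k then b else C r) = (\<chi> r. ?A $ (Transposition.transpose i k r))"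
    using assms by (auto simp: vec_eq_iff Transposition.transpose_def)
  then have "det (\<chi> r. if r = i then a else if r = k then b else C r) = of_int (sign (Transposition.transpose i k)) * det ?A"
    using det_permute_rows[of "Transposition.transpose i k" ?A] permutes_swap_id[of i UNIV k] by simp
  then show ?thesis using assms by (simp add: sign_swap_id)
qed

text \<open>Cofactors appear as determinants with a unit vector in row \<open>i\<close>, a form to
  which \<open>has_derivative_det_rows\<close> applies directly.\<close>

lemma det_row_expand:
  fixes v :: "real^'n::finite"
  shows "det (\<chi> r. if r = i then v else C r) = (\<Sum>l\<in>UNIV. v $ l * det (\<chi> r. if r = i then axis l 1 else C r))"
proof -
  have v: "v = (\<Sum>l\<in>UNIV. v $ l *s axis l 1)" by (simp add: basis_expansion)
  have "det (\<chi> r. if r = i then v else C r) = det (\<chi> r. if r = i then (\<Sum>l\<in>UNIV. v $ l *s axis l 1) else C r)"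
    by (rule arg_cong[where f="\<lambda>u. det (\<chi> r. if r = i then u else C r)"], rule v)
  also have "\<dots> = (\<Sum>l\<in>UNIV. det (\<chi> r. if r = i then v $ l *s axis l 1 else C r))"
    by (rule det_linear_row_sum) simp
  finally show ?thesis by (simp add: det_row_mul)
qed

lemma antisymmetric_sum_eq_0:
  fixes h M :: "'n::finite \<Rightarrow> 'n \<Rightarrow> real"
  assumes "\<And>i j. h i j = h j i" "\<And>i j. M i j = - M j i"
  shows "(\<Sum>i\<in>UNIV. \<Sum>j\<in>UNIV. h i j * M i j) = 0"
proof -
  have "(\<Sum>i\<in>UNIV. \<Sum>j\<in>UNIV. h i j * M i j) = (\<Sum>j\<in>UNIV. \<Sum>i\<in>UNIV. h i j * M i j)"
    by (rule sum.swap)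
  also have "\<dots> = (\<Sum>i\<in>UNIV. \<Sum>j\<in>UNIV. - (h i j * M i j))"
    by (intro sum.cong refl) (metis assms mult_minus_right)
  finally show ?thesis by (simp add: sum_negf)
qed

text \<open>The rows of the cofactor matrix of a Jacobian matrix are divergence free.\<close>

lemma piola_identity:
  fixes C :: "'n::finite \<Rightarrow> real^'n" and Q :: "'n \<Rightarrow> real^'n^'n"
  assumes sym: "\<And>i a b. (Q i *v a) \<bullet> b = (Q i *v b) \<bullet> a"
  shows "(\<Sum>j\<in>UNIV. \<Sum>i\<in>UNIV. det (\<chi> l. if l = i then (if i = k then 0 else Q i *v axis j 1)
            else if l = k then axis j 1 else C l)) = 0"
proof -
  have z: "(\<Sum>j\<in>UNIV. det (\<chi> l. if l = i then (if i = k then 0 else Q i *v axis j 1)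
            else if l = k then axis j 1 else C l)) = 0" (is "sum ?f UNIV = 0") for i
  proof (cases "i = k")
    case True
    \<comment> \<open>Row \<open>k\<close> holds a constant unit vector, so differentiating it
      leaves a zero row.\<close>
    have "?f j = 0" for j
      using det_row_0[of k "\<lambda>l. if l = k then axis j 1 else C l"] True by simp
    then show ?thesis by simp
  next
    case False
    \<comment> \<open>Exchanging the unit vectors in rows \<open>i\<close> and \<open>k\<close>
      changes the sign of \<open>M\<close>, while the Hessian \<open>Q i\<close> is symmetric; so
      the double sum cancels in pairs.\<close>
    define M where "M = (\<lambda>l j. det (\<chi> r. if r = i then axis l 1 else if r = k then axis j 1 else C r))"
    have "?f j = (\<Sum>l\<in>UNIV. (Q i *v axis j 1) $ l * M l j)" for j
      using False det_row_expand[of i "Q i *v axis j 1" "\<lambda>l. if l = k then axis j 1 else C l"]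
      unfolding M_def by simp
    then have "sum ?f UNIV = (\<Sum>j\<in>UNIV. \<Sum>l\<in>UNIV. (Q i *v axis j 1) $ l * M l j)" by simp
    also have "\<dots> = 0"
    proof (rule antisymmetric_sum_eq_0[where M = "\<lambda>j l. M l j"])
      show "(Q i *v axis j 1) $ l = (Q i *v axis l 1) $ j" for j l
        using sym[of i "axis j 1" "axis l 1"] by (simp add: inner_axis)
      show "M l j = - M j l" for j l
        unfolding M_def using False by (rule det_swap_rows)
    qed
    finally show ?thesis .
  qed
  show ?thesis by (subst sum.swap) (simp only: z sum.neutral_const)
qed

text \<open>By the Piola identity the determinant is the divergence of \<open>w k\<close> times row
  \<open>k\<close> of the cofactor matrix, so it integrates to 0 once that field vanishes off a
  compact set. \<open>vanish\<close> speaks of the product because at some points \<open>w k\<close>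
  is 0 and at others one of the remaining rows.\<close>

lemma null_lagrangian:
  fixes w :: "'n::finite \<Rightarrow> real^'n \<Rightarrow> real"
  assumes U: "open U" and g: "\<And>i. grad2 U (w i) (D i) (H i)"
    and K: "compact K" "K \<subseteq> U"
    and vanish: "\<And>x b. x \<in> U - K \<Longrightarrow> w k x * det (\<chi> i. if i = k then b else D i x) = 0"
  shows "integral\<^sup>L lborel (\<lambda>x. if x \<in> U then det (\<chi> i. D i x) else 0) = 0"
proof -
  \<comment> \<open>\<open>cf (axis j 1)\<close> is the cofactor at position \<open>(k, j)\<close>
    and \<open>v j\<close> the \<open>j\<close>-th component of the field, extended by 0;
    \<open>cf'\<close> and \<open>V\<close> are their derivatives.\<close>
  define cf where "cf = (\<lambda>b x. det (\<chi> i. if i = k then b else D i x))"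
  define cf' where "cf' = (\<lambda>b x h. \<Sum>i\<in>UNIV. det (\<chi> l. if l = i then (if i = k then 0 else H i x *v h)
            else if l = k then b else D l x))"
  define v where "v = (\<lambda>j x. if x \<in> U then w k x * cf (axis j 1) x else 0)"
  define V where "V = (\<lambda>j x h. if x \<in> U then w k x * cf' (axis j 1) x h + (D k x \<bullet> h) * cf (axis j 1) x else 0)"
  have cf: "(cf b has_derivative cf' b x) (at x)" if "x \<in> U" for b x
  proof -
    have *: "((\<lambda>x. if i = k then b else D i x) has_derivative (\<lambda>h. if i = k then 0 else H i x *v h)) (at x)" for i
      using grad2D(2)[OF g that] by (cases "i = k") auto
    show ?thesis
      using has_derivative_det_rows[of "\<lambda>i x. if i = k then b else D i x", OF *]
      unfolding cf_def cf'_def by simp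
  qed
  have v0: "v j x = 0" if "x \<notin> K" for j x
    using vanish[of x] that by (auto simp: v_def cf_def)
  have opK: "open (- K)" using K(1) by (simp add: compact_imp_closed open_Compl)
  have vV: "(v j has_derivative V j x) (at x)" if "x \<in> U" for j x
  proof -
    have "((\<lambda>x. w k x * cf (axis j 1) x) has_derivative
       (\<lambda>h. w k x * cf' (axis j 1) x h + (D k x \<bullet> h) * cf (axis j 1) x)) (at x)"
      by (rule has_derivative_mult[OF grad2D(1)[OF g that] cf[OF that]])
    then have "((\<lambda>x. w k x * cf (axis j 1) x) has_derivative V j x) (at x)"
      using that by (simp add: V_def cong: if_cong)
    then show ?thesis
      by (rule has_derivative_transform_within_open[OF _ U that]) (simp add: v_def)
  qed
  have v00: "(v j has_derivative (\<lambda>h. 0)) (at x)" if "x \<notin> K" for j x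
    by (rule has_derivative_transform_within_open[OF has_derivative_const[of 0] opK]) (use that v0 in auto)
  \<comment> \<open>Inside \<open>U\<close> but off \<open>K\<close> the formula for
    \<open>V\<close> is not visibly 0; there \<open>v j\<close> vanishes on an open set, and
    uniqueness of the derivative gives the claim.\<close>
  have V0: "V j x = (\<lambda>h. 0)" if "x \<notin> K" for j x
  proof (cases "x \<in> U")
    case True
    show ?thesis using has_derivative_unique[OF vV[OF True] v00[OF that]] .
  qed (simp add: V_def)
  have der: "(v j has_derivative V j x) (at x)" for j x
    using vV v00 V0 K(2) by (cases "x \<in> K") auto
  have UK: "U \<union> - K = UNIV" using K(2) by auto
  have contV: "continuous_on UNIV (\<lambda>x. V j x (axis j 1))" for j
  proof -
    have "continuous_on U (\<lambda>x. w k x * cf' (axis j 1) x (axis j 1) + (D k x \<bullet> axis j 1) * cf (axis j 1) x)"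
    proof (intro continuous_intros)
      show "continuous_on U (cf (axis j 1))"
        by (intro continuous_at_imp_continuous_on ballI has_derivative_continuous[OF cf])
      show "continuous_on U (\<lambda>x. cf' (axis j 1) x (axis j 1))"
        unfolding cf'_def
      proof (intro continuous_on_sum continuous_on_det_rows)
        show "continuous_on U (\<lambda>x. if l = i then (if i = k then 0 else H i x *v axis j 1)
            else if l = k then axis j 1 else D l x)" for i l
          using continuous_on_matrix_vector_mult_left[OF grad2D(3)[OF g]] grad2D(4)[OF g]
          by (cases "l = i"; cases "i = k"; cases "l = k"; simp)
      qed
    qed (auto intro: grad2D[OF g])
    then have "continuous_on U (\<lambda>x. V j x (axis j 1))"
      by (rule continuous_on_eq) (simp add: V_def)
    moreover have "continuous_on (- K) (\<lambda>x. V j x (axis j 1))"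
      by (rule continuous_on_eq[OF continuous_on_const[of _ 0]]) (simp add: V0)
    ultimately show ?thesis
      using continuous_on_open_Un[OF U opK] by (metis UK)
  qed
  have I: "integrable lborel (\<lambda>x. V j x (axis j 1))" "integral\<^sup>L lborel (\<lambda>x. V j x (axis j 1)) = 0" for j
  proof -
    have V1: "V j x (axis j 1) = 0" if "x \<notin> K" for x using V0[OF that] by simp
    note * = integral_directional_derivative_eq_0[of "v j" "V j" "axis j 1" K, OF der contV compact_imp_bounded[OF K(1)] v0 V1]
    show "integrable lborel (\<lambda>x. V j x (axis j 1))" by (rule *(1))
    show "integral\<^sup>L lborel (\<lambda>x. V j x (axis j 1)) = 0" by (rule *(2))
  qed
  have "(if x \<in> U then det (\<chi> i. D i x) else 0) = (\<Sum>j\<in>UNIV. V j x (axis j 1))" for x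
  proof (cases "x \<in> U")
    case True
    have "(\<Sum>j\<in>UNIV. V j x (axis j 1)) =
      w k x * (\<Sum>j\<in>UNIV. cf' (axis j 1) x (axis j 1)) + (\<Sum>j\<in>UNIV. D k x $ j * cf (axis j 1) x)"
      using True by (simp add: V_def sum.distrib sum_distrib_left inner_axis)
    also have "(\<Sum>j\<in>UNIV. cf' (axis j 1) x (axis j 1)) = 0"
      unfolding cf'_def by (rule piola_identity) (rule grad2_symmetric[OF g U True])
    also have "(\<Sum>j\<in>UNIV. D k x $ j * cf (axis j 1) x) = det (\<chi> i. if i = k then D k x else D i x)"
      unfolding cf_def by (rule det_row_expand[symmetric])
    also have "(\<chi> i. if i = k then D k x else D i x) = (\<chi> i. D i x)"
      by (simp add: vec_eq_iff)
    finally show ?thesis using True by simp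
  qed (simp add: V_def)
  then have "integral\<^sup>L lborel (\<lambda>x. if x \<in> U then det (\<chi> i. D i x) else 0)
      = (\<Sum>j\<in>UNIV. integral\<^sup>L lborel (\<lambda>x. V j x (axis j 1)))"
    by (simp only: Bochner_Integration.integral_sum[OF I(1)])
  then show ?thesis using I(2) by simp
qed

section \<open>Bump functions and their antiderivatives\<close>

lemma has_derivative_positive_part_power2:
  "((\<lambda>t::real. (max 0 t)\<^sup>2) has_real_derivative 2 * max 0 t) (at t)"
proof -
  consider "t > 0" | "t < 0" | "t = 0" by linarith
  then show ?thesis
  proof cases
    case 1
    have "((\<lambda>t::real. t\<^sup>2) has_real_derivative 2 * t) (at t)"
      by (auto intro!: derivative_eq_intros)
    then have "((\<lambda>t::real. (max 0 t)\<^sup>2) has_real_derivative 2 * t) (at t)"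
      by (rule has_field_derivative_transform_within_open[where S="{0<..}"]) (use 1 in auto)
    then show ?thesis using 1 by simp
  next
    case 2
    have "((\<lambda>t::real. 0) has_real_derivative 0) (at t)" by simp
    then have "((\<lambda>t::real. (max 0 t)\<^sup>2) has_real_derivative 0) (at t)"
      by (rule has_field_derivative_transform_within_open[where S="{..<0}"]) (use 2 in auto)
    then show ?thesis using 2 by simp
  next
    case 3
    have "((\<lambda>h::real. max 0 h) \<longlongrightarrow> max 0 0) (at 0)"
      by (intro tendsto_intros)
    moreover have "(max 0 h)\<^sup>2 / h = max 0 h" for h :: real
      by (auto simp: power2_eq_square max_def)
    ultimately have "((\<lambda>h::real. (max 0 h)\<^sup>2 / h) \<longlongrightarrow> 0) (at 0)"
      by simp
    then show ?thesis using 3 by (simp add: DERIV_def)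
  qed
qed

text \<open>Squaring the positive part makes it continuously differentiable. An antiderivative of
  the bump is then twice continuously differentiable, the regularity that \<open>grad2\<close> asks
  of a composition with it.\<close>

definition bump :: "real \<Rightarrow> real \<Rightarrow> real" where
  "bump \<epsilon> s = (max 0 (\<epsilon>\<^sup>2 - s\<^sup>2))\<^sup>2"

definition bump' :: "real \<Rightarrow> real \<Rightarrow> real" where
  "bump' \<epsilon> s = - 4 * s * max 0 (\<epsilon>\<^sup>2 - s\<^sup>2)"

lemma has_derivative_bump: "(bump \<epsilon> has_real_derivative bump' \<epsilon> s) (at s)"
proof -
  have "((\<lambda>s. \<epsilon>\<^sup>2 - s\<^sup>2) has_real_derivative - 2 * s) (at s)"
    by (auto intro!: derivative_eq_intros)
  from DERIV_chain2[OF has_derivative_positive_part_power2 this]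
  have "((\<lambda>s. (max 0 (\<epsilon>\<^sup>2 - s\<^sup>2))\<^sup>2) has_real_derivative 2 * max 0 (\<epsilon>\<^sup>2 - s\<^sup>2) * (- 2 * s)) (at s)" .
  moreover have "bump \<epsilon> = (\<lambda>s. (max 0 (\<epsilon>\<^sup>2 - s\<^sup>2))\<^sup>2)" by (simp add: bump_def fun_eq_iff)
  moreover have "bump' \<epsilon> s = 2 * max 0 (\<epsilon>\<^sup>2 - s\<^sup>2) * (- 2 * s)" by (simp add: bump'_def)
  ultimately show ?thesis by metis
qed

lemma continuous_on_bump [continuous_intros]:
  assumes "continuous_on S w"
  shows "continuous_on S (\<lambda>x. bump \<epsilon> (w x))" "continuous_on S (\<lambda>x. bump' \<epsilon> (w x))"
proof -
  show "continuous_on S (\<lambda>x. bump \<epsilon> (w x))"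
    unfolding bump_def by (intro continuous_intros assms)
  show "continuous_on S (\<lambda>x. bump' \<epsilon> (w x))"
    unfolding bump'_def by (intro continuous_intros assms)
qed

lemma bump_nonneg: "bump \<epsilon> s \<ge> 0"
  by (simp add: bump_def)

lemma bump_eq_0: "\<epsilon> > 0 \<Longrightarrow> \<bar>s\<bar> \<ge> \<epsilon> \<Longrightarrow> bump \<epsilon> s = 0"
  using power_mono[of \<epsilon> "\<bar>s\<bar>" 2] by (simp add: bump_def)

lemma bump_pos: "\<bar>s\<bar> < \<epsilon> \<Longrightarrow> bump \<epsilon> s > 0"
  using power_strict_mono[of "\<bar>s\<bar>" \<epsilon> 2] by (simp add: bump_def max_def)

text \<open>On either side of the support an antiderivative is constant, with different constants.
  Hence its values at two points outside the support are known to agree only if both are at least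
  \<open>\<epsilon>\<close> or both at most \<open>- \<epsilon>\<close>; this shapes the hypotheses
  \<open>off\<close> of the comparison lemmas below.\<close>

lemma bump_antiderivative:
  assumes "\<epsilon> > 0"
  obtains \<Phi> where "\<And>s. (\<Phi> has_real_derivative bump \<epsilon> s) (at s)"
    "\<And>s t. s \<ge> \<epsilon> \<Longrightarrow> t \<ge> \<epsilon> \<Longrightarrow> \<Phi> s = \<Phi> t" "\<And>s t. s \<le> - \<epsilon> \<Longrightarrow> t \<le> - \<epsilon> \<Longrightarrow> \<Phi> s = \<Phi> t"
proof -
  have "isCont (bump \<epsilon>) s" for s
    using has_derivative_bump by (rule DERIV_isCont)
  then obtain \<Phi> where "\<And>s. (\<Phi> has_vector_derivative bump \<epsilon> s) (at s)"
    using einterval_antiderivative[of "-\<infinity>" "\<infinity>" "bump \<epsilon>"] by auto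
  then have \<Phi>: "(\<Phi> has_real_derivative bump \<epsilon> s) (at s)" for s
    by (simp add: has_real_derivative_iff_has_vector_derivative)
  have const: "\<Phi> s = \<Phi> t" if "convex S" "\<And>s. s \<in> S \<Longrightarrow> \<bar>s\<bar> \<ge> \<epsilon>" "s \<in> S" "t \<in> S" for S s t
  proof -
    have "(\<Phi> has_field_derivative 0) (at u within S)" if "u \<in> S" for u
      using \<Phi>[of u] bump_eq_0[OF assms \<open>\<And>s. s \<in> S \<Longrightarrow> \<bar>s\<bar> \<ge> \<epsilon>\<close>[OF that]]
      by (simp add: has_field_derivative_at_within)
    from has_field_derivative_zero_constant[OF \<open>convex S\<close> this] show ?thesis
      using that(3,4) by auto
  qed
  show ?thesis
  proof
    show "(\<Phi> has_real_derivative bump \<epsilon> s) (at s)" for s by (rule \<Phi>)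
    show "\<Phi> s = \<Phi> t" if "s \<ge> \<epsilon>" "t \<ge> \<epsilon>" for s t
      by (rule const[of "{\<epsilon>..}"]) (use that in auto)
    show "\<Phi> s = \<Phi> t" if "s \<le> - \<epsilon>" "t \<le> - \<epsilon>" for s t
      by (rule const[of "{..- \<epsilon>}"]) (use that in auto)
  qed
qed

lemma grad2_compose_antiderivative:
  fixes w :: "real^'n::finite \<Rightarrow> real"
  assumes g: "grad2 U w D H" and \<Phi>: "\<And>s. (\<Phi> has_real_derivative bump \<epsilon> s) (at s)"
  shows "grad2 U (\<lambda>x. \<Phi> (w x)) (\<lambda>x. bump \<epsilon> (w x) *\<^sub>R D x)
    (\<lambda>x. \<chi> r c. bump' \<epsilon> (w x) * D x $ r * D x $ c + bump \<epsilon> (w x) * H x $ r $ c)"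
  unfolding grad2_def
proof (intro conjI ballI)
  fix x assume x: "x \<in> U"
  note w = grad2D(1)[OF g x] and D = grad2D(2)[OF g x]
  have "((\<lambda>x. \<Phi> (w x)) has_derivative (\<lambda>h. bump \<epsilon> (w x) * (D x \<bullet> h))) (at x)"
    by (rule has_derivative_compose[OF w, of \<Phi> "(*) (bump \<epsilon> (w x))"])
      (use \<Phi>[of "w x"] in \<open>simp add: has_field_derivative_def\<close>)
  then show "((\<lambda>x. \<Phi> (w x)) has_derivative (\<lambda>h. (bump \<epsilon> (w x) *\<^sub>R D x) \<bullet> h)) (at x)"
    by simp
  have "((\<lambda>x. bump \<epsilon> (w x)) has_derivative (\<lambda>h. bump' \<epsilon> (w x) * (D x \<bullet> h))) (at x)"
    by (rule has_derivative_compose[OF w, of "bump \<epsilon>" "(*) (bump' \<epsilon> (w x))"])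
      (use has_derivative_bump[of \<epsilon> "w x"] in \<open>simp add: has_field_derivative_def\<close>)
  from has_derivative_scaleR[OF this D]
  have "((\<lambda>x. bump \<epsilon> (w x) *\<^sub>R D x) has_derivative
      (\<lambda>h. bump \<epsilon> (w x) *\<^sub>R (H x *v h) + (bump' \<epsilon> (w x) * (D x \<bullet> h)) *\<^sub>R D x)) (at x)" .
  also have "(\<lambda>h. bump \<epsilon> (w x) *\<^sub>R (H x *v h) + (bump' \<epsilon> (w x) * (D x \<bullet> h)) *\<^sub>R D x)
    = (\<lambda>h. (\<chi> r c. bump' \<epsilon> (w x) * D x $ r * D x $ c + bump \<epsilon> (w x) * H x $ r $ c) *v h)"
    by (auto simp: fun_eq_iff vec_eq_iff matrix_vector_mult_def inner_vec_def sum.distrib sum_distrib_left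
        sum_distrib_right algebra_simps intro!: sum.cong)
  finally show "((\<lambda>x. bump \<epsilon> (w x) *\<^sub>R D x) has_derivative
    (\<lambda>h. (\<chi> r c. bump' \<epsilon> (w x) * D x $ r * D x $ c + bump \<epsilon> (w x) * H x $ r $ c) *v h)) (at x)" .
next
  show "continuous_on U (\<lambda>x. \<chi> r c. bump' \<epsilon> (w x) * D x $ r * D x $ c + bump \<epsilon> (w x) * H x $ r $ c)"
    by (intro continuous_intros continuous_on_bump grad2D[OF g])
qed

lemma grad2_add:
  assumes "grad2 U w D H" "grad2 U w' D' H'"
  shows "grad2 U (\<lambda>x. w x + w' x) (\<lambda>x. D x + D' x) (\<lambda>x. H x + H' x)"
  unfolding grad2_def
proof (intro conjI ballI)
  fix x assume x: "x \<in> U"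
  show "((\<lambda>x. w x + w' x) has_derivative (\<lambda>h. (D x + D' x) \<bullet> h)) (at x)"
    using has_derivative_add[OF grad2D(1)[OF assms(1) x] grad2D(1)[OF assms(2) x]] by (simp add: inner_add_left)
  show "((\<lambda>x. D x + D' x) has_derivative (\<lambda>h. (H x + H' x) *v h)) (at x)"
    using has_derivative_add[OF grad2D(2)[OF assms(1) x] grad2D(2)[OF assms(2) x]]
    by (simp add: matrix_vector_mult_add_rdistrib)
qed (intro continuous_intros grad2D[OF assms(1)] grad2D[OF assms(2)])

lemma grad2_cmult:
  assumes "grad2 U w D H"
  shows "grad2 U (\<lambda>x. c * w x) (\<lambda>x. c *\<^sub>R D x) (\<lambda>x. c *\<^sub>R H x)"
  unfolding grad2_def
proof (intro conjI ballI)
  fix x assume x: "x \<in> U"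
  show "((\<lambda>x. c * w x) has_derivative (\<lambda>h. (c *\<^sub>R D x) \<bullet> h)) (at x)"
    using has_derivative_mult_right[OF grad2D(1)[OF assms(1) x]] by simp
  show "((\<lambda>x. c *\<^sub>R D x) has_derivative (\<lambda>h. (c *\<^sub>R H x) *v h)) (at x)"
    using has_derivative_scaleR_right[OF grad2D(2)[OF assms(1) x]]
    by (simp add: scaleR_matrix_vector_assoc)
qed (intro continuous_intros grad2D[OF assms(1)])

section \<open>Homotopy invariance of the Heinz integral\<close>

text \<open>The bump factors sit inside the rows: if \<open>D i\<close> is the gradient of
  \<open>a i\<close>, row \<open>i\<close> is the gradient of \<open>a i\<close> composed with an
  antiderivative of the bump. Coordinates and gradients are separate arguments so that those of two
  maps can be mixed.\<close>

definition heinz :: "real \<Rightarrow> (real^'n::finite) set \<Rightarrow> ('n \<Rightarrow> real^'n \<Rightarrow> real) \<Rightarrow> ('n \<Rightarrow> real^'n \<Rightarrow> real^'n) \<Rightarrow> real^'n \<Rightarrow> real"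
  where "heinz \<epsilon> U a D x = (if x \<in> U then det (\<chi> i. bump \<epsilon> (a i x) *\<^sub>R D i x) else 0)"

lemma heinz_eq_prod:
  "heinz \<epsilon> U a D x = (if x \<in> U then (\<Prod>i\<in>UNIV. bump \<epsilon> (a i x)) * det (\<chi> i. D i x) else 0)"
  by (simp add: heinz_def det_rows_mul scalar_mult_eq_scaleR[symmetric])

lemma integrable_heinz:
  assumes U: "open U" and g: "\<And>i. grad2 U (a i) (D i) (H i)" and \<epsilon>: "\<epsilon> > 0"
    and K: "compact K" "K \<subseteq> U" and off: "\<And>x. x \<in> U - K \<Longrightarrow> \<exists>i. \<bar>a i x\<bar> \<ge> \<epsilon>"
  shows "integrable lborel (heinz \<epsilon> U a D)"
proof (rule integrable_continuous_bounded_support[OF _ compact_imp_bounded[OF K(1)]])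
  have z: "heinz \<epsilon> U a D x = 0" if x: "x \<notin> K" for x
  proof (cases "x \<in> U")
    case True
    then obtain i where "\<bar>a i x\<bar> \<ge> \<epsilon>" using off x by blast
    then have "bump \<epsilon> (a i x) = 0" using bump_eq_0 \<epsilon> by blast
    then show ?thesis by (auto simp: heinz_eq_prod)
  qed (simp add: heinz_def)
  then show "\<And>x. x \<notin> K \<Longrightarrow> heinz \<epsilon> U a D x = 0" .
  have "continuous_on U (\<lambda>x. det (\<chi> i. bump \<epsilon> (a i x) *\<^sub>R D i x))"
    by (intro continuous_on_det_rows continuous_intros grad2D[OF g])
  then have "continuous_on U (heinz \<epsilon> U a D)"
    by (rule continuous_on_eq) (simp add: heinz_def)
  moreover have "continuous_on (- K) (heinz \<epsilon> U a D)"
    by (rule continuous_on_eq[OF continuous_on_const[of _ 0]]) (simp add: z)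
  moreover have "U \<union> - K = UNIV" "open (- K)"
    using K by (auto simp: compact_imp_closed open_Compl)
  ultimately show "continuous_on UNIV (heinz \<epsilon> U a D)"
    using continuous_on_open_Un[OF U] by metis
qed

text \<open>Only the \<open>k\<close>-th coordinate changes. With \<open>\<Phi>\<close> an antiderivative of the bump, the difference of the
  integrands is a null Lagrangian of the functions \<open>\<Phi> (a i x)\<close> and \<open>\<Phi> (a k x) - \<Phi> (b k x)\<close>.\<close>

lemma heinz_change_coordinate:
  assumes U: "open U" and ga: "\<And>i. grad2 U (a i) (D i) (H i)" and gb: "\<And>i. grad2 U (b i) (D' i) (H' i)"
    and \<epsilon>: "\<epsilon> > 0" and K: "compact K" "K \<subseteq> U"
    and eq: "\<And>i. i \<noteq> k \<Longrightarrow> b i = a i" "\<And>i. i \<noteq> k \<Longrightarrow> D' i = D i"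
    and off: "\<And>x. x \<in> U - K \<Longrightarrow> \<exists>i. a i x \<ge> \<epsilon> \<and> b i x \<ge> \<epsilon> \<or> a i x \<le> - \<epsilon> \<and> b i x \<le> - \<epsilon>"
  shows "integral\<^sup>L lborel (heinz \<epsilon> U a D) = integral\<^sup>L lborel (heinz \<epsilon> U b D')"
proof -
  obtain \<Phi> where \<Phi>: "\<And>s. (\<Phi> has_real_derivative bump \<epsilon> s) (at s)"
    "\<And>s t. s \<ge> \<epsilon> \<Longrightarrow> t \<ge> \<epsilon> \<Longrightarrow> \<Phi> s = \<Phi> t" "\<And>s t. s \<le> - \<epsilon> \<Longrightarrow> t \<le> - \<epsilon> \<Longrightarrow> \<Phi> s = \<Phi> t"
    using bump_antiderivative[OF \<epsilon>] by blast
  define w where "w = (\<lambda>i x. if i = k then \<Phi> (a k x) + (- 1) * \<Phi> (b k x) else \<Phi> (a i x))"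
  define W where "W = (\<lambda>i x. if i = k then bump \<epsilon> (a k x) *\<^sub>R D k x + (- 1) *\<^sub>R (bump \<epsilon> (b k x) *\<^sub>R D' k x)
      else bump \<epsilon> (a i x) *\<^sub>R D i x)"
  have "\<exists>Q. grad2 U (w i) (W i) Q" for i
  proof (cases "i = k")
    case True
    show ?thesis
      using grad2_add[OF grad2_compose_antiderivative[OF ga \<Phi>(1), of k]
          grad2_cmult[OF grad2_compose_antiderivative[OF gb \<Phi>(1), of k], of "- 1"]]
      unfolding True w_def W_def by auto
  next
    case False
    then show ?thesis
      using grad2_compose_antiderivative[OF ga \<Phi>(1), of i] unfolding w_def W_def by auto
  qed
  then obtain Q where Q: "\<And>i. grad2 U (w i) (W i) (Q i)" by metis
  have "integral\<^sup>L lborel (\<lambda>x. if x \<in> U then det (\<chi> i. W i x) else 0) = 0"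
  proof (rule null_lagrangian[OF U Q K])
    fix x and v :: "real^'a" assume "x \<in> U - K"
    then obtain i where i: "a i x \<ge> \<epsilon> \<and> b i x \<ge> \<epsilon> \<or> a i x \<le> - \<epsilon> \<and> b i x \<le> - \<epsilon>"
      using off by blast
    show "w k x * det (\<chi> i. if i = k then v else W i x) = 0"
    proof (cases "i = k")
      case True
      then have "\<Phi> (a k x) = \<Phi> (b k x)" using i \<Phi>(2,3) by blast
      then show ?thesis by (simp add: w_def)
    next
      case False
      have "bump \<epsilon> (a i x) = 0" using i \<epsilon> by (intro bump_eq_0) auto
      then have "row i (\<chi> i. if i = k then v else W i x) = 0"
        using False by (simp add: row_def W_def vec_eq_iff)
      then show ?thesis by (simp add: det_zero_row)
    qed
  qed
  moreover have "(if x \<in> U then det (\<chi> i. W i x) else 0) = heinz \<epsilon> U a D x - heinz \<epsilon> U b D' x" for x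
  proof -
    \<comment> \<open>Row \<open>k\<close> of the first integrand is \<open>W k x\<close> plus row
      \<open>k\<close> of the second; linearity in this row splits the determinant.\<close>
    let ?B = "bump \<epsilon> (b k x) *\<^sub>R D' k x" and ?C = "\<lambda>i. bump \<epsilon> (a i x) *\<^sub>R D i x"
    have "det (\<chi> i. ?C i) = det (\<chi> i. if i = k then W k x + ?B else ?C i)"
      by (rule arg_cong[where f=det]) (auto simp: vec_eq_iff W_def)
    also have "\<dots> = det (\<chi> i. if i = k then W k x else ?C i) + det (\<chi> i. if i = k then ?B else ?C i)"
      by (rule det_row_add)
    also have "(\<chi> i. if i = k then W k x else ?C i) = (\<chi> i. W i x)"
      by (auto simp: vec_eq_iff W_def)
    also have "(\<chi> i. if i = k then ?B else ?C i) = (\<chi> i. bump \<epsilon> (b i x) *\<^sub>R D' i x)"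
      using eq by (auto simp: vec_eq_iff)
    finally show ?thesis by (simp add: heinz_def)
  qed
  moreover have off': "\<exists>i. \<bar>a i x\<bar> \<ge> \<epsilon>" "\<exists>i. \<bar>b i x\<bar> \<ge> \<epsilon>" if x: "x \<in> U - K" for x
  proof -
    obtain i where "a i x \<ge> \<epsilon> \<and> b i x \<ge> \<epsilon> \<or> a i x \<le> - \<epsilon> \<and> b i x \<le> - \<epsilon>"
      using off[OF x] by blast
    then have "\<bar>a i x\<bar> \<ge> \<epsilon>" "\<bar>b i x\<bar> \<ge> \<epsilon>" by linarith+
    then show "\<exists>i. \<bar>a i x\<bar> \<ge> \<epsilon>" "\<exists>i. \<bar>b i x\<bar> \<ge> \<epsilon>" by blast+
  qed
  moreover have "integrable lborel (heinz \<epsilon> U a D)"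
    by (rule integrable_heinz[OF U ga \<epsilon> K off'(1)])
  moreover have "integrable lborel (heinz \<epsilon> U b D')"
    by (rule integrable_heinz[OF U gb \<epsilon> K off'(2)])
  ultimately show ?thesis by simp
qed

text \<open>The coordinates are exchanged one after the other. In every mixture coordinate
  \<open>i\<close> is either \<open>a i\<close> or \<open>b i\<close>, so the coordinate that
  \<open>off\<close> provides at a point stays beyond \<open>\<epsilon>\<close> on the same side
  throughout.\<close>

lemma heinz_close:
  assumes U: "open U" and ga: "\<And>i. grad2 U (a i) (D i) (H i)" and gb: "\<And>i. grad2 U (b i) (D' i) (H' i)"
    and \<epsilon>: "\<epsilon> > 0" and K: "compact K" "K \<subseteq> U"
    and off: "\<And>x. x \<in> U - K \<Longrightarrow> \<exists>i. a i x \<ge> \<epsilon> \<and> b i x \<ge> \<epsilon> \<or> a i x \<le> - \<epsilon> \<and> b i x \<le> - \<epsilon>"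
  shows "integral\<^sup>L lborel (heinz \<epsilon> U a D) = integral\<^sup>L lborel (heinz \<epsilon> U b D')"
proof -
  define mx where "mx = (\<lambda>S i. if i \<in> S then b i else a i)"
  define Dx where "Dx = (\<lambda>S i. if i \<in> S then D' i else D i)"
  define Hx where "Hx = (\<lambda>S i. if i \<in> S then H' i else H i)"
  have gx: "grad2 U (mx S i) (Dx S i) (Hx S i)" for S i
    using ga gb by (simp add: mx_def Dx_def Hx_def)
  have "integral\<^sup>L lborel (heinz \<epsilon> U a D) = integral\<^sup>L lborel (heinz \<epsilon> U (mx S) (Dx S))" if "finite S" for S
    using that
  proof induction
    case empty
    then show ?case by (simp add: mx_def Dx_def)
  next
    case (insert k S)
    have "integral\<^sup>L lborel (heinz \<epsilon> U (mx S) (Dx S)) = integral\<^sup>L lborel (heinz \<epsilon> U (mx (insert k S)) (Dx (insert k S)))"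
    proof (rule heinz_change_coordinate[OF U gx gx \<epsilon> K])
      show "\<exists>i. mx S i x \<ge> \<epsilon> \<and> mx (insert k S) i x \<ge> \<epsilon> \<or> mx S i x \<le> - \<epsilon> \<and> mx (insert k S) i x \<le> - \<epsilon>"
        if "x \<in> U - K" for x
      proof -
        obtain i where "a i x \<ge> \<epsilon> \<and> b i x \<ge> \<epsilon> \<or> a i x \<le> - \<epsilon> \<and> b i x \<le> - \<epsilon>"
          using off[OF \<open>x \<in> U - K\<close>] by blast
        then show ?thesis by (intro exI[of _ i]) (auto simp: mx_def)
      qed
    qed (auto simp: mx_def Dx_def)
    then show ?case using insert.IH by simp
  qed
  from this[of UNIV] show ?thesis by (simp add: mx_def Dx_def)
qed

lemma exists_large_component:
  fixes v :: "real^'n::finite"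
  assumes "norm v \<ge> \<delta>"
  shows "\<exists>i. \<bar>v $ i\<bar> \<ge> \<delta> / CARD('n)"
proof (rule ccontr)
  assume "\<not> ?thesis"
  then have "\<bar>v $ i\<bar> < \<delta> / CARD('n)" for i by (simp add: not_le)
  then have "(\<Sum>i\<in>UNIV. \<bar>v $ i\<bar>) < (\<Sum>i\<in>(UNIV :: 'n set). \<delta> / CARD('n))"
    by (intro sum_strict_mono) auto
  then show False using norm_le_l1_cart[of v] assms by simp
qed

text \<open>Compactness of the parameter interval times the frontier gives a \<open>\<delta>\<close>
  such that there some coordinate is always at least \<open>\<delta>\<close> in modulus. The segment
  is cut into steps so short that \<open>heinz_close\<close> applies to each; one range of
  \<open>\<epsilon>\<close> serves all steps.\<close>

lemma heinz_homotopy: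
  fixes U :: "(real^'n::finite) set"
  assumes U: "open U" "bounded U"
    and ga: "\<And>i. grad2 U (a i) (D i) (H i)" and gb: "\<And>i. grad2 U (b i) (D' i) (H' i)"
    and ca: "\<And>i. continuous_on (closure U) (a i)" and cb: "\<And>i. continuous_on (closure U) (b i)"
    and nz: "\<And>t x. 0 \<le> t \<Longrightarrow> t \<le> 1 \<Longrightarrow> x \<in> frontier U \<Longrightarrow> \<exists>i. (1 - t) * a i x + t * b i x \<noteq> 0"
  shows "\<exists>\<epsilon>0>0. \<forall>\<epsilon>. 0 < \<epsilon> \<longrightarrow> \<epsilon> < \<epsilon>0 \<longrightarrow>
    integral\<^sup>L lborel (heinz \<epsilon> U a D) = integral\<^sup>L lborel (heinz \<epsilon> U b D')"
proof -
  define m where "m = (\<lambda>t i x. (1 - t) * a i x + t * b i x)"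
  define Dm where "Dm = (\<lambda>t i x. (1 - t) *\<^sub>R D i x + t *\<^sub>R D' i x)"
  define Hm where "Hm = (\<lambda>t i x. (1 - t) *\<^sub>R H i x + t *\<^sub>R H' i x)"
  have gm: "grad2 U (m t i) (Dm t i) (Hm t i)" for t i
    unfolding m_def Dm_def Hm_def by (intro grad2_add grad2_cmult ga gb)
  have cU: "compact (closure U)" using U(2) by (simp add: compact_closure)
  have fU: "frontier U \<subseteq> closure U" by (simp add: frontier_def)
  have cm: "continuous_on (closure U) (m t i)" for t i
    unfolding m_def by (intro continuous_intros ca cb)
  have "\<exists>\<delta>>0. \<forall>t\<in>{0..1}. \<forall>x\<in>frontier U. \<exists>i. \<bar>m t i x\<bar> \<ge> \<delta>"
  proof (cases "frontier U = {}")
    case True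
    then show ?thesis by (auto intro: exI[of _ 1])
  next
    case False
    define F where "F = (\<lambda>p. norm ((\<chi> i. m (fst p) i (snd p)) :: real^'n))"
    have "compact ({0..1::real} \<times> frontier U)"
      using compact_frontier_bounded[OF U(2)] by (intro compact_Times) auto
    moreover have "continuous_on ({0..1::real} \<times> frontier U) F"
    proof -
      have "continuous_on ({0..1::real} \<times> frontier U) (\<lambda>p. a i (snd p))" for i
        by (rule continuous_on_compose2[OF ca]) (use fU in \<open>auto intro!: continuous_intros\<close>)
      moreover have "continuous_on ({0..1::real} \<times> frontier U) (\<lambda>p. b i (snd p))" for i
        by (rule continuous_on_compose2[OF cb]) (use fU in \<open>auto intro!: continuous_intros\<close>)
      ultimately show ?thesis unfolding F_def m_def by (intro continuous_intros)
    qed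
    ultimately obtain p where p: "p \<in> {0..1} \<times> frontier U" "\<And>q. q \<in> {0..1} \<times> frontier U \<Longrightarrow> F p \<le> F q"
      using continuous_attains_inf[of "{0..1::real} \<times> frontier U" F] False by (metis Times_empty atLeastatMost_empty_iff2 zero_le_one)
    have "F p > 0"
    proof -
      obtain i where "m (fst p) i (snd p) \<noteq> 0"
        using nz[of "fst p" "snd p"] p(1) unfolding m_def by (cases p) auto
      then have "(\<chi> i. m (fst p) i (snd p)) \<noteq> 0" by (auto simp: vec_eq_iff)
      then show ?thesis by (simp add: F_def)
    qed
    moreover have "\<exists>i. \<bar>m t i x\<bar> \<ge> F p / CARD('n)" if "t \<in> {0..1}" "x \<in> frontier U" for t x
      using exists_large_component[of "F p" "\<chi> i. m t i x"] p(2)[of "(t, x)"] that by (simp add: F_def)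
    ultimately show ?thesis by (intro exI[of _ "F p / CARD('n)"]) auto
  qed
  then obtain \<delta> where \<delta>: "\<delta> > 0" "\<And>t x. t \<in> {0..1} \<Longrightarrow> x \<in> frontier U \<Longrightarrow> \<exists>i. \<bar>m t i x\<bar> \<ge> \<delta>"
    by metis
  have "\<exists>M>0. \<forall>i. \<forall>x\<in>closure U. \<bar>b i x - a i x\<bar> \<le> M"
  proof -
    have "continuous_on (closure U) (\<lambda>x. \<chi> i. b i x - a i x)"
      by (intro continuous_intros ca cb)
    then have "bounded ((\<lambda>x. \<chi> i. b i x - a i x) ` closure U)"
      by (intro compact_imp_bounded compact_continuous_image cU)
    then obtain M where "M > 0" "\<forall>y\<in>(\<lambda>x. \<chi> i. b i x - a i x) ` closure U. norm y \<le> M"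
      unfolding bounded_pos by blast
    then have M: "norm (\<chi> i. b i x - a i x) \<le> M" if "x \<in> closure U" for x using that by blast
    have "\<bar>b i x - a i x\<bar> \<le> M" if "x \<in> closure U" for i x
      using M[OF that] component_le_norm_cart[of "\<chi> i. b i x - a i x" i] by simp
    then show ?thesis using \<open>M > 0\<close> by blast
  qed
  then obtain M where M: "M > 0" "\<And>i x. x \<in> closure U \<Longrightarrow> \<bar>b i x - a i x\<bar> \<le> M" by blast
  obtain N :: nat where N: "2 * M / \<delta> < N" using reals_Archimedean2 by blast
  have "N > 0"
  proof -
    have "2 * M / \<delta> > 0" using M \<delta> by simp
    then show ?thesis using N by (cases N) auto
  qed
  \<comment> \<open>A parameter step of length \<open>1 / N\<close> moves no coordinate by more than
    \<open>\<eta>\<close>, which is less than half of \<open>\<delta>\<close>.\<close>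
  define \<eta> where "\<eta> = M / N"
  have \<eta>: "\<eta> < \<delta> / 2" "\<eta> > 0" using N \<delta> M \<open>N > 0\<close> by (auto simp: \<eta>_def field_simps)
  have main: "integral\<^sup>L lborel (heinz \<epsilon> U a D) = integral\<^sup>L lborel (heinz \<epsilon> U b D')"
    if \<epsilon>: "0 < \<epsilon>" "\<epsilon> < \<delta> / 2" for \<epsilon>
  proof -
    have step: "integral\<^sup>L lborel (heinz \<epsilon> U (m t) (Dm t)) = integral\<^sup>L lborel (heinz \<epsilon> U (m t') (Dm t'))"
      if t: "0 \<le> t" "t \<le> 1" "\<bar>t' - t\<bar> \<le> 1 / N" for t t'
    proof (rule heinz_close[OF U(1) gm gm \<epsilon>(1)])
      \<comment> \<open>Off \<open>?K\<close> some coordinate exceeds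
        \<open>\<epsilon> + \<eta>\<close> in modulus, so it stays beyond \<open>\<epsilon>\<close>
        with the same sign after the step; \<open>\<epsilon> + \<eta> < \<delta>\<close> keeps
        \<open>?K\<close> away from the frontier.\<close>
      let ?K = "closure U \<inter> (\<Inter>i. {x \<in> closure U. \<bar>m t i x\<bar> \<le> \<epsilon> + \<eta>})"
      have "closed {x \<in> closure U. \<bar>m t i x\<bar> \<le> \<epsilon> + \<eta>}" for i
        by (intro continuous_on_closed_Collect_le continuous_intros cm) auto
      then show "compact ?K" by (intro compact_Int_closed cU closed_INT) auto
      show "?K \<subseteq> U"
      proof
        fix x assume x: "x \<in> ?K"
        show "x \<in> U"
        proof (rule ccontr)
          assume "x \<notin> U"
          then have "x \<in> frontier U" using x U(1) by (auto simp: frontier_def interior_open)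
          then obtain i where "\<bar>m t i x\<bar> \<ge> \<delta>" using \<delta>(2)[of t x] t by auto
          moreover have "\<bar>m t i x\<bar> \<le> \<epsilon> + \<eta>" using x by auto
          ultimately show False using \<epsilon> \<eta> by linarith
        qed
      qed
      fix x assume x: "x \<in> U - ?K"
      then have xc: "x \<in> closure U" using closure_subset by blast
      obtain i where i: "\<bar>m t i x\<bar> > \<epsilon> + \<eta>" using x xc by (auto simp: not_le)
      have "m t' i x - m t i x = (t' - t) * (b i x - a i x)" by (simp add: m_def algebra_simps)
      then have "\<bar>m t' i x - m t i x\<bar> = \<bar>t' - t\<bar> * \<bar>b i x - a i x\<bar>" by (simp add: abs_mult)
      also have "\<dots> \<le> 1 / N * M"
        by (rule mult_mono[OF t(3) M(2)[OF xc]]) auto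
      finally have "\<bar>m t' i x - m t i x\<bar> \<le> 1 / N * M" .
      then have "\<bar>m t' i x - m t i x\<bar> \<le> \<eta>" by (simp add: \<eta>_def)
      then show "\<exists>i. m t i x \<ge> \<epsilon> \<and> m t' i x \<ge> \<epsilon> \<or> m t i x \<le> - \<epsilon> \<and> m t' i x \<le> - \<epsilon>"
        using i \<eta> \<epsilon> by (intro exI[of _ i]) linarith
    qed
    have "integral\<^sup>L lborel (heinz \<epsilon> U (m 0) (Dm 0)) = integral\<^sup>L lborel (heinz \<epsilon> U (m (real k / N)) (Dm (real k / N)))"
      if "k \<le> N" for k
      using that
    proof (induction k)
      case (Suc k)
      have "integral\<^sup>L lborel (heinz \<epsilon> U (m (real k / N)) (Dm (real k / N)))
         = integral\<^sup>L lborel (heinz \<epsilon> U (m (real (Suc k) / N)) (Dm (real (Suc k) / N)))"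
        by (rule step) (use Suc.prems \<open>N > 0\<close> in \<open>auto simp: field_simps\<close>)
      then show ?case using Suc by simp
    qed simp
    from this[of N] \<open>N > 0\<close> show ?thesis by (simp add: m_def Dm_def)
  qed
  show ?thesis using \<delta>(1) main by (intro exI[of _ "\<delta> / 2"]) auto
qed

section \<open>Change of variables and critical values for arbitrary finite index types\<close>

text \<open>The library states the change of variables formula and Sard's theorem for well-ordered index types
  only. The type \<open>'a idx\<close> is a well-ordered copy of the finite type \<open>'a\<close>.\<close>

typedef ('a::finite) idx = "{..<CARD('a)}" morphisms nat_of_idx idx_of_nat
  by (rule exI[of _ 0]) simp

instantiation idx :: (finite) wellorder
begin

definition less_eq_idx :: "'a idx \<Rightarrow> 'a idx \<Rightarrow> bool" where "less_eq_idx x y \<longleftrightarrow> nat_of_idx x \<le> nat_of_idx y"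
definition less_idx :: "'a idx \<Rightarrow> 'a idx \<Rightarrow> bool" where "less_idx x y \<longleftrightarrow> nat_of_idx x < nat_of_idx y"

instance
proof
  fix P :: "'a idx \<Rightarrow> bool" and a :: "'a idx"
  assume step: "\<And>x. (\<And>y. y < x \<Longrightarrow> P y) \<Longrightarrow> P x"
  show "P a"
  proof (induction "nat_of_idx a" arbitrary: a rule: less_induct)
    case less
    show ?case by (rule step) (simp add: less less_idx_def)
  qed
qed (auto simp: less_eq_idx_def less_idx_def nat_of_idx_inject)

end

instance idx :: (finite) finite
proof
  have "finite (nat_of_idx ` (UNIV :: 'a idx set))"
    by (rule finite_subset[of _ "{..<CARD('a)}"]) (use nat_of_idx in auto)
  then show "finite (UNIV :: 'a idx set)"
    by (rule finite_imageD) (simp add: inj_on_def nat_of_idx_inject)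
qed

lemma ex_bij_idx: "\<exists>e :: 'a::finite idx \<Rightarrow> 'a. bij e"
proof -
  have "card (UNIV :: 'a idx set) = CARD('a)"
    using type_definition.card[OF type_definition_idx] by simp
  then show ?thesis using finite_same_card_bij[of "UNIV :: 'a idx set" "UNIV :: 'a set"] by auto
qed

section \<open>Relabelling coordinates along a bijection of index types\<close>

definition relabel :: "('k \<Rightarrow> 'n) \<Rightarrow> real^'n::finite \<Rightarrow> real^'k::finite" where
  "relabel e x = (\<chi> k. x $ e k)"

lemma relabel_nth [simp]: "relabel e x $ k = x $ e k"
  by (simp add: relabel_def)

lemma relabel_inverse [simp]:
  assumes "bij e"
  shows "relabel (inv e) (relabel e x) = x" "relabel e (relabel (inv e) y) = y"
  using assms by (auto simp: vec_eq_iff bij_is_surj surj_f_inv_f bij_is_inj)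

lemma mem_relabel_image:
  assumes "bij e"
  shows "y \<in> relabel e ` B \<longleftrightarrow> relabel (inv e) y \<in> B"
  by (auto simp: relabel_inverse[OF assms] intro!: image_eqI[of y "relabel e" "relabel (inv e) y"])

lemma linear_relabel: "linear (relabel e)"
  by (auto intro!: linearI simp: vec_eq_iff)

lemma has_derivative_relabel: "(relabel e has_derivative relabel e) F"
  by (simp add: linear_imp_has_derivative linear_relabel)

lemma continuous_on_relabel [continuous_intros]:
  "continuous_on S w \<Longrightarrow> continuous_on S (\<lambda>x. relabel e (w x))"
  unfolding relabel_def by (intro continuous_intros)

lemma relabel_cbox:
  assumes "bij e"
  shows "relabel e ` cbox u v = cbox (relabel e u) (relabel e v)"
proof
  show "relabel e ` cbox u v \<subseteq> cbox (relabel e u) (relabel e v)"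
    by (auto simp: mem_box_cart)
  show "cbox (relabel e u) (relabel e v) \<subseteq> relabel e ` cbox u v"
  proof
    fix y assume y: "y \<in> cbox (relabel e u) (relabel e v)"
    have "u $ i \<le> relabel (inv e) y $ i \<and> relabel (inv e) y $ i \<le> v $ i" for i
      using y assms surj_f_inv_f[OF bij_is_surj[OF assms], of i] by (auto simp: mem_box_cart dest!: spec[of _ "inv e i"])
    then have "relabel (inv e) y \<in> cbox u v" by (simp add: mem_box_cart)
    then show "y \<in> relabel e ` cbox u v"
      using relabel_inverse(2)[OF assms] by (metis imageI)
  qed
qed

lemma content_relabel_cbox:
  assumes "bij e"
  shows "measure lborel (relabel e ` cbox u v) = measure lborel (cbox u v)"
proof -
  have "(\<Prod>k\<in>UNIV. v $ e k - u $ e k) = (\<Prod>i\<in>UNIV. v $ i - u $ i)"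
    using assms by (rule prod.reindex_bij_betw)
  moreover have "cbox (relabel e u) (relabel e v) = {} \<longleftrightarrow> cbox u v = {}"
    using relabel_cbox[OF assms, of u v] by (metis image_is_empty)
  ultimately show ?thesis
    by (simp add: relabel_cbox[OF assms] content_cbox_if_cart)
qed

lemma has_integral_relabel:
  fixes F :: "real^'k::finite \<Rightarrow> real" and e :: "'k \<Rightarrow> 'n::finite"
  assumes e: "bij e" and F: "(F has_integral c) UNIV" and B: "bounded B" "\<And>x. x \<notin> B \<Longrightarrow> F x = 0"
  shows "((\<lambda>x. F (relabel e x)) has_integral c) UNIV"
proof -
  obtain a b where ab: "B \<subseteq> cbox a b" using bounded_subset_cbox_symmetric[OF B(1)] by blast
  then have "F x = 0" if "x \<notin> cbox a b" for x using B(2) that by blast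
  then have "(\<lambda>x. if x \<in> cbox a b then F x else 0) = F" by auto
  then have "(F has_integral c) (cbox a b)" using F has_integral_restrict_UNIV[of "cbox a b" F c] by simp
  then have "((\<lambda>x. F (relabel e x)) has_integral (1 / 1) *\<^sub>R c) (relabel (inv e) ` cbox a b)"
  proof (rule has_integral_twiddle[rotated -1])
    show "\<exists>w z. relabel e ` cbox u v = cbox w z" for u v using relabel_cbox[OF e] by blast
    show "\<exists>w z. relabel (inv e) ` cbox u v = cbox w z" for u v using relabel_cbox[OF bij_imp_bij_inv[OF e]] by blast
    show "continuous (at x) (relabel e)" for x
      using has_derivative_relabel has_derivative_continuous by blast
    show "measure lborel (relabel e ` cbox u v) = 1 * measure lborel (cbox u v)" for u v
      using content_relabel_cbox[OF e] by simp
  qed (auto simp: e)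
  moreover have "F (relabel e x) = 0" if "x \<notin> relabel (inv e) ` cbox a b" for x
  proof -
    have "relabel e x \<notin> cbox a b" using that relabel_inverse(1)[OF e, of x] by (metis imageI)
    then show ?thesis using ab B(2) by blast
  qed
  then have "(\<lambda>x. if x \<in> relabel (inv e) ` cbox a b then F (relabel e x) else 0) = (\<lambda>x. F (relabel e x))" by auto
  ultimately show ?thesis
    using has_integral_restrict_UNIV[of "relabel (inv e) ` cbox a b" "\<lambda>x. F (relabel e x)"] by simp
qed

lemma swapidseq_conjugate:
  assumes e: "bij e" and "swapidseq n p"
  shows "swapidseq n (inv e \<circ> p \<circ> e)"
  using assms(2)
proof induction
  case id
  have "inv e \<circ> id \<circ> e = id" by (rule ext) (simp add: inv_f_f[OF bij_is_inj[OF e]])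
  then show ?case by (simp only: swapidseq.id)
next
  case (comp_Suc n p a b)
  have "inv e \<circ> (Transposition.transpose a b \<circ> p) \<circ> e = Transposition.transpose (inv e a) (inv e b) \<circ> (inv e \<circ> p \<circ> e)"
    using e by (auto simp: fun_eq_iff Transposition.transpose_def bij_is_surj surj_f_inv_f dest!: arg_cong[where f=e])
  moreover have "inv e a \<noteq> inv e b"
    using comp_Suc(2) e by (metis bij_is_surj surj_f_inv_f)
  ultimately show ?case using swapidseq.comp_Suc[OF comp_Suc.IH] by metis
qed

text \<open>Conjugation by \<open>e\<close> carries the permutations of one index type to those of
  the other and preserves their sign, because it maps transpositions to transpositions.\<close>

lemma det_relabel:
  fixes A :: "real^'n::finite^'n" and e :: "'k::finite \<Rightarrow> 'n"
  assumes e: "bij e"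
  shows "det (\<chi> i j. A $ e i $ e j) = det A"
proof -
  have s: "sign (inv e \<circ> p \<circ> e) = sign p" if "p permutes UNIV" for p
  proof -
    have "permutation p"
      unfolding permutation_permutes by (rule exI[of _ UNIV]) (simp add: that)
    then obtain n where n: "swapidseq n p" unfolding permutation_def by blast
    show ?thesis
      using evenperm_unique[OF n refl] evenperm_unique[OF swapidseq_conjugate[OF e n] refl]
      by (simp add: sign_def)
  qed
  have bij: "bij_betw (\<lambda>p. inv e \<circ> p \<circ> e) {p. p permutes (UNIV :: 'n set)} {q. q permutes (UNIV :: 'k set)}"
  proof (rule bij_betwI[where g = "\<lambda>q. e \<circ> q \<circ> inv e"])
    have ie: "bij (inv e)" using e by (rule bij_imp_bij_inv)
    show "(\<lambda>p. inv e \<circ> p \<circ> e) \<in> {p. p permutes UNIV} \<rightarrow> {q. q permutes UNIV}"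
      using e ie by (auto intro!: bij_imp_permutes bij_comp dest: permutes_bij)
    show "(\<lambda>q. e \<circ> q \<circ> inv e) \<in> {q. q permutes UNIV} \<rightarrow> {p. p permutes UNIV}"
      using e ie by (auto intro!: bij_imp_permutes bij_comp dest: permutes_bij)
  qed (use e in \<open>auto simp: fun_eq_iff bij_is_surj surj_f_inv_f bij_is_inj\<close>)
  have "det (\<chi> i j. A $ e i $ e j) = (\<Sum>q | q permutes (UNIV :: 'k set). of_int (sign q) * (\<Prod>i\<in>UNIV. A $ e i $ e (q i)))"
    by (simp add: det_def)
  also have "\<dots> = (\<Sum>p | p permutes (UNIV :: 'n set). of_int (sign (inv e \<circ> p \<circ> e)) * (\<Prod>i\<in>UNIV. A $ e i $ e ((inv e \<circ> p \<circ> e) i)))"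
    by (rule sum.reindex_bij_betw[OF bij, symmetric])
  also have "\<dots> = det A"
    unfolding det_def
  proof (rule sum.cong[OF refl])
    fix p assume p: "p \<in> {p. p permutes (UNIV :: 'n set)}"
    have "(\<Prod>i\<in>UNIV. A $ e i $ e ((inv e \<circ> p \<circ> e) i)) = (\<Prod>i\<in>UNIV. A $ e i $ p (e i))"
      using e by (simp add: bij_is_surj surj_f_inv_f)
    also have "\<dots> = (\<Prod>i\<in>UNIV. A $ i $ p i)"
      using e by (rule prod.reindex_bij_betw)
    finally show "of_int (sign (inv e \<circ> p \<circ> e)) * (\<Prod>i\<in>UNIV. A $ e i $ e ((inv e \<circ> p \<circ> e) i))
      = of_int (sign p) * (\<Prod>i\<in>UNIV. A $ i $ p i)"
      using s p by simp
  qed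
  finally show ?thesis .
qed

lemma matrix_relabel:
  fixes e :: "'k::finite \<Rightarrow> 'n::finite" and g' :: "real^'n \<Rightarrow> real^'n"
  assumes "bij e"
  shows "matrix (\<lambda>h. relabel e (g' (relabel (inv e) h))) = (\<chi> i j. matrix g' $ e i $ e j)"
proof -
  have "relabel (inv e) (axis j 1) = axis (e j) 1" for j
    using assms by (auto simp: vec_eq_iff axis_def bij_is_surj surj_f_inv_f bij_is_inj)
  then show ?thesis by (simp add: matrix_def)
qed

lemma has_derivative_relabel_conjugate:
  assumes e: "bij e" and "(g has_derivative g') (at (relabel (inv e) y))"
  shows "((\<lambda>y. relabel e (g (relabel (inv e) y))) has_derivative (\<lambda>h. relabel e (g' (relabel (inv e) h)))) (at y)"
  by (rule has_derivative_compose[OF has_derivative_compose[OF has_derivative_relabel assms(2)] has_derivative_relabel])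

lemma has_integral_change_of_variables_wellorder:
  fixes f :: "real^'m::{finite,wellorder} \<Rightarrow> real" and g :: "real^'m::_ \<Rightarrow> real^'m::_"
  assumes S: "S \<in> sets lebesgue" and der: "\<And>x. x \<in> S \<Longrightarrow> (g has_derivative g' x) (at x within S)"
    and inj: "inj_on g S" and f: "f absolutely_integrable_on g ` S"
  shows "((\<lambda>x. \<bar>det (matrix (g' x))\<bar> * f (g x)) has_integral integral (g ` S) f) S"
proof -
  \<comment> \<open>The transformation formula used below is for vector valued integrands;
    \<open>real^1\<close> carries the real valued one.\<close>
  have bv: "bounded_linear (vec :: real \<Rightarrow> real^1)"
    by (intro linear_conv_bounded_linear[THEN iffD1] linearI) (auto simp: vec_eq_iff)
  define F where "F = (vec :: real \<Rightarrow> real^1) \<circ> f"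
  define w where "w = (\<lambda>x. \<bar>det (matrix (g' x))\<bar> *\<^sub>R F (g x))"
  have "F absolutely_integrable_on g ` S"
    unfolding F_def using f bv by (rule absolutely_integrable_linear)
  then have *: "w absolutely_integrable_on S" "integral S w = integral (g ` S) F"
    using has_absolute_integral_change_of_variables[OF S der inj, of F "integral (g ` S) F"] unfolding w_def by auto
  have "(w has_integral integral (g ` S) F) S"
    using * set_lebesgue_integral_eq_integral(1) by (metis has_integral_integral)
  then have "((\<lambda>x. w x $ 1) has_integral integral (g ` S) F $ 1) S"
    by (drule_tac has_integral_linear[OF _ bounded_linear_vec_nth[of 1]]) (simp add: o_def)
  moreover have "integral (g ` S) F = vec (integral (g ` S) f)"
    unfolding F_def using f bv set_lebesgue_integral_eq_integral(1) integral_linear by blast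
  ultimately show ?thesis by (simp add: w_def F_def)
qed

text \<open>Domain, map and integrand are conjugated by a relabelling, which preserves integrals and
  determinants. Since \<open>f\<close> is 0 off the image of \<open>S\<close>, its integral can be
  taken over the whole space.\<close>

lemma has_integral_change_of_variables:
  fixes g :: "real^'n::finite \<Rightarrow> real^'n" and f :: "real^'n \<Rightarrow> real"
  assumes S: "open S" "bounded S" and der: "\<And>x. x \<in> S \<Longrightarrow> (g has_derivative g' x) (at x)"
    and inj: "inj_on g S" and gS: "bounded (g ` S)"
    and f: "continuous_on UNIV f" "\<And>y. y \<notin> g ` S \<Longrightarrow> f y = 0"
  shows "((\<lambda>x. if x \<in> S then \<bar>det (matrix (g' x))\<bar> * f (g x) else 0) has_integral integral UNIV f) UNIV"
proof -
  obtain e :: "'n idx \<Rightarrow> 'n" where e: "bij e" using ex_bij_idx by blast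
  have ie: "bij (inv e)" "inv (inv e) = e" using e by (auto simp: bij_imp_bij_inv inv_inv_eq)
  define G where "G = (\<lambda>y. relabel e (g (relabel (inv e) y)))"
  define G' where "G' = (\<lambda>y h. relabel e (g' (relabel (inv e) y) (relabel (inv e) h)))"
  define f2 where "f2 = (\<lambda>y. f (relabel (inv e) y))"
  define S2 where "S2 = relabel e ` S"
  have S2: "y \<in> S2 \<longleftrightarrow> relabel (inv e) y \<in> S" for y
    unfolding S2_def by (rule mem_relabel_image[OF e])
  have imG: "G ` S2 = relabel e ` g ` S"
    unfolding S2_def G_def by (simp add: image_image relabel_inverse[OF e])
  have GS2: "y \<in> G ` S2 \<longleftrightarrow> relabel (inv e) y \<in> g ` S" for y
    unfolding imG by (rule mem_relabel_image[OF e])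
  have "open ((\<lambda>y. relabel (inv e) y) -` S)"
    using S(1) by (intro open_vimage continuous_intros)
  also have "(\<lambda>y. relabel (inv e) y) -` S = S2" using S2 by auto
  finally have oS2: "open S2" .
  have bl: "bounded (relabel e ` B)" if "bounded B" for B :: "(real^'n) set"
    using that by (intro bounded_linear_image linear_relabel linear_conv_bounded_linear[THEN iffD1])
  have derG: "(G has_derivative G' y) (at y within S2)" if "y \<in> S2" for y
    unfolding G_def G'_def using has_derivative_relabel_conjugate[OF e der[OF S2[THEN iffD1, OF that]]]
    by (rule has_derivative_at_withinI)
  have injG: "inj_on G S2"
  proof (rule inj_onI)
    fix x y assume xy: "x \<in> S2" "y \<in> S2" "G x = G y"
    then have "g (relabel (inv e) x) = g (relabel (inv e) y)"
      unfolding G_def by (metis relabel_inverse(1)[OF e])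
    then have "relabel (inv e) x = relabel (inv e) y" using inj xy S2 by (auto dest: inj_onD)
    then show "x = y" by (metis relabel_inverse(2)[OF e])
  qed
  have f20: "f2 y = 0" if "y \<notin> G ` S2" for y using that GS2 f(2) by (simp add: f2_def)
  have GSb: "bounded (G ` S2)"
    using bl[OF gS] imG by simp
  have if2: "integrable lborel f2"
    by (rule integrable_continuous_bounded_support[OF _ GSb f20])
      (auto simp: f2_def intro!: continuous_intros continuous_on_compose2[OF f(1)])
  have intf: "(f has_integral integral UNIV f) UNIV"
    using integrable_on_lborel[OF integrable_continuous_bounded_support[OF f(1) gS f(2)]] by (simp add: has_integral_integral)
  have f2c: "(f2 has_integral integral UNIV f) UNIV"
    unfolding f2_def by (rule has_integral_relabel[OF ie(1) intf gS f(2)])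
  have "(\<lambda>x. if x \<in> G ` S2 then f2 x else 0) = f2" using f20 by auto
  moreover have "f2 absolutely_integrable_on UNIV"
    using if2 integrable_completion[of f2 lborel] by (simp add: set_integrable_def)
  ultimately have "f2 absolutely_integrable_on G ` S2" "integral (G ` S2) f2 = integral UNIV f"
    using absolutely_integrable_restrict_UNIV[of "G ` S2" f2] integral_restrict_UNIV[of "G ` S2" f2] f2c
    by (simp_all add: integral_unique)
  then have "((\<lambda>x. \<bar>det (matrix (G' x))\<bar> * f2 (G x)) has_integral integral UNIV f) S2"
    using has_integral_change_of_variables_wellorder[OF _ derG injG, of f2] oS2 by simp
  then have "((\<lambda>x. if x \<in> S2 then \<bar>det (matrix (G' x))\<bar> * f2 (G x) else 0) has_integral integral UNIV f) UNIV"
    by (simp only: has_integral_restrict_UNIV)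
  from has_integral_relabel[OF e this, of S2]
  have "((\<lambda>x. if relabel e x \<in> S2 then \<bar>det (matrix (G' (relabel e x)))\<bar> * f2 (G (relabel e x)) else 0) has_integral integral UNIV f) UNIV"
    using bl[OF S(2)] by (simp add: S2_def)
  moreover have "det (matrix (G' (relabel e x))) = det (matrix (g' x))" for x
    unfolding G'_def using matrix_relabel[OF e, of "g' x"] det_relabel[OF e] relabel_inverse[OF e] by simp
  moreover have "relabel e x \<in> S2 \<longleftrightarrow> x \<in> S" for x using S2 relabel_inverse[OF e] by simp
  ultimately show ?thesis using relabel_inverse[OF e] by (simp add: f2_def G_def)
qed

text \<open>This is the equal dimension case of Sard's theorem, in which mere differentiability is
  enough.\<close>

lemma negligible_critical_values:
  fixes g :: "real^'n::finite \<Rightarrow> real^'n"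
  assumes der: "\<And>x. x \<in> S \<Longrightarrow> (g has_derivative g' x) (at x)"
    and crit: "\<And>x. x \<in> S \<Longrightarrow> det (matrix (g' x)) = 0"
  shows "negligible (g ` S)"
proof -
  obtain e :: "'n idx \<Rightarrow> 'n" where e: "bij e" using ex_bij_idx by blast
  define G where "G = (\<lambda>y. relabel e (g (relabel (inv e) y)))"
  define G' where "G' = (\<lambda>y h. relabel e (g' (relabel (inv e) y) (relabel (inv e) h)))"
  have "negligible (G ` relabel e ` S)"
  proof (rule baby_Sard[where f' = G'])
    fix y assume y: "y \<in> relabel e ` S"
    then have yS: "relabel (inv e) y \<in> S" using relabel_inverse[OF e] by auto
    show "(G has_derivative G' y) (at y within relabel e ` S)"
      unfolding G_def G'_def using has_derivative_relabel_conjugate[OF e der[OF yS]]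
      by (rule has_derivative_at_withinI)
    have "det (matrix (G' y)) = 0"
      unfolding G'_def using matrix_relabel[OF e, of "g' (relabel (inv e) y)"] det_relabel[OF e] crit[OF yS] by simp
    then show "rank (matrix (G' y)) < CARD('n idx)" by (simp add: det_eq_0_rank)
  qed simp
  then have "negligible (relabel (inv e) ` (G ` relabel e ` S))"
  proof (rule negligible_differentiable_image_negligible[rotated])
    have "card (UNIV :: 'n idx set) = CARD('n)"
      using e by (rule bij_betw_same_card)
    then show "DIM(real^'n idx) \<le> DIM(real^'n)" by simp
    show "relabel (inv e) differentiable_on G ` relabel e ` S"
      unfolding differentiable_on_def differentiable_def using has_derivative_relabel by blast
  qed
  moreover have "relabel (inv e) ` (G ` relabel e ` S) = g ` S"
    unfolding G_def by (simp add: image_image relabel_inverse[OF e])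
  ultimately show ?thesis by simp
qed

section \<open>The Heinz integral counts regular zeros\<close>

lemma has_derivative_vec_lambda:
  fixes f :: "'n::finite \<Rightarrow> 'a::real_normed_vector \<Rightarrow> real"
  assumes "\<And>i. (f i has_derivative f' i) (at x within S)"
  shows "((\<lambda>x. \<chi> i. f i x) has_derivative (\<lambda>h. \<chi> i. f' i h)) (at x within S)"
  using assms by (subst has_derivative_componentwise_within) (auto simp: Basis_vec_def inner_axis)

text \<open>Row \<open>i\<close> of the Jacobian matrix is the gradient of the \<open>i\<close>-th
  coordinate, and its derivative is read off \<open>g''\<close>. This brings a \<open>C2_on\<close>
  map into the form on which Heinz's integral operates.\<close>

lemma C2_onD:
  fixes g :: "real^'n::finite \<Rightarrow> real^'n"
  assumes C2: "C2_on U g" and U: "open U"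
  shows "\<exists>H. \<forall>i. grad2 U (\<lambda>x. g x $ i) (\<lambda>x. jacobian g (at x) $ i) (H i)"
    and "x \<in> U \<Longrightarrow> (g has_derivative (\<lambda>h. jacobian g (at x) *v h)) (at x)"
proof -
  obtain g' g'' where g': "\<And>x. x \<in> U \<Longrightarrow> (g has_derivative blinfun_apply (g' x)) (at x)"
    and g'': "\<And>x. x \<in> U \<Longrightarrow> (g' has_derivative blinfun_apply (g'' x)) (at x)"
    and cont: "continuous_on U g''"
    using C2 unfolding C2_on_def by blast
  have J: "jacobian g (at x) = matrix (blinfun_apply (g' x))" if "x \<in> U" for x
    unfolding jacobian_def using frechet_derivative_at[OF g'[OF that]] by simp
  have Jv: "jacobian g (at x) *v h = blinfun_apply (g' x) h" if "x \<in> U" for x h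
    unfolding J[OF that]
    by (rule matrix_works) (simp add: blinfun.bounded_linear_right linear_matrix_vector_mul_eq bounded_linear.linear)
  then show der: "(g has_derivative (\<lambda>h. jacobian g (at x) *v h)) (at x)" if "x \<in> U" for x
    using g'[OF that] that by simp
  \<comment> \<open>The column index \<open>c\<close> is the direction of the second
    differentiation, so that \<open>H i x *v h\<close> is the derivative of the gradient along
    \<open>h\<close>.\<close>
  define H where "H = (\<lambda>i x. \<chi> r c. blinfun_apply (blinfun_apply (g'' x) (axis c 1)) (axis r 1) $ i)"
  have "grad2 U (\<lambda>x. g x $ i) (\<lambda>x. jacobian g (at x) $ i) (H i)" for i
    unfolding grad2_def
  proof (intro conjI ballI)
    fix x assume x: "x \<in> U"
    have "((\<lambda>x. g x $ i) has_derivative (\<lambda>h. (jacobian g (at x) *v h) $ i)) (at x)"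
      by (rule bounded_linear.has_derivative[OF bounded_linear_vec_nth der[OF x]])
    then show "((\<lambda>x. g x $ i) has_derivative (\<lambda>h. jacobian g (at x) $ i \<bullet> h)) (at x)"
      by (simp add: matrix_vector_mul_component)
    have "((\<lambda>x. \<chi> j. blinfun_apply (g' x) (axis j 1) $ i) has_derivative
       (\<lambda>h. \<chi> j. blinfun_apply (blinfun_apply (g'' x) h) (axis j 1) $ i)) (at x)"
    proof (rule has_derivative_vec_lambda)
      fix j
      have "((\<lambda>x. blinfun_apply (g' x) (axis j 1)) has_derivative
          (\<lambda>h. blinfun_apply (blinfun_apply (g'' x) h) (axis j 1))) (at x)"
        using bounded_bilinear.FDERIV[OF bounded_bilinear_blinfun_apply g''[OF x] has_derivative_const[of "axis j 1"]]
        by (simp add: blinfun.zero_right)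
      then show "((\<lambda>x. blinfun_apply (g' x) (axis j 1) $ i) has_derivative
          (\<lambda>h. blinfun_apply (blinfun_apply (g'' x) h) (axis j 1) $ i)) (at x)"
        by (rule bounded_linear.has_derivative[OF bounded_linear_vec_nth])
    qed
    moreover have "(\<chi> j. blinfun_apply (blinfun_apply (g'' x) h) (axis j 1) $ i) = H i x *v h" for h
    proof -
      have "h = (\<Sum>c\<in>UNIV. h $ c *\<^sub>R axis c 1)"
        using basis_expansion[of h] by (simp add: scalar_mult_eq_scaleR)
      then have "blinfun_apply (g'' x) h = (\<Sum>c\<in>UNIV. h $ c *\<^sub>R blinfun_apply (g'' x) (axis c 1))"
        by (metis (mono_tags, lifting) blinfun.scaleR_right blinfun.sum_right sum.cong)
      then show ?thesis
        by (simp add: vec_eq_iff H_def matrix_vector_mult_def blinfun.sum_left blinfun.scaleR_left mult.commute)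
    qed
    ultimately have "((\<lambda>x. \<chi> j. blinfun_apply (g' x) (axis j 1) $ i) has_derivative (\<lambda>h. H i x *v h)) (at x)"
      by simp
    then show "((\<lambda>x. jacobian g (at x) $ i) has_derivative (\<lambda>h. H i x *v h)) (at x)"
      by (rule has_derivative_transform_within_open[OF _ U x]) (simp add: J matrix_def vec_eq_iff)
  next
    show "continuous_on U (H i)"
      unfolding H_def by (intro continuous_intros cont)
  qed
  then show "\<exists>H. \<forall>i. grad2 U (\<lambda>x. g x $ i) (\<lambda>x. jacobian g (at x) $ i) (H i)" by blast
qed

lemma C2_on_blinfun:
  fixes g :: "real^'n::finite \<Rightarrow> real^'n"
  assumes "C2_on U g"
  obtains g' where "\<And>x. x \<in> U \<Longrightarrow> (g has_derivative blinfun_apply (g' x)) (at x)" "continuous_on U g'"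
    "\<And>x. x \<in> U \<Longrightarrow> jacobian g (at x) = matrix (blinfun_apply (g' x))"
proof -
  obtain g' g'' where g': "\<And>x. x \<in> U \<Longrightarrow> (g has_derivative blinfun_apply (g' x)) (at x)"
    and g'': "\<And>x. x \<in> U \<Longrightarrow> (g' has_derivative blinfun_apply (g'' x)) (at x)"
    using assms unfolding C2_on_def by blast
  show thesis
  proof (rule that[OF g'])
    show "continuous_on U g'"
      by (rule continuous_at_imp_continuous_on) (use g'' has_derivative_continuous in blast)
    show "jacobian g (at x) = matrix (blinfun_apply (g' x))" if "x \<in> U" for x
      unfolding jacobian_def using frechet_derivative_at[OF g'[OF that]] by simp
  qed
qed

abbreviation heinz_map :: "real \<Rightarrow> (real^'n::finite) set \<Rightarrow> (real^'n \<Rightarrow> real^'n) \<Rightarrow> real^'n \<Rightarrow> real" where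
  "heinz_map \<epsilon> U g \<equiv> heinz \<epsilon> U (\<lambda>i x. g x $ i) (\<lambda>i x. jacobian g (at x) $ i)"

definition bump_vec :: "real \<Rightarrow> real^'n::finite \<Rightarrow> real" where
  "bump_vec \<epsilon> y = (\<Prod>i\<in>UNIV. bump \<epsilon> (y $ i))"

lemma heinz_map_eq: "heinz_map \<epsilon> U g x = (if x \<in> U then bump_vec \<epsilon> (g x) * det (jacobian g (at x)) else 0)"
  by (simp add: heinz_eq_prod bump_vec_def)

text \<open>For positive \<open>\<epsilon>\<close> this is the set where
  \<open>bump_vec \<epsilon>\<close> is positive; it is a cube because the bump is a product over
  the coordinates.\<close>

definition open_cube :: "real \<Rightarrow> (real^'n::finite) set" where
  "open_cube \<epsilon> = {y. \<forall>i. \<bar>y $ i\<bar> < \<epsilon>}"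

lemma open_open_cube: "open (open_cube \<epsilon> :: (real^'n::finite) set)"
proof -
  have "open (\<Inter>i. {y :: real^'n. \<bar>y $ i\<bar> < \<epsilon>})"
    by (intro open_INT ballI open_Collect_less continuous_intros) simp
  also have "(\<Inter>i. {y :: real^'n. \<bar>y $ i\<bar> < \<epsilon>}) = open_cube \<epsilon>" by (auto simp: open_cube_def)
  finally show ?thesis .
qed

lemma open_cube_subset_ball:
  assumes "r > 0"
  shows "open_cube (r / CARD('n)) \<subseteq> ball (0 :: real^'n::finite) r"
proof
  fix y :: "real^'n" assume y: "y \<in> open_cube (r / CARD('n))"
  show "y \<in> ball 0 r"
  proof (rule ccontr)
    assume "y \<notin> ball 0 r"
    then have "norm y \<ge> r" by simp
    from exists_large_component[OF this] obtain i where "r / CARD('n) \<le> \<bar>y $ i\<bar>" by blast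
    moreover have "\<bar>y $ i\<bar> < r / CARD('n)" using y by (simp add: open_cube_def)
    ultimately show False by simp
  qed
qed

lemma open_cube_mono: "\<epsilon> \<le> \<epsilon>' \<Longrightarrow> open_cube \<epsilon> \<subseteq> open_cube \<epsilon>'"
  unfolding open_cube_def by (auto intro: less_le_trans)

lemma bounded_open_cube: "bounded (open_cube \<epsilon> :: (real^'n::finite) set)"
proof -
  have "\<bar>\<epsilon>\<bar> + 1 > 0" by linarith
  then have "open_cube (\<bar>\<epsilon>\<bar> + 1) \<subseteq> ball (0 :: real^'n) ((\<bar>\<epsilon>\<bar> + 1) * CARD('n))"
    using open_cube_subset_ball[where 'n='n, of "(\<bar>\<epsilon>\<bar> + 1) * CARD('n)"] by simp
  moreover have "open_cube \<epsilon> \<subseteq> (open_cube (\<bar>\<epsilon>\<bar> + 1) :: (real^'n) set)" by (rule open_cube_mono) simp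
  ultimately have "open_cube \<epsilon> \<subseteq> ball (0 :: real^'n) ((\<bar>\<epsilon>\<bar> + 1) * CARD('n))" by (rule order_trans[rotated])
  then show ?thesis using bounded_ball bounded_subset by blast
qed

lemma bump_vec_eq_0: "\<epsilon> > 0 \<Longrightarrow> y \<notin> open_cube \<epsilon> \<Longrightarrow> bump_vec \<epsilon> y = 0"
  unfolding bump_vec_def open_cube_def using bump_eq_0[of \<epsilon>] by (auto simp: not_less)

lemma continuous_on_bump_vec: "continuous_on S (bump_vec \<epsilon>)"
  unfolding bump_vec_def by (intro continuous_intros)

text \<open>A zero integral would force the continuous nonnegative integrand to vanish at 0. The
  value is never computed: it is the common factor of all signed counts and only has to be
  cancelled.\<close>

lemma integral_bump_vec_pos:
  assumes "\<epsilon> > 0"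
  shows "integral UNIV (bump_vec \<epsilon> :: real^'n::finite \<Rightarrow> real) > 0"
proof -
  let ?f = "bump_vec \<epsilon> :: real^'n \<Rightarrow> real"
  have "integrable lborel ?f"
    by (rule integrable_continuous_bounded_support[OF continuous_on_bump_vec bounded_open_cube])
      (use bump_vec_eq_0[OF assms] in auto)
  then have int: "(?f has_integral integral UNIV ?f) UNIV"
    by (intro integrable_integral integrable_on_lborel)
  have nonneg: "?f y \<ge> 0" for y unfolding bump_vec_def by (intro prod_nonneg ballI bump_nonneg)
  have "integral UNIV ?f \<ge> 0" by (rule has_integral_nonneg[OF int nonneg])
  moreover have "integral UNIV ?f \<noteq> 0"
  proof
    assume 0: "integral UNIV ?f = 0"
    let ?a = "\<chi> i. - \<epsilon> :: real^'n" and ?b = "\<chi> i. \<epsilon> :: real^'n"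
    have "?f y = 0" if y: "y \<notin> cbox ?a ?b" for y
    proof (rule bump_vec_eq_0[OF assms], rule notI)
      assume "y \<in> open_cube \<epsilon>"
      then have ab: "\<bar>y $ i\<bar> < \<epsilon>" for i by (simp add: open_cube_def)
      have "- \<epsilon> \<le> y $ i \<and> y $ i \<le> \<epsilon>" for i using ab[of i] by linarith
      then show False using y by (simp add: mem_box_cart)
    qed
    then have "(\<lambda>y. if y \<in> cbox ?a ?b then ?f y else 0) = ?f" by auto
    then have "(?f has_integral 0) (cbox ?a ?b)"
      using int 0 has_integral_restrict_UNIV[of "cbox ?a ?b" ?f 0] by simp
    moreover have "box ?a ?b \<noteq> {}" using assms by (auto simp: interval_eq_empty_cart not_le)
    moreover have "(0::real^'n) \<in> cbox ?a ?b" using assms by (simp add: mem_box_cart)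
    ultimately have "?f 0 = 0"
      using has_integral_0_cbox_imp_0[of ?a ?b ?f] continuous_on_bump_vec nonneg by blast
    moreover have "?f 0 > 0" unfolding bump_vec_def using bump_pos[of 0 \<epsilon>] assms by simp
    ultimately show False by simp
  qed
  ultimately show ?thesis by simp
qed

lemma finite_set_separated:
  fixes Z :: "'a::metric_space set"
  assumes "finite Z"
  obtains r where "r > 0" "\<And>x y. x \<in> Z \<Longrightarrow> y \<in> Z \<Longrightarrow> x \<noteq> y \<Longrightarrow> 2 * r \<le> dist x y"
proof -
  have "\<forall>a. \<exists>d>0. \<forall>x\<in>Z. x \<noteq> a \<longrightarrow> d \<le> dist a x"
    using finite_set_avoid[OF assms] by blast
  then obtain d where d: "\<And>a. d a > 0" "\<And>a x. x \<in> Z \<Longrightarrow> x \<noteq> a \<Longrightarrow> d a \<le> dist a x" by metis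
  \<comment> \<open>The inserted 1 covers the case of empty \<open>Z\<close>; the halving makes
    balls of radius \<open>r\<close> around the points of \<open>Z\<close> disjoint.\<close>
  define r where "r = Min (insert 1 (d ` Z)) / 2"
  have "r > 0" using assms d(1) by (simp add: r_def)
  moreover have "2 * r \<le> dist x y" if "x \<in> Z" "y \<in> Z" "x \<noteq> y" for x y
  proof -
    have "2 * r \<le> d x" using assms that by (simp add: r_def)
    also have "\<dots> \<le> dist x y" using d(2) that by auto
    finally show ?thesis .
  qed
  ultimately show thesis using that by blast
qed

text \<open>The inverse function theorem yields a neighbourhood on which the map is injective and
  open; cutting it down to the open set \<open>P\<close> fixes the sign of the determinant, and to
  the ball its size.\<close>

lemma local_diffeomorphism:
  fixes g :: "real^'n::finite \<Rightarrow> real^'n"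
  assumes U: "open U" and C2: "C2_on U g" and z: "z \<in> U" and reg: "det (jacobian g (at z)) \<noteq> 0" and r: "r > 0"
  obtains V where "open V" "V \<subseteq> U" "V \<subseteq> ball z r" "z \<in> V" "inj_on g V" "open (g ` V)"
    "\<And>x. x \<in> V \<Longrightarrow> sgn (det (jacobian g (at x))) = sgn (det (jacobian g (at z)))"
proof -
  obtain g' where g': "\<And>x. x \<in> U \<Longrightarrow> (g has_derivative blinfun_apply (g' x)) (at x)"
    and cont: "continuous_on U g'" and J: "\<And>x. x \<in> U \<Longrightarrow> jacobian g (at x) = matrix (blinfun_apply (g' x))"
    using C2_on_blinfun[OF C2] by blast
  have lin: "linear (blinfun_apply (g' z))"
    by (simp add: blinfun.bounded_linear_right bounded_linear.linear)
  have "inj (blinfun_apply (g' z))"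
    using reg det_nz_iff_inj[OF lin] J[OF z] by simp
  then obtain k where k: "linear k" "k \<circ> blinfun_apply (g' z) = id"
    using linear_injective_left_inverse[OF lin] by blast
  have inv: "Blinfun k o\<^sub>L g' z = id_blinfun"
    using k by (intro blinfun_eqI) (simp add: bounded_linear_Blinfun_apply linear_conv_bounded_linear o_def fun_eq_iff)
  obtain U' W h h' where U': "open U'" "U' \<subseteq> U" "z \<in> U'" "open W" "homeomorphism U' W g h"
    using inverse_function_theorem[OF U g' cont z inv] by metis
  obtain H where H: "\<And>i. grad2 U (\<lambda>x. g x $ i) (\<lambda>x. jacobian g (at x) $ i) (H i)"
    using C2_onD(1)[OF C2 U] by blast
  have "continuous_on U (\<lambda>x. det (\<chi> i. jacobian g (at x) $ i))"
    by (intro continuous_on_det_rows grad2D(4)[OF H])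
  then have cdet: "continuous_on U (\<lambda>x. det (jacobian g (at x)) * det (jacobian g (at z)))"
    by (intro continuous_intros) simp
  define P where "P = {x \<in> U. det (jacobian g (at x)) * det (jacobian g (at z)) > 0}"
  have "openin (top_of_set U) (U \<inter> (\<lambda>x. det (jacobian g (at x)) * det (jacobian g (at z))) -` {0<..})"
    using cdet by (rule continuous_openin_preimage_gen) simp
  also have "U \<inter> (\<lambda>x. det (jacobian g (at x)) * det (jacobian g (at z))) -` {0<..} = P"
    by (auto simp: P_def)
  finally have "open P" using U openin_open_eq by blast
  define V where "V = U' \<inter> P \<inter> ball z r"
  have V: "open V" "V \<subseteq> U'" using U'(1) \<open>open P\<close> by (auto simp: V_def)
  show thesis
  proof
    show "open V" by fact
    show "V \<subseteq> U" "V \<subseteq> ball z r" using U' by (auto simp: V_def)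
    show "z \<in> V" using U' r z reg by (simp add: V_def P_def) (metis linorder_neqE_linordered_idom mult_neg_neg mult_pos_pos)
    show "inj_on g V"
      using homeomorphism_apply1[OF U'(5)] V(2) by (intro inj_on_inverseI[where g=h]) blast
    have "openin (top_of_set W) (g ` V)"
      by (rule homeomorphism_imp_open_map[OF U'(5)]) (use V U'(1) openin_open_eq in blast)
    then show "open (g ` V)" using U'(4) openin_open_eq by blast
    show "sgn (det (jacobian g (at x))) = sgn (det (jacobian g (at z)))" if "x \<in> V" for x
      using that by (auto simp: V_def P_def zero_less_mult_iff)
  qed
qed

text \<open>The zeros form a compact set because none lies on the frontier, and each is isolated by
  local injectivity. Finiteness matters: a sum over an infinite set would be 0 by
  convention.\<close>

lemma finite_regular_zeros:
  fixes g :: "real^'n::finite \<Rightarrow> real^'n"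
  assumes U: "open U" "bounded U" and cont: "continuous_on (closure U) g" and C2: "C2_on U g"
    and nz: "\<And>x. x \<in> frontier U \<Longrightarrow> g x \<noteq> 0" and reg: "regular_value_on U g 0"
  shows "finite {x \<in> U. g x = 0}"
proof -
  define Z where "Z = {x \<in> U. g x = 0}"
  have "Z = {x \<in> closure U. g x = 0}"
    using nz U(1) closure_subset[of U] by (auto simp: Z_def frontier_def interior_open)
  moreover have "closed {x \<in> closure U. g x = 0}"
    by (rule continuous_closed_preimage_constant[OF cont closed_closure])
  moreover have "bounded Z" using U(2) by (rule bounded_subset) (auto simp: Z_def)
  ultimately have "compact Z" by (simp add: compact_eq_bounded_closed)
  have "\<exists>V. open V \<and> z \<in> V \<and> Z \<inter> V \<subseteq> {z}" if z: "z \<in> Z" for z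
  proof -
    have "z \<in> U" "det (jacobian g (at z)) \<noteq> 0" using reg z by (auto simp: regular_value_on_def Z_def)
    then obtain V where "open V" "z \<in> V" "inj_on g V"
      using local_diffeomorphism[OF U(1) C2, of z 1] by (metis zero_less_one)
    moreover from this have "y = z" if "y \<in> Z" "y \<in> V" for y
      using inj_onD[of g V y z] that z by (simp add: Z_def)
    ultimately show ?thesis by (intro exI[of _ V]) auto
  qed
  then obtain V where V: "\<And>z. z \<in> Z \<Longrightarrow> open (V z) \<and> z \<in> V z \<and> Z \<inter> V z \<subseteq> {z}" by metis
  obtain T where T: "T \<subseteq> Z" "finite T" "Z \<subseteq> (\<Union>z\<in>T. V z)"
    using compactE_image[OF \<open>compact Z\<close>, of Z V] V by blast
  have "Z \<subseteq> T" using T V by blast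
  then show ?thesis using T(2) finite_subset unfolding Z_def by blast
qed

text \<open>For small \<open>\<epsilon>\<close> the integrand lives on disjoint neighbourhoods
  \<open>S z\<close> of the zeros, each mapped bijectively onto the cube
  \<open>open_cube \<epsilon>\<close>. By change of variables each contributes the integral of
  \<open>bump_vec \<epsilon>\<close> times the sign of its determinant.\<close>

lemma heinz_eq_signed_count:
  fixes g :: "real^'n::finite \<Rightarrow> real^'n"
  assumes U: "open U" "bounded U" and cont: "continuous_on (closure U) g" and C2: "C2_on U g"
    and nz: "\<And>x. x \<in> frontier U \<Longrightarrow> g x \<noteq> 0" and reg: "regular_value_on U g 0"
  shows "\<exists>\<epsilon>0>0. \<forall>\<epsilon>. 0 < \<epsilon> \<longrightarrow> \<epsilon> < \<epsilon>0 \<longrightarrow> integral\<^sup>L lborel (heinz_map \<epsilon> U g)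
     = integral UNIV (bump_vec \<epsilon> :: real^'n \<Rightarrow> real) * (\<Sum>x\<in>{x\<in>U. g x = 0}. sgn (det (jacobian g (at x))))"
proof -
  define Z where "Z = {x \<in> U. g x = 0}"
  have fin: "finite Z" unfolding Z_def by (rule finite_regular_zeros[OF assms])
  obtain r where r: "r > 0" "\<And>x y. x \<in> Z \<Longrightarrow> y \<in> Z \<Longrightarrow> x \<noteq> y \<Longrightarrow> 2 * r \<le> dist x y"
    using finite_set_separated[OF fin] by blast
  have "\<forall>z\<in>Z. \<exists>V. open V \<and> V \<subseteq> U \<and> V \<subseteq> ball z r \<and> z \<in> V \<and> inj_on g V \<and> open (g ` V) \<and>
     (\<forall>x\<in>V. sgn (det (jacobian g (at x))) = sgn (det (jacobian g (at z))))"
  proof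
    fix z assume z: "z \<in> Z"
    have "z \<in> U" "det (jacobian g (at z)) \<noteq> 0" using reg z by (auto simp: regular_value_on_def Z_def)
    from local_diffeomorphism[OF U(1) C2 this r(1)]
    show "\<exists>V. open V \<and> V \<subseteq> U \<and> V \<subseteq> ball z r \<and> z \<in> V \<and> inj_on g V \<and> open (g ` V) \<and>
      (\<forall>x\<in>V. sgn (det (jacobian g (at x))) = sgn (det (jacobian g (at z))))" by metis
  qed
  then have "\<exists>V. \<forall>z\<in>Z. open (V z) \<and> V z \<subseteq> U \<and> V z \<subseteq> ball z r \<and> z \<in> V z \<and> inj_on g (V z) \<and> open (g ` V z) \<and>
     (\<forall>x\<in>V z. sgn (det (jacobian g (at x))) = sgn (det (jacobian g (at z))))"
    by (rule bchoice)
  then obtain V where "\<forall>z\<in>Z. open (V z) \<and> V z \<subseteq> U \<and> V z \<subseteq> ball z r \<and> z \<in> V z \<and> inj_on g (V z) \<and> open (g ` V z) \<and>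
     (\<forall>x\<in>V z. sgn (det (jacobian g (at x))) = sgn (det (jacobian g (at z))))" ..
  then have V: "\<And>z. z \<in> Z \<Longrightarrow> open (V z)" "\<And>z. z \<in> Z \<Longrightarrow> V z \<subseteq> U" "\<And>z. z \<in> Z \<Longrightarrow> V z \<subseteq> ball z r"
    "\<And>z. z \<in> Z \<Longrightarrow> z \<in> V z" "\<And>z. z \<in> Z \<Longrightarrow> inj_on g (V z)" "\<And>z. z \<in> Z \<Longrightarrow> open (g ` V z)"
    "\<And>z x. z \<in> Z \<Longrightarrow> x \<in> V z \<Longrightarrow> sgn (det (jacobian g (at x))) = sgn (det (jacobian g (at z)))"
    by blast+
  have disj: "z = z'" if "z \<in> Z" "z' \<in> Z" "x \<in> V z" "x \<in> V z'" for x z z'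
  proof (rule ccontr)
    assume "z \<noteq> z'"
    then have "2 * r \<le> dist z z'" using r(2) that by blast
    moreover have "dist z x < r" "dist z' x < r" using V(3)[OF that(1)] V(3)[OF that(2)] that(3,4) by auto
    ultimately show False using dist_triangle2[of z z' x] by linarith
  qed
  have "\<exists>\<rho>>0. open_cube \<rho> \<subseteq> g ` V z" if z: "z \<in> Z" for z
  proof -
    have "0 \<in> g ` V z" using V(4)[OF z] z by (force simp: Z_def)
    then obtain s where "s > 0" "ball 0 s \<subseteq> g ` V z" using V(6)[OF z] open_contains_ball by blast
    then show ?thesis using open_cube_subset_ball[where 'n='n, of s] by (intro exI[of _ "s / CARD('n)"]) auto
  qed
  then obtain \<rho> where \<rho>: "\<And>z. z \<in> Z \<Longrightarrow> \<rho> z > 0" "\<And>z. z \<in> Z \<Longrightarrow> open_cube (\<rho> z) \<subseteq> g ` V z" by metis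
  \<comment> \<open>The compact remainder includes the frontier and contains no zero, so the norm of
    \<open>g\<close> is bounded below on it.\<close>
  define L where "L = closure U - (\<Union>z\<in>Z. V z)"
  have "compact L" unfolding L_def
    using U(2) V(1) by (intro compact_diff) (auto simp: compact_closure)
  have gL: "g x \<noteq> 0" if "x \<in> L" for x
  proof
    assume 0: "g x = 0"
    show False
    proof (cases "x \<in> U")
      case True
      then have "x \<in> Z" using 0 by (simp add: Z_def)
      then show False using V(4) that by (auto simp: L_def)
    next
      case False
      then show False using nz[of x] 0 that U(1) by (auto simp: L_def frontier_def interior_open)
    qed
  qed
  have "\<exists>\<delta>>0. \<forall>x\<in>L. \<delta> \<le> norm (g x)"
  proof (cases "L = {}")
    case False
    have "continuous_on L (\<lambda>x. norm (g x))"
      by (intro continuous_intros continuous_on_subset[OF cont]) (auto simp: L_def)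
    then obtain x where "x \<in> L" "\<forall>y\<in>L. norm (g x) \<le> norm (g y)"
      using continuous_attains_inf[OF \<open>compact L\<close> False] by blast
    then show ?thesis using gL by (intro exI[of _ "norm (g x)"]) auto
  qed (auto intro: exI[of _ 1])
  then obtain \<delta> where \<delta>: "\<delta> > 0" "\<And>x. x \<in> L \<Longrightarrow> \<delta> \<le> norm (g x)" by blast
  \<comment> \<open>Up to \<open>\<rho> z\<close> the cube lies in the image of \<open>V z\<close>;
    up to \<open>\<delta> / CARD('n)\<close> it misses the image of \<open>L\<close>.\<close>
  define \<epsilon>0 where "\<epsilon>0 = Min (insert (\<delta> / CARD('n)) (\<rho> ` Z))"
  have \<epsilon>0: "\<epsilon>0 > 0" "\<epsilon>0 \<le> \<delta> / CARD('n)" "\<And>z. z \<in> Z \<Longrightarrow> \<epsilon>0 \<le> \<rho> z"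
    using fin \<delta>(1) \<rho>(1) by (auto simp: \<epsilon>0_def)
  show ?thesis
  proof (intro exI[of _ \<epsilon>0] conjI allI impI)
    show "\<epsilon>0 > 0" by fact
    fix \<epsilon> :: real assume \<epsilon>: "0 < \<epsilon>" "\<epsilon> < \<epsilon>0"
    define c where "c = integral UNIV (bump_vec \<epsilon> :: real^'n \<Rightarrow> real)"
    define S where "S = (\<lambda>z. V z \<inter> g -` open_cube \<epsilon>)"
    have contU: "continuous_on U g" using cont closure_subset continuous_on_subset by blast
    have gS: "g ` S z = open_cube \<epsilon>" if z: "z \<in> Z" for z
      using open_cube_mono[of \<epsilon> "\<rho> z"] \<epsilon>(2) \<epsilon>0(3)[OF z] \<rho>(2)[OF z] unfolding S_def by fastforce
    have oS: "open (S z)" if z: "z \<in> Z" for z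
    proof -
      have "openin (top_of_set (V z)) (V z \<inter> g -` open_cube \<epsilon>)"
        by (rule continuous_openin_preimage_gen[OF continuous_on_subset[OF contU V(2)[OF z]] open_open_cube])
      then show ?thesis using V(1)[OF z] openin_open_eq unfolding S_def by blast
    qed
    have SU: "S z \<subseteq> U" if "z \<in> Z" for z using V(2)[OF that] by (auto simp: S_def)
    have piece: "((\<lambda>x. if x \<in> S z then \<bar>det (jacobian g (at x))\<bar> * bump_vec \<epsilon> (g x) else 0) has_integral c) UNIV"
      if z: "z \<in> Z" for z
    proof -
      have "((\<lambda>x. if x \<in> S z then \<bar>det (matrix (\<lambda>h. jacobian g (at x) *v h))\<bar> * bump_vec \<epsilon> (g x) else 0) has_integral c) UNIV"
        unfolding c_def
      proof (rule has_integral_change_of_variables[OF oS[OF z]])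
        show "bounded (S z)" using U(2) SU[OF z] bounded_subset by blast
        show "(g has_derivative (\<lambda>h. jacobian g (at x) *v h)) (at x)" if "x \<in> S z" for x
          using C2_onD(2)[OF C2 U(1)] SU[OF z] that by blast
        show "inj_on g (S z)" using V(5)[OF z] unfolding S_def by (rule inj_on_subset) auto
        show "bounded (g ` S z)" unfolding gS[OF z] by (rule bounded_open_cube)
        show "bump_vec \<epsilon> y = 0" if "y \<notin> g ` S z" for y
          using that unfolding gS[OF z] by (rule bump_vec_eq_0[OF \<epsilon>(1)])
      qed (rule continuous_on_bump_vec)
      then show ?thesis by simp
    qed
    \<comment> \<open>The change of variables involves the absolute value of the determinant; the
      constant sign on \<open>V z\<close> restores the determinant itself.\<close>
    have split: "heinz_map \<epsilon> U g x = (\<Sum>z\<in>Z. sgn (det (jacobian g (at z))) *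
       (if x \<in> S z then \<bar>det (jacobian g (at x))\<bar> * bump_vec \<epsilon> (g x) else 0))" for x
    proof (cases "\<exists>z\<in>Z. x \<in> S z")
      case True
      then obtain z where z: "z \<in> Z" "x \<in> S z" by blast
      have "(\<Sum>z\<in>Z. sgn (det (jacobian g (at z))) * (if x \<in> S z then \<bar>det (jacobian g (at x))\<bar> * bump_vec \<epsilon> (g x) else 0))
        = (\<Sum>z'\<in>Z. if z' = z then sgn (det (jacobian g (at z))) * (\<bar>det (jacobian g (at x))\<bar> * bump_vec \<epsilon> (g x)) else 0)"
        using z disj[OF z(1)] by (intro sum.cong) (auto simp: S_def)
      also have "\<dots> = sgn (det (jacobian g (at z))) * (\<bar>det (jacobian g (at x))\<bar> * bump_vec \<epsilon> (g x))"
        using fin z(1) by simp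
      also have "sgn (det (jacobian g (at z))) = sgn (det (jacobian g (at x)))"
        using V(7)[OF z(1), of x] z(2) by (simp add: S_def)
      also have "sgn (det (jacobian g (at x))) * (\<bar>det (jacobian g (at x))\<bar> * bump_vec \<epsilon> (g x))
         = det (jacobian g (at x)) * bump_vec \<epsilon> (g x)"
        by (metis mult.assoc sgn_mult_abs)
      finally show ?thesis using z SU by (auto simp: heinz_map_eq)
    next
      case False
      have "bump_vec \<epsilon> (g x) = 0" if xU: "x \<in> U"
      proof (rule bump_vec_eq_0[OF \<epsilon>(1)], rule notI)
        assume cube: "g x \<in> open_cube \<epsilon>"
        then have "x \<in> L" using False xU closure_subset[of U] by (auto simp: L_def S_def)
        then obtain i where "\<delta> / CARD('n) \<le> \<bar>g x $ i\<bar>" using exists_large_component \<delta>(2) by blast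
        moreover have "\<bar>g x $ i\<bar> < \<epsilon>" using cube by (simp add: open_cube_def)
        ultimately show False using \<epsilon> \<epsilon>0(2) by linarith
      qed
      then show ?thesis using False by (auto simp: heinz_map_eq)
    qed
    have "(heinz_map \<epsilon> U g has_integral (\<Sum>z\<in>Z. sgn (det (jacobian g (at z))) * c)) UNIV"
      unfolding split[abs_def] by (intro has_integral_sum[OF fin] has_integral_mult_right piece)
    \<comment> \<open>The sum was computed as a gauge integral; Lebesgue integrability identifies it
      with \<open>integral\<^sup>L\<close>.\<close>
    moreover have "integrable lborel (heinz_map \<epsilon> U g)"
    proof -
      obtain H where H: "\<And>i. grad2 U (\<lambda>x. g x $ i) (\<lambda>x. jacobian g (at x) $ i) (H i)"
        using C2_onD(1)[OF C2 U(1)] by blast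
      define K where "K = closure U \<inter> (\<Inter>i. {x \<in> closure U. \<bar>g x $ i\<bar> \<le> \<epsilon>})"
      have "closed {x \<in> closure U. \<bar>g x $ i\<bar> \<le> \<epsilon>}" for i
        by (intro continuous_on_closed_Collect_le continuous_intros cont) auto
      then have "compact K" unfolding K_def using U(2)
        by (intro compact_Int_closed closed_INT) (auto simp: compact_closure)
      moreover have "K \<subseteq> U"
      proof
        fix x assume x: "x \<in> K"
        show "x \<in> U"
        proof (rule ccontr)
          assume xU: "x \<notin> U"
          then have "x \<in> L" using x V(2) by (auto simp: K_def L_def)
          then obtain i where "\<delta> / CARD('n) \<le> \<bar>g x $ i\<bar>" using exists_large_component \<delta>(2) by blast
          moreover have "\<bar>g x $ i\<bar> \<le> \<epsilon>" using x by (simp add: K_def)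
          ultimately show False using \<epsilon> \<epsilon>0(2) by linarith
        qed
      qed
      moreover have "\<exists>i. \<epsilon> \<le> \<bar>g x $ i\<bar>" if "x \<in> U - K" for x
        using that closure_subset[of U] by (auto simp: K_def not_le intro: less_imp_le)
      ultimately show ?thesis by (rule integrable_heinz[OF U(1) H \<epsilon>(1)])
    qed
    ultimately have "integral\<^sup>L lborel (heinz_map \<epsilon> U g) = (\<Sum>z\<in>Z. sgn (det (jacobian g (at z))) * c)"
      using integral_lborel by (metis integral_unique)
    then show "integral\<^sup>L lborel (heinz_map \<epsilon> U g)
     = integral UNIV (bump_vec \<epsilon> :: real^'n \<Rightarrow> real) * (\<Sum>x\<in>{x\<in>U. g x = 0}. sgn (det (jacobian g (at x))))"
      by (simp add: c_def Z_def sum_distrib_left mult.commute)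
  qed
qed

section \<open>The Brouwer degree\<close>

text \<open>Both counts are read off Heinz integrals with the same small \<open>\<epsilon>\<close>.\<close>

lemma signed_count_homotopy:
  fixes g h :: "real^'n::finite \<Rightarrow> real^'n"
  assumes U: "open U" "bounded U"
    and g: "continuous_on (closure U) g" "C2_on U g" "regular_value_on U g 0"
    and h: "continuous_on (closure U) h" "C2_on U h" "regular_value_on U h 0"
    and nz: "\<And>t x. 0 \<le> t \<Longrightarrow> t \<le> 1 \<Longrightarrow> x \<in> frontier U \<Longrightarrow> (1 - t) *\<^sub>R g x + t *\<^sub>R h x \<noteq> 0"
  shows "(\<Sum>x\<in>{x\<in>U. g x = 0}. sgn (det (jacobian g (at x)))) = (\<Sum>x\<in>{x\<in>U. h x = 0}. sgn (det (jacobian h (at x))))"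
proof -
  have nzg: "g x \<noteq> 0" if "x \<in> frontier U" for x using nz[of 0 x] that by simp
  have nzh: "h x \<noteq> 0" if "x \<in> frontier U" for x using nz[of 1 x] that by simp
  obtain Hg where Hg: "\<And>i. grad2 U (\<lambda>x. g x $ i) (\<lambda>x. jacobian g (at x) $ i) (Hg i)"
    using C2_onD(1)[OF g(2) U(1)] by blast
  obtain Hh where Hh: "\<And>i. grad2 U (\<lambda>x. h x $ i) (\<lambda>x. jacobian h (at x) $ i) (Hh i)"
    using C2_onD(1)[OF h(2) U(1)] by blast
  obtain e1 where e1: "e1 > 0" "\<And>\<epsilon>. 0 < \<epsilon> \<Longrightarrow> \<epsilon> < e1 \<Longrightarrow> integral\<^sup>L lborel (heinz_map \<epsilon> U g)
     = integral UNIV (bump_vec \<epsilon> :: real^'n \<Rightarrow> real) * (\<Sum>x\<in>{x\<in>U. g x = 0}. sgn (det (jacobian g (at x))))"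
    using heinz_eq_signed_count[OF U g(1,2) nzg g(3)] by blast
  obtain e2 where e2: "e2 > 0" "\<And>\<epsilon>. 0 < \<epsilon> \<Longrightarrow> \<epsilon> < e2 \<Longrightarrow> integral\<^sup>L lborel (heinz_map \<epsilon> U h)
     = integral UNIV (bump_vec \<epsilon> :: real^'n \<Rightarrow> real) * (\<Sum>x\<in>{x\<in>U. h x = 0}. sgn (det (jacobian h (at x))))"
    using heinz_eq_signed_count[OF U h(1,2) nzh h(3)] by blast
  have "\<exists>i. (1 - t) * g x $ i + t * h x $ i \<noteq> 0" if "0 \<le> t" "t \<le> 1" "x \<in> frontier U" for t x
    using nz[OF that] by (auto simp: vec_eq_iff)
  moreover have "continuous_on (closure U) (\<lambda>x. g x $ i)" "continuous_on (closure U) (\<lambda>x. h x $ i)" for i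
    using g(1) h(1) by (auto intro!: continuous_intros)
  ultimately obtain e3 where e3: "e3 > 0" "\<And>\<epsilon>. 0 < \<epsilon> \<Longrightarrow> \<epsilon> < e3 \<Longrightarrow> integral\<^sup>L lborel (heinz_map \<epsilon> U g)
     = integral\<^sup>L lborel (heinz_map \<epsilon> U h)"
    using heinz_homotopy[where a="\<lambda>i x. g x $ i" and b="\<lambda>i x. h x $ i" and
        D="\<lambda>i x. jacobian g (at x) $ i" and D'="\<lambda>i x. jacobian h (at x) $ i", OF U Hg Hh] by blast
  define \<epsilon> where "\<epsilon> = min e1 (min e2 e3) / 2"
  have \<epsilon>: "0 < \<epsilon>" "\<epsilon> < e1" "\<epsilon> < e2" "\<epsilon> < e3" using e1(1) e2(1) e3(1) by (auto simp: \<epsilon>_def min_def)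
  show ?thesis
    using e1(2)[OF \<epsilon>(1,2)] e2(2)[OF \<epsilon>(1,3)] e3(2)[OF \<epsilon>(1,4)] integral_bump_vec_pos[OF \<epsilon>(1), where 'n='n] by auto
qed

lemma C2_on_diff_const:
  assumes "C2_on U g"
  shows "C2_on U (\<lambda>x. g x - p)" "\<And>x. x \<in> U \<Longrightarrow> jacobian (\<lambda>x. g x - p) (at x) = jacobian g (at x)"
proof -
  obtain g' g'' where g': "\<And>x. x \<in> U \<Longrightarrow> (g has_derivative blinfun_apply (g' x)) (at x)"
    and g'': "\<And>x. x \<in> U \<Longrightarrow> (g' has_derivative blinfun_apply (g'' x)) (at x)"
    and cont: "continuous_on U g''"
    using assms unfolding C2_on_def by blast
  have d: "((\<lambda>x. g x - p) has_derivative blinfun_apply (g' x)) (at x)" if "x \<in> U" for x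
    using has_derivative_diff[OF g'[OF that] has_derivative_const[of p]] by simp
  then show "C2_on U (\<lambda>x. g x - p)" unfolding C2_on_def using g'' cont by blast
  show "jacobian (\<lambda>x. g x - p) (at x) = jacobian g (at x)" if "x \<in> U" for x
    unfolding jacobian_def using frechet_derivative_at[OF d[OF that]] frechet_derivative_at[OF g'[OF that]] by simp
qed

text \<open>The critical values are negligible and a ball is not, so some \<open>p\<close> in the
  ball avoids them; 0 is then a regular value of the translate.\<close>

lemma ex_regular_value:
  fixes g :: "real^'n::finite \<Rightarrow> real^'n"
  assumes U: "open U" and C2: "C2_on U g" and r: "r > 0"
  obtains p where "norm p < r" "regular_value_on U (\<lambda>x. g x - p) 0"
proof -
  define S where "S = {x \<in> U. det (jacobian g (at x)) = 0}"
  have "negligible (g ` S)"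
  proof (rule negligible_critical_values)
    show "(g has_derivative (\<lambda>h. jacobian g (at x) *v h)) (at x)" if "x \<in> S" for x
      using C2_onD(2)[OF C2 U] that by (simp add: S_def)
  qed (simp add: S_def)
  moreover have "\<not> negligible (ball (0 :: real^'n) r)"
    using r by (intro open_not_negligible) auto
  ultimately obtain p where p: "p \<in> ball 0 r" "p \<notin> g ` S"
    using negligible_subset by blast
  have "regular_value_on U (\<lambda>x. g x - p) 0"
    using p(2) C2_on_diff_const(2)[OF C2] by (auto simp: regular_value_on_def S_def image_iff)
  then show thesis using that p(1) by simp
qed



text \<open>With an empty frontier \<open>infdist\<close> would be 0 by convention, and no map would
  qualify in the definition of the degree over a nonempty set.\<close>

lemma frontier_nonempty:
  fixes U :: "(real^'n::finite) set"
  assumes "open U" "bounded U" "U \<noteq> {}"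
  shows "frontier U \<noteq> {}"
  using assms frontier_eq_empty[of U] not_bounded_UNIV by blast

text \<open>A small translate of \<open>h\<close> by a regular value is an admissible competitor.\<close>

lemma brouwer_degree_exists:
  fixes h :: "real^'n::finite \<Rightarrow> real^'n"
  assumes U: "open U" "bounded U" "U \<noteq> {}" and h: "continuous_on (closure U) h" "C2_on U h"
    and nz: "\<And>x. x \<in> frontier U \<Longrightarrow> h x \<noteq> 0"
  obtains r where "r > 0"
    "\<And>p. norm p < r \<Longrightarrow> regular_value_on U (\<lambda>x. h x - p) 0 \<Longrightarrow>
       real_of_int (brouwer_degree h U 0) = (\<Sum>x\<in>{x\<in>U. h x - p = 0}. sgn (det (jacobian (\<lambda>x. h x - p) (at x))))"
proof -
  have fU: "compact (frontier U)" "frontier U \<subseteq> closure U" "frontier U \<noteq> {}"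
    using frontier_nonempty[OF U] compact_frontier_bounded[OF U(2)] by (auto simp: frontier_def)
  define r where "r = infdist 0 (h ` frontier U)"
  have cl: "compact (h ` frontier U)" "h ` frontier U \<noteq> {}"
    using fU h(1) continuous_on_subset by (auto intro!: compact_continuous_image)
  have rpos: "r > 0"
  proof -
    have "0 \<notin> h ` frontier U" using nz by auto
    then show ?thesis
      using cl in_closed_iff_infdist_zero[of "h ` frontier U" 0] infdist_nonneg[of 0 "h ` frontier U"]
      unfolding r_def by (metis compact_imp_closed order_le_imp_less_or_eq)
  qed
  have rle: "r \<le> norm (h x)" if "x \<in> frontier U" for x
    using infdist_le[of "h x" "h ` frontier U" 0] that by (simp add: r_def)
  define adm where "adm = (\<lambda>g. continuous_on (closure U) g \<and> C2_on U g \<and>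
     (\<forall>x\<in>closure U. dist (g x) (h x) < r) \<and> regular_value_on U g 0)"
  define N where "N = (\<lambda>g. \<Sum>x\<in>{x\<in>U. g x = (0::real^'n)}. sgn (det (jacobian g (at x))))"
  \<comment> \<open>Convex combinations of two admissible maps are still closer than
    \<open>r\<close> to \<open>h\<close>, and \<open>h\<close> has norm at least \<open>r\<close> on
    the frontier; so the segment between them has no zero there.\<close>
  have same: "N g1 = N g2" if "adm g1" "adm g2" for g1 g2
    unfolding N_def
  proof (rule signed_count_homotopy[OF U(1,2)])
    show "(1 - t) *\<^sub>R g1 x + t *\<^sub>R g2 x \<noteq> 0" if t: "0 \<le> t" "t \<le> 1" "x \<in> frontier U" for t x
    proof
      assume 0: "(1 - t) *\<^sub>R g1 x + t *\<^sub>R g2 x = 0"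
      have d: "norm (g1 x - h x) < r" "norm (g2 x - h x) < r"
        using \<open>adm g1\<close> \<open>adm g2\<close> t(3) fU(2) by (auto simp: adm_def dist_norm)
      have "(1 - t) *\<^sub>R (g1 x - h x) + t *\<^sub>R (g2 x - h x) = ((1 - t) *\<^sub>R g1 x + t *\<^sub>R g2 x) - h x"
        by (simp add: algebra_simps)
      then have "norm (h x) = norm ((1 - t) *\<^sub>R (g1 x - h x) + t *\<^sub>R (g2 x - h x))"
        unfolding 0 by simp
      then have "norm (h x) \<le> (1 - t) * norm (g1 x - h x) + t * norm (g2 x - h x)"
        using norm_triangle_ineq[of "(1 - t) *\<^sub>R (g1 x - h x)" "t *\<^sub>R (g2 x - h x)"] t by simp
      also have "\<dots> < r"
        using convex_bound_lt[OF d, of "1 - t" t] t by simp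
      finally show False using rle[OF t(3)] by simp
    qed
  qed (use that in \<open>auto simp: adm_def\<close>)
  have trans: "adm (\<lambda>x. h x - p)" if "norm p < r" "regular_value_on U (\<lambda>x. h x - p) 0" for p
    unfolding adm_def using that C2_on_diff_const(1)[OF h(2)] h(1)
    by (auto simp: dist_norm intro!: continuous_intros)
  obtain p where p: "norm p < r" "regular_value_on U (\<lambda>x. h x - p) 0"
    using ex_regular_value[OF U(1) h(2) rpos] by blast
  define g0 where "g0 = (\<lambda>x. h x - p)"
  have g0: "adm g0" unfolding g0_def by (rule trans[OF p])
  \<comment> \<open>The definition asks for an integer, whereas the count is a real sum of
    signs.\<close>
  have Nint: "N g \<in> \<int>" for g
    unfolding N_def by (intro Ints_sum) (auto simp: sgn_real_def)
  then obtain d where d: "real_of_int d = N g0" by (metis Ints_cases)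
  have "brouwer_degree h U 0 = d"
    unfolding brouwer_degree_def
  proof (rule the_equality)
    show "\<forall>g. continuous_on (closure U) g \<longrightarrow> C2_on U g \<longrightarrow>
        (\<forall>x\<in>closure U. dist (g x) (h x) < infdist 0 (h ` frontier U)) \<longrightarrow>
        regular_value_on U g 0 \<longrightarrow>
        real_of_int d = (\<Sum>x\<in>{x\<in>U. g x = 0}. sgn (det (jacobian g (at x))))"
      using same[OF _ g0] d by (auto simp: adm_def N_def r_def)
    fix d' :: int assume "\<forall>g. continuous_on (closure U) g \<longrightarrow> C2_on U g \<longrightarrow>
        (\<forall>x\<in>closure U. dist (g x) (h x) < infdist 0 (h ` frontier U)) \<longrightarrow>
        regular_value_on U g 0 \<longrightarrow>
        real_of_int d' = (\<Sum>x\<in>{x\<in>U. g x = 0}. sgn (det (jacobian g (at x))))"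
    then have "real_of_int d' = N g0" using g0 by (auto simp: adm_def N_def r_def)
    then show "d' = d" using d by linarith
  qed
  then show thesis
    using that[OF rpos] same[OF trans g0] d by (simp add: N_def)
qed

lemma brouwer_degree_regular:
  fixes h :: "real^'n::finite \<Rightarrow> real^'n"
  assumes U: "open U" "bounded U" "U \<noteq> {}" and h: "continuous_on (closure U) h" "C2_on U h"
    and nz: "\<And>x. x \<in> frontier U \<Longrightarrow> h x \<noteq> 0" and reg: "regular_value_on U h 0"
  shows "real_of_int (brouwer_degree h U 0) = (\<Sum>x\<in>{x\<in>U. h x = 0}. sgn (det (jacobian h (at x))))"
proof -
  obtain r where "r > 0"
    "\<And>p. norm p < r \<Longrightarrow> regular_value_on U (\<lambda>x. h x - p) 0 \<Longrightarrow>
       real_of_int (brouwer_degree h U 0) = (\<Sum>x\<in>{x\<in>U. h x - p = 0}. sgn (det (jacobian (\<lambda>x. h x - p) (at x))))"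
    using brouwer_degree_exists[OF U h nz] by blast
  from this(1) this(2)[of 0] reg show ?thesis by simp
qed

text \<open>Both ends are translated by regular values smaller than the distance
  \<open>\<delta>\<close> of the homotopy from 0 on the frontier. The segment between the translates
  still avoids 0 there, so their signed counts agree.\<close>

lemma brouwer_degree_homotopy:
  fixes g h :: "real^'n::finite \<Rightarrow> real^'n"
  assumes U: "open U" "bounded U" "U \<noteq> {}" and g: "continuous_on (closure U) g" "C2_on U g"
    and h: "continuous_on (closure U) h" "C2_on U h"
    and nz: "\<And>t x. 0 \<le> t \<Longrightarrow> t \<le> 1 \<Longrightarrow> x \<in> frontier U \<Longrightarrow> (1 - t) *\<^sub>R g x + t *\<^sub>R h x \<noteq> 0"
  shows "brouwer_degree g U 0 = brouwer_degree h U 0"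
proof -
  have fU: "compact (frontier U)" "frontier U \<subseteq> closure U" "frontier U \<noteq> {}"
    using frontier_nonempty[OF U] compact_frontier_bounded[OF U(2)] by (auto simp: frontier_def)
  have nzg: "g x \<noteq> 0" if "x \<in> frontier U" for x using nz[of 0 x] that by simp
  have nzh: "h x \<noteq> 0" if "x \<in> frontier U" for x using nz[of 1 x] that by simp
  obtain r1 where r1: "r1 > 0" "\<And>p. norm p < r1 \<Longrightarrow> regular_value_on U (\<lambda>x. g x - p) 0 \<Longrightarrow>
       real_of_int (brouwer_degree g U 0) = (\<Sum>x\<in>{x\<in>U. g x - p = 0}. sgn (det (jacobian (\<lambda>x. g x - p) (at x))))"
    using brouwer_degree_exists[OF U g nzg] by blast
  obtain r2 where r2: "r2 > 0" "\<And>p. norm p < r2 \<Longrightarrow> regular_value_on U (\<lambda>x. h x - p) 0 \<Longrightarrow>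
       real_of_int (brouwer_degree h U 0) = (\<Sum>x\<in>{x\<in>U. h x - p = 0}. sgn (det (jacobian (\<lambda>x. h x - p) (at x))))"
    using brouwer_degree_exists[OF U h nzh] by blast
  have "\<exists>\<delta>>0. \<forall>t\<in>{0..1}. \<forall>x\<in>frontier U. \<delta> \<le> norm ((1 - t) *\<^sub>R g x + t *\<^sub>R h x)"
  proof -
    define F where "F = (\<lambda>q. norm ((1 - fst q) *\<^sub>R g (snd q) + fst q *\<^sub>R h (snd q)))"
    have "compact ({0..1::real} \<times> frontier U)" using fU by (intro compact_Times) auto
    moreover have "{0..1::real} \<times> frontier U \<noteq> {}" using fU(3) by auto
    moreover have "continuous_on ({0..1::real} \<times> frontier U) F"
    proof -
      have "continuous_on ({0..1::real} \<times> frontier U) (\<lambda>q. g (snd q))"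
        by (rule continuous_on_compose2[OF g(1)]) (use fU in \<open>auto intro!: continuous_intros\<close>)
      moreover have "continuous_on ({0..1::real} \<times> frontier U) (\<lambda>q. h (snd q))"
        by (rule continuous_on_compose2[OF h(1)]) (use fU in \<open>auto intro!: continuous_intros\<close>)
      ultimately show ?thesis unfolding F_def by (intro continuous_intros)
    qed
    ultimately obtain q where q: "q \<in> {0..1} \<times> frontier U" "\<And>q'. q' \<in> {0..1} \<times> frontier U \<Longrightarrow> F q \<le> F q'"
      using continuous_attains_inf by metis
    have "F q > 0" using nz[of "fst q" "snd q"] q(1) by (cases q) (auto simp: F_def)
    moreover have "F q \<le> norm ((1 - t) *\<^sub>R g x + t *\<^sub>R h x)" if "t \<in> {0..1}" "x \<in> frontier U" for t x
      using q(2)[of "(t, x)"] that by (simp add: F_def)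
    ultimately show ?thesis by blast
  qed
  then obtain \<delta> where \<delta>: "\<delta> > 0"
    "\<And>t x. 0 \<le> t \<Longrightarrow> t \<le> 1 \<Longrightarrow> x \<in> frontier U \<Longrightarrow> \<delta> \<le> norm ((1 - t) *\<^sub>R g x + t *\<^sub>R h x)"
    by (metis atLeastAtMost_iff)
  obtain p where p: "norm p < min r1 \<delta>" "regular_value_on U (\<lambda>x. g x - p) 0"
    using ex_regular_value[OF U(1) g(2), of "min r1 \<delta>"] r1(1) \<delta>(1) by auto
  obtain q where q: "norm q < min r2 \<delta>" "regular_value_on U (\<lambda>x. h x - q) 0"
    using ex_regular_value[OF U(1) h(2), of "min r2 \<delta>"] r2(1) \<delta>(1) by auto
  have g': "continuous_on (closure U) (\<lambda>x. g x - p)" and h': "continuous_on (closure U) (\<lambda>x. h x - q)"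
    using g(1) h(1) by (auto intro!: continuous_intros)
  have "(\<Sum>x\<in>{x\<in>U. g x - p = 0}. sgn (det (jacobian (\<lambda>x. g x - p) (at x))))
     = (\<Sum>x\<in>{x\<in>U. h x - q = 0}. sgn (det (jacobian (\<lambda>x. h x - q) (at x))))"
  proof (rule signed_count_homotopy[OF U(1,2) g' C2_on_diff_const(1)[OF g(2)] p(2) h' C2_on_diff_const(1)[OF h(2)] q(2)])
    show "(1 - t) *\<^sub>R (g x - p) + t *\<^sub>R (h x - q) \<noteq> 0" if t: "0 \<le> t" "t \<le> 1" "x \<in> frontier U" for t x
    proof
      assume "(1 - t) *\<^sub>R (g x - p) + t *\<^sub>R (h x - q) = 0"
      then have "(1 - t) *\<^sub>R g x + t *\<^sub>R h x = (1 - t) *\<^sub>R p + t *\<^sub>R q"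
        by (simp add: algebra_simps)
      then have "norm ((1 - t) *\<^sub>R g x + t *\<^sub>R h x) \<le> (1 - t) * norm p + t * norm q"
        using norm_triangle_ineq[of "(1 - t) *\<^sub>R p" "t *\<^sub>R q"] t by simp
      also have "\<dots> < \<delta>" using convex_bound_lt[of "norm p" \<delta> "norm q" "1 - t" t] t p(1) q(1) by simp
      finally show False using \<delta>(2)[OF t] by simp
    qed
  qed
  then show ?thesis
    using r1(2)[of p] r2(2)[of q] p q by simp
qed

section \<open>The graph Laplacian\<close>

definition smooth2 :: "(real \<Rightarrow> real) \<Rightarrow> bool" where
  "smooth2 \<phi> \<longleftrightarrow> (\<exists>\<phi>' \<phi>''. (\<forall>y. (\<phi> has_real_derivative \<phi>' y) (at y)) \<and>
     (\<forall>y. (\<phi>' has_real_derivative \<phi>'' y) (at y)) \<and> continuous_on UNIV \<phi>'')"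

lemma smooth2_const: "smooth2 (\<lambda>y. a)"
  unfolding smooth2_def by (intro exI[of _ "\<lambda>y. 0"]) auto

lemma smooth2_exp: "smooth2 (\<lambda>y. exp (b * y))"
  unfolding smooth2_def
  by (intro exI[of _ "\<lambda>y. b * exp (b * y)"] exI[of _ "\<lambda>y. b * (b * exp (b * y))"] conjI allI)
    (auto intro!: derivative_eq_intros continuous_intros)

lemma smooth2_add:
  assumes "smooth2 \<phi>" "smooth2 \<psi>"
  shows "smooth2 (\<lambda>y. \<phi> y + \<psi> y)"
proof -
  obtain \<phi>' \<phi>'' \<psi>' \<psi>'' where "\<And>y. (\<phi> has_real_derivative \<phi>' y) (at y)" "\<And>y. (\<phi>' has_real_derivative \<phi>'' y) (at y)"
    "continuous_on UNIV \<phi>''" "\<And>y. (\<psi> has_real_derivative \<psi>' y) (at y)" "\<And>y. (\<psi>' has_real_derivative \<psi>'' y) (at y)"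
    "continuous_on UNIV \<psi>''" using assms unfolding smooth2_def by blast
  then show ?thesis unfolding smooth2_def
    by (intro exI[of _ "\<lambda>y. \<phi>' y + \<psi>' y"] exI[of _ "\<lambda>y. \<phi>'' y + \<psi>'' y"])
      (auto intro!: DERIV_add continuous_on_add)
qed

lemma smooth2_cmult:
  assumes "smooth2 \<phi>"
  shows "smooth2 (\<lambda>y. a * \<phi> y)"
proof -
  obtain \<phi>' \<phi>'' where "\<And>y. (\<phi> has_real_derivative \<phi>' y) (at y)" "\<And>y. (\<phi>' has_real_derivative \<phi>'' y) (at y)"
    "continuous_on UNIV \<phi>''" using assms unfolding smooth2_def by blast
  then show ?thesis unfolding smooth2_def
    by (intro exI[of _ "\<lambda>y. a * \<phi>' y"] exI[of _ "\<lambda>y. a * \<phi>'' y"])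
      (auto intro!: DERIV_cmult continuous_on_mult_left)
qed

lemma smooth2_sum:
  assumes "\<And>i. i \<in> I \<Longrightarrow> smooth2 (\<phi> i)"
  shows "smooth2 (\<lambda>y. \<Sum>i\<in>I. \<phi> i y)"
  using assms by (induction I rule: infinite_finite_induct) (auto intro: smooth2_const smooth2_add)

lemma C2_on_linear_minus_diagonal:
  fixes A :: "real^'n::finite \<Rightarrow> real^'n"
  assumes A: "bounded_linear A" and F: "\<And>x. smooth2 (F x)"
  shows "C2_on U (\<lambda>u. A u - (\<chi> x. F x (u $ x)))"
proof -
  obtain F1 F2 where F1: "\<And>x y. (F x has_real_derivative F1 x y) (at y)"
    and F2: "\<And>x y. (F1 x has_real_derivative F2 x y) (at y)" and cF: "\<And>x. continuous_on UNIV (F2 x)"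
    using F unfolding smooth2_def by metis
  \<comment> \<open>\<open>P x\<close> projects onto the coordinate \<open>x\<close>: the first
    derivative of the diagonal part is a combination of the \<open>P x\<close>, the second one of
    the \<open>Q x\<close>.\<close>
  define P where "P = (\<lambda>x. Blinfun (\<lambda>h :: real^'n. axis x (h $ x) :: real^'n))"
  have blP: "bounded_linear (\<lambda>h :: real^'n. axis x (h $ x) :: real^'n)" for x
    by (intro linear_conv_bounded_linear[THEN iffD1] linearI) (auto simp: vec_eq_iff axis_def)
  have P: "blinfun_apply (P x) h = axis x (h $ x)" for x h
    unfolding P_def by (simp add: bounded_linear_Blinfun_apply[OF blP])
  define Q where "Q = (\<lambda>x. Blinfun (\<lambda>h :: real^'n. h $ x *\<^sub>R P x))"
  have blQ: "bounded_linear (\<lambda>h :: real^'n. h $ x *\<^sub>R P x)" for x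
    by (intro linear_conv_bounded_linear[THEN iffD1] linearI) (auto simp: algebra_simps)
  have Q: "blinfun_apply (Q x) h = h $ x *\<^sub>R P x" for x h
    unfolding Q_def by (simp add: bounded_linear_Blinfun_apply[OF blQ])
  have comp: "((\<lambda>u :: real^'n. \<phi> (u $ x)) has_derivative (\<lambda>h. \<phi>' * h $ x)) (at u)"
    if "(\<phi> has_real_derivative \<phi>') (at (u $ x))" for \<phi> \<phi>' x u
    by (rule has_derivative_compose[of "\<lambda>u. u $ x", OF _ that[unfolded has_field_derivative_def]])
      (rule bounded_linear.has_derivative[OF bounded_linear_vec_nth has_derivative_ident])
  define g' where "g' = (\<lambda>u. Blinfun A - (\<Sum>x\<in>UNIV. F1 x (u $ x) *\<^sub>R P x))"
  define g'' where "g'' = (\<lambda>u. - (\<Sum>x\<in>UNIV. F2 x (u $ x) *\<^sub>R Q x))"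
  have g': "((\<lambda>u. A u - (\<chi> x. F x (u $ x))) has_derivative blinfun_apply (g' u)) (at u)" for u
  proof -
    have "((\<lambda>u. A u - (\<chi> x. F x (u $ x))) has_derivative (\<lambda>h. A h - (\<chi> x. F1 x (u $ x) * h $ x))) (at u)"
      by (intro has_derivative_diff has_derivative_vec_lambda comp F1 bounded_linear_imp_has_derivative A)
    moreover have "blinfun_apply (g' u) = (\<lambda>h. A h - (\<chi> x. F1 x (u $ x) * h $ x))"
    proof
      fix h
      have "(\<Sum>x\<in>UNIV. F1 x (u $ x) *\<^sub>R axis x (h $ x)) = (\<chi> x. F1 x (u $ x) * h $ x)"
        by (simp add: vec_eq_iff axis_def if_distrib[of "\<lambda>z. _ * z"] cong: if_cong)
      then show "blinfun_apply (g' u) h = A h - (\<chi> x. F1 x (u $ x) * h $ x)"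
        by (simp add: g'_def blinfun.diff_left blinfun.sum_left blinfun.scaleR_left P bounded_linear_Blinfun_apply[OF A])
    qed
    ultimately show ?thesis by simp
  qed
  have g'': "(g' has_derivative blinfun_apply (g'' u)) (at u)" for u
  proof -
    have "(g' has_derivative (\<lambda>h. 0 - (\<Sum>x\<in>UNIV. (F2 x (u $ x) * h $ x) *\<^sub>R P x))) (at u)"
      unfolding g'_def
      by (intro has_derivative_diff has_derivative_sum has_derivative_scaleR_left comp F2 has_derivative_const)
    moreover have "(\<lambda>h. 0 - (\<Sum>x\<in>UNIV. (F2 x (u $ x) * h $ x) *\<^sub>R P x)) = blinfun_apply (g'' u)"
      by (simp add: fun_eq_iff g''_def blinfun.minus_left blinfun.sum_left blinfun.scaleR_left Q)
    ultimately show ?thesis by simp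
  qed
  have "continuous_on U g''"
  proof -
    have cF2: "continuous_on U (\<lambda>u. F2 x (u $ x))" for x
      by (rule continuous_on_compose2[OF cF]) (auto intro!: continuous_intros)
    show ?thesis unfolding g''_def by (intro continuous_intros cF2)
  qed
  then show ?thesis unfolding C2_on_def using g' g'' by blast
qed

section \<open>Balls of the sup norm\<close>

lemma sup_ball_interior:
  assumes "R > 0"
  shows "open (interior (sup_ball R :: (real^'n::finite) set))" "bounded (interior (sup_ball R :: (real^'n) set))"
    "interior (sup_ball R :: (real^'n) set) \<noteq> {}"
    "\<And>u :: real^'n. u \<in> frontier (interior (sup_ball R)) \<Longrightarrow> infnorm u = R"
    "\<And>u :: real^'n. infnorm u < R \<Longrightarrow> u \<in> interior (sup_ball R)"
proof -
  have cont: "continuous_on UNIV (infnorm :: real^'n \<Rightarrow> real)"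
    by (intro continuous_at_imp_continuous_on ballI continuous_infnorm continuous_ident)
  have "closed {u :: real^'n. infnorm u \<le> R}"
    by (intro closed_Collect_le cont continuous_on_const)
  then have cl: "closed (sup_ball R :: (real^'n) set)" by (simp add: sup_ball_def)
  have "open {u :: real^'n. infnorm u < R}"
    by (intro open_Collect_less cont continuous_on_const)
  then have sub: "{u :: real^'n. infnorm u < R} \<subseteq> interior (sup_ball R)"
    by (intro interior_maximal) (auto simp: sup_ball_def)
  then show in_int: "\<And>u :: real^'n. infnorm u < R \<Longrightarrow> u \<in> interior (sup_ball R)" by blast
  show "open (interior (sup_ball R :: (real^'n) set))" by simp
  have "bounded (sup_ball R :: (real^'n) set)"
    unfolding bounded_iff
  proof (intro exI ballI)
    fix u :: "real^'n" assume "u \<in> sup_ball R"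
    then show "norm u \<le> sqrt DIM(real^'n) * R"
      using norm_le_infnorm[of u] by (auto simp: sup_ball_def intro: order_trans mult_left_mono)
  qed
  then show "bounded (interior (sup_ball R :: (real^'n) set))"
    using interior_subset bounded_subset by blast
  show "interior (sup_ball R :: (real^'n) set) \<noteq> {}"
    using in_int[of 0] assms by (auto simp: infnorm_0)
  show "infnorm u = R" if u: "u \<in> frontier (interior (sup_ball R))" for u :: "real^'n"
  proof -
    have "u \<in> closure (interior (sup_ball R))" "u \<notin> interior (sup_ball R)"
      using u by (auto simp: frontier_def)
    moreover have "closure (interior (sup_ball R)) \<subseteq> (sup_ball R :: (real^'n) set)"
      by (intro closure_minimal cl interior_subset)
    ultimately show ?thesis using in_int[of u] by (fastforce simp: sup_ball_def)
  qed
qed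

section \<open>The operator L = -Delta: energy, determinant, oscillation\<close>

context finite_connected_weighted_graph
begin

text \<open>The sum may run over all vertices, since weights vanish off the edges and a loop
  contributes the difference 0. The sign makes the operator nonnegative.\<close>

definition L :: "real^'v \<Rightarrow> real^'v" where
  "L u = (\<chi> x. (\<Sum>y\<in>UNIV. \<omega> x y * (u $ x - u $ y)) / m x)"

lemma edge_weight_eq_0: "{x, y} \<notin> E \<Longrightarrow> \<omega> x y = 0"
  using edge_weight_nonneg[of x y] edge_weight_pos_iff[of x y] by linarith

lemma laplacian_eq: "- laplacian E \<omega> m (($) u) x = L u $ x"
proof -
  have "(\<Sum>y | {x, y} \<in> E. \<omega> x y * (u $ y - u $ x)) = (\<Sum>y\<in>UNIV. \<omega> x y * (u $ y - u $ x))"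
    by (rule sum.mono_neutral_left) (auto simp: edge_weight_eq_0)
  also have "\<dots> = - (\<Sum>y\<in>UNIV. \<omega> x y * (u $ x - u $ y))"
    by (simp add: sum_negf[symmetric] algebra_simps)
  finally show ?thesis by (simp add: laplacian_def L_def)
qed

lemma linear_L: "linear L"
  by (rule linearI)
    (auto simp: L_def vec_eq_iff add_divide_distrib[symmetric] sum.distrib[symmetric] sum_distrib_left
      sum_divide_distrib algebra_simps intro!: arg_cong[where f="\<lambda>s. s / m _"] sum.cong)

lemma bounded_linear_L: "bounded_linear L"
  using linear_L linear_conv_bounded_linear by blast

lemma L_minus: "L (- u) = - L u"
  by (rule linear_neg[OF linear_L])

lemma m_L: "m x * L u $ x = (\<Sum>y\<in>UNIV. \<omega> x y * (u $ x - u $ y))"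
  using vertex_weight_pos[of x] by (simp add: L_def)

text \<open>After multiplication by \<open>m x\<close> the summands are antisymmetric in
  \<open>x\<close> and \<open>y\<close>. For a solution this is the compatibility condition on the
  nonlinearity from which the sign arguments start.\<close>

lemma sum_m_L: "(\<Sum>x\<in>UNIV. m x * L u $ x) = 0"
proof -
  have "(\<Sum>x\<in>UNIV. \<Sum>y\<in>UNIV. \<omega> x y * (u $ x - u $ y)) = (\<Sum>y\<in>UNIV. \<Sum>x\<in>UNIV. \<omega> x y * (u $ x - u $ y))"
    by (rule sum.swap)
  also have "\<dots> = (\<Sum>x\<in>UNIV. \<Sum>y\<in>UNIV. - (\<omega> x y * (u $ x - u $ y)))"
    by (intro sum.cong refl) (simp add: edge_weight_sym algebra_simps)
  finally show ?thesis by (simp add: m_L sum_negf)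
qed

text \<open>Summation by parts: adding to the double sum its copy with \<open>x\<close> and
  \<open>y\<close> exchanged produces the squares. The right hand side is the Dirichlet
  energy.\<close>

lemma energy_L: "(\<Sum>x\<in>UNIV. m x * (u $ x * L u $ x)) = (\<Sum>x\<in>UNIV. \<Sum>y\<in>UNIV. \<omega> x y * (u $ x - u $ y)\<^sup>2) / 2"
proof -
  define S where "S = (\<Sum>x\<in>UNIV. \<Sum>y\<in>UNIV. \<omega> x y * (u $ x * (u $ x - u $ y)))"
  have 1: "(\<Sum>x\<in>UNIV. m x * (u $ x * L u $ x)) = S"
  proof -
    have "m x * (u $ x * L u $ x) = u $ x * (m x * L u $ x)" for x by simp
    then show ?thesis unfolding S_def m_L by (simp add: sum_distrib_left algebra_simps)
  qed
  have "S = (\<Sum>y\<in>UNIV. \<Sum>x\<in>UNIV. \<omega> x y * (u $ x * (u $ x - u $ y)))"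
    unfolding S_def by (rule sum.swap)
  also have "\<dots> = (\<Sum>x\<in>UNIV. \<Sum>y\<in>UNIV. \<omega> x y * (u $ y * (u $ y - u $ x)))"
    by (intro sum.cong refl) (simp add: edge_weight_sym)
  finally have "S + S = S + (\<Sum>x\<in>UNIV. \<Sum>y\<in>UNIV. \<omega> x y * (u $ y * (u $ y - u $ x)))"
    by (rule arg_cong)
  also have "\<dots> = (\<Sum>x\<in>UNIV. \<Sum>y\<in>UNIV. \<omega> x y * (u $ x - u $ y)\<^sup>2)"
    unfolding S_def sum.distrib[symmetric]
    by (intro sum.cong refl) (simp add: power2_eq_square algebra_simps)
  finally have "S + S = (\<Sum>x\<in>UNIV. \<Sum>y\<in>UNIV. \<omega> x y * (u $ x - u $ y)\<^sup>2)" .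
  then show ?thesis using 1 by simp
qed

lemma energy_nonneg: "(\<Sum>x\<in>UNIV. m x * (u $ x * L u $ x)) \<ge> 0"
  unfolding energy_L
  by (intro divide_nonneg_pos sum_nonneg mult_nonneg_nonneg edge_weight_nonneg zero_le_power2) simp

lemma energy_eq_0_imp_constant:
  assumes "(\<Sum>x\<in>UNIV. m x * (u $ x * L u $ x)) = 0"
  shows "u $ x = u $ y"
proof -
  have nn: "0 \<le> \<omega> x y * (u $ x - u $ y)\<^sup>2" for x y by (simp add: edge_weight_nonneg)
  have "(\<Sum>x\<in>UNIV. \<Sum>y\<in>UNIV. \<omega> x y * (u $ x - u $ y)\<^sup>2) = 0"
    using assms unfolding energy_L by simp
  then have "\<omega> x y * (u $ x - u $ y)\<^sup>2 = 0" for x y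
    using nn by (simp add: sum_nonneg_eq_0_iff sum_nonneg)
  then have edge: "u $ x = u $ y" if "{x, y} \<in> E" for x y
    using edge_weight_pos_iff[of x y] that by (metis eq_iff_diff_eq_0 less_irrefl mult_eq_0_iff power_eq_0_iff)
  show ?thesis
    using connected[of x y] by (induction rule: rtrancl_induct) (auto dest: edge)
qed

definition delta :: "'v \<Rightarrow> real^'v \<Rightarrow> real^'v" where
  "delta x1 u = axis x1 (u $ x1)"

lemma linear_delta: "linear (delta x1)"
  by (rule linearI) (auto simp: delta_def vec_eq_iff axis_def)

text \<open>Multiply the equation by \<open>m u\<close> and sum over the vertices.\<close>

lemma L_delta_injective:
  assumes t: "0 \<le> t" "t \<le> 1" and 0: "t *\<^sub>R (L u + delta x1 u) + (1 - t) *\<^sub>R u = 0"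
  shows "u = 0"
proof -
  define e where "e = (\<Sum>x\<in>UNIV. m x * (u $ x * L u $ x))"
  define s where "s = (\<Sum>x\<in>UNIV. m x * (u $ x)\<^sup>2)"
  have e: "e \<ge> 0" unfolding e_def by (rule energy_nonneg)
  have s: "s \<ge> 0" unfolding s_def using vertex_weight_pos by (auto intro!: sum_nonneg simp: less_imp_le)
  have "(\<Sum>x\<in>UNIV. m x * (u $ x * (t *\<^sub>R (L u + delta x1 u) + (1 - t) *\<^sub>R u) $ x)) = 0"
    unfolding 0 by simp
  moreover have "m x * (u $ x * (t *\<^sub>R (L u + delta x1 u) + (1 - t) *\<^sub>R u) $ x)
      = t * (m x * (u $ x * L u $ x)) + (if x = x1 then t * (m x * (u $ x)\<^sup>2) else 0) + (1 - t) * (m x * (u $ x)\<^sup>2)" for x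
    by (simp add: delta_def axis_def power2_eq_square algebra_simps)
  ultimately have sum0: "t * e + t * (m x1 * (u $ x1)\<^sup>2) + (1 - t) * s = 0"
    by (simp add: e_def s_def sum.distrib sum_distrib_left[symmetric])
  have m1: "m x1 * (u $ x1)\<^sup>2 \<ge> 0" using vertex_weight_pos[of x1] by simp
  have parts: "t * e \<ge> 0" "t * (m x1 * (u $ x1)\<^sup>2) \<ge> 0" "(1 - t) * s \<ge> 0"
    using e m1 s t by simp_all
  have zero3: "a = 0 \<and> b = 0 \<and> c = 0" if "a + b + c = 0" "0 \<le> a" "0 \<le> b" "0 \<le> c" for a b c :: real
    using that by linarith
  have zero: "t * e = 0" "t * (m x1 * (u $ x1)\<^sup>2) = 0" "(1 - t) * s = 0"
    using zero3[OF sum0 parts] by blast+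
  show ?thesis
  proof (cases "t = 1")
    case True
    then have "e = 0" "m x1 * (u $ x1)\<^sup>2 = 0" using zero by auto
    then have "u $ x = u $ x1" "u $ x1 = 0" for x
      using energy_eq_0_imp_constant[of u x x1] vertex_weight_pos[of x1] by (auto simp: e_def)
    then show ?thesis by (simp add: vec_eq_iff)
  next
    case False
    then have "s = 0" using zero by simp
    moreover have "0 \<le> m x * (u $ x)\<^sup>2" for x using vertex_weight_pos[of x] by simp
    ultimately have "m x * (u $ x)\<^sup>2 = 0" for x
      unfolding s_def by (simp add: sum_nonneg_eq_0_iff)
    then show ?thesis using vertex_weight_pos by (simp add: vec_eq_iff less_imp_neq[symmetric])
  qed
qed

text \<open>By \<open>L_delta_injective\<close> the determinant has no zero on the segment from the
  identity, where it is 1, to this matrix.\<close>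

lemma det_L_plus_delta_pos: "det (matrix (\<lambda>u. L u + delta x1 u)) > 0"
proof -
  define A where "A = matrix (\<lambda>u. L u + delta x1 u)"
  have lin: "linear (\<lambda>u. L u + delta x1 u)"
    by (intro linear_compose_add linear_L linear_delta)
  have A: "A *v u = L u + delta x1 u" for u
    unfolding A_def using matrix_vector_mul(2)[OF lin] by metis
  define d where "d = (\<lambda>t. det (t *\<^sub>R A + (1 - t) *\<^sub>R mat 1))"
  have "d t \<noteq> 0" if t: "0 \<le> t" "t \<le> 1" for t
  proof -
    have mv: "(t *\<^sub>R A + (1 - t) *\<^sub>R mat 1) *v u = t *\<^sub>R (L u + delta x1 u) + (1 - t) *\<^sub>R u" for u
      by (simp add: matrix_vector_mult_add_rdistrib scaleR_matrix_vector_assoc[symmetric] A)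
    have lin': "linear ((*v) (t *\<^sub>R A + (1 - t) *\<^sub>R mat 1))" by (rule matrix_vector_mul_linear)
    have "inj ((*v) (t *\<^sub>R A + (1 - t) *\<^sub>R mat 1))"
      unfolding linear_injective_0[OF lin'] mv using L_delta_injective[OF t] by blast
    then show ?thesis
      unfolding d_def using det_nz_iff_inj[OF matrix_vector_mul_linear[of "t *\<^sub>R A + (1 - t) *\<^sub>R mat 1"]] by simp
  qed
  moreover have "continuous_on {0..1} d"
  proof -
    have "continuous_on {0..1} (\<lambda>t. det (\<chi> i. (t *\<^sub>R A + (1 - t) *\<^sub>R mat 1) $ i))"
      by (intro continuous_on_det_rows continuous_intros)
    then show ?thesis unfolding d_def by (simp only: vec_lambda_eta)
  qed
  moreover have "d 0 > 0" by (simp add: d_def)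
  ultimately have "d 1 > 0"
    using IVT2'[of d 1 0 0] by (metis atLeastAtMost_iff not_less zero_le_one less_imp_le)
  then show ?thesis by (simp add: d_def A_def)
qed

text \<open>Only row \<open>x1\<close> depends on \<open>r\<close>, so the determinant is affine in
  \<open>r\<close>; its constant part is the determinant of \<open>L\<close>, which is 0 because
  constants lie in the kernel.\<close>

lemma det_L_plus_scaled_delta:
  "det (matrix (\<lambda>u. L u + r *\<^sub>R delta x1 u)) = r * det (matrix (\<lambda>u. L u + delta x1 u))"
proof -
  define B where "B = matrix L"
  have row: "matrix (\<lambda>u. L u + r *\<^sub>R delta x1 u) = (\<chi> i. if i = x1 then B $ i + r *s axis x1 1 else B $ i)" for r
    by (auto simp: vec_eq_iff B_def matrix_def delta_def axis_def)
  have "B *v (\<chi> x. 1) = L (\<chi> x. 1)"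
    unfolding B_def using matrix_vector_mul(2)[OF linear_L] by (rule fun_cong)
  also have "\<dots> = 0" by (simp add: L_def vec_eq_iff)
  finally have "B *v (\<chi> x. 1) = 0" .
  then have "\<not> inj ((*v) B)"
    using injD[of "(*v) B" "\<chi> x. 1" 0] by (auto simp: vec_eq_iff)
  then have "det B = 0" using det_nz_iff_inj[OF matrix_vector_mul_linear[of B]] by simp
  have "det (matrix (\<lambda>u. L u + r *\<^sub>R delta x1 u)) = r * det (\<chi> i. if i = x1 then axis x1 1 else B $ i)" for r
  proof -
    have "det (matrix (\<lambda>u. L u + r *\<^sub>R delta x1 u)) = det (\<chi> i. if i = x1 then B $ i else B $ i)
        + det (\<chi> i. if i = x1 then r *s axis x1 1 else B $ i)"
      unfolding row by (rule det_row_add)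
    also have "(\<chi> i. if i = x1 then B $ i else B $ i) = B" by (simp add: vec_eq_iff)
    finally show ?thesis using \<open>det B = 0\<close> by (simp add: det_row_mul)
  qed
  from this[of r] this[of 1] show ?thesis by simp
qed

text \<open>Adding \<open>delta x1\<close> makes \<open>L\<close> injective, hence bounded below.
  Subtracting the constant \<open>u $ x1\<close> from \<open>u\<close> changes neither the
  oscillation nor \<open>L u\<close> and makes the added term vanish.\<close>

lemma oscillation_bound:
  "\<exists>K>0. \<forall>u x y. \<bar>u $ x - u $ y\<bar> \<le> K * norm (L u)"
proof -
  fix x1 :: 'v
  have lin: "linear (\<lambda>u. L u + delta x1 u)"
    by (intro linear_compose_add linear_L linear_delta)
  have "inj (\<lambda>u. L u + delta x1 u)"
    unfolding linear_injective_0[OF lin] by (intro allI impI, rule L_delta_injective[of 1 _ x1]) auto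
  then obtain b where b: "b > 0" "\<And>u. b * norm u \<le> norm (L u + delta x1 u)"
    using linear_inj_bounded_below_pos[OF lin] by metis
  have bound: "\<bar>u $ x - u $ y\<bar> \<le> (2 / b) * norm (L u)" for u x y
  proof -
    define v where "v = u - (\<chi> x. u $ x1)"
    have Lc: "L (\<chi> x. u $ x1) = 0" by (simp add: L_def vec_eq_iff)
    have "L v = L u" unfolding v_def using linear_diff[OF linear_L] Lc by simp
    moreover have "delta x1 v = 0" by (simp add: v_def delta_def)
    ultimately have "b * norm v \<le> norm (L u)" using b(2)[of v] by simp
    then have nv: "norm v \<le> norm (L u) / b" using b(1) by (simp add: field_simps)
    have "\<bar>u $ x - u $ y\<bar> = \<bar>v $ x - v $ y\<bar>" by (simp add: v_def)
    also have "\<dots> \<le> norm v + norm v"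
      using component_le_norm_cart[of v x] component_le_norm_cart[of v y] by linarith
    finally show ?thesis using nv by simp
  qed
  show ?thesis using bound b(1) by (intro exI[of _ "2 / b"]) simp
qed

lemma sum_m_pos: "(\<Sum>x\<in>UNIV. m x) > 0"
  using vertex_weight_pos by (intro sum_pos) auto

text \<open>A one-sided bound suffices because of \<open>sum_m_L\<close>: a very negative value of
  \<open>L u\<close> would have to be balanced by large positive values elsewhere.\<close>

lemma oscillation_bound_upper:
  "\<exists>K>0. \<forall>u C. C \<ge> 0 \<longrightarrow> (\<forall>x. L u $ x \<le> C) \<longrightarrow> (\<forall>x y. \<bar>u $ x - u $ y\<bar> \<le> K * C)"
proof -
  obtain K where K: "K > 0" "\<And>u x y. \<bar>u $ x - u $ y\<bar> \<le> K * norm (L u)"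
    using oscillation_bound by blast
  define M where "M = (\<Sum>x\<in>UNIV. m x)"
  define B where "B = (\<Sum>x\<in>UNIV. 1 + M / m x)"
  have mM: "m x \<le> M" for x
    unfolding M_def using vertex_weight_pos by (intro member_le_sum) (auto simp: less_imp_le)
  have "M > 0" unfolding M_def by (rule sum_m_pos)
  have "B > 0" unfolding B_def using vertex_weight_pos \<open>M > 0\<close> by (intro sum_pos) (auto intro!: add_pos_pos)
  have "\<bar>u $ x - u $ y\<bar> \<le> (K * B) * C" if C: "C \<ge> 0" and L: "\<And>x. L u $ x \<le> C" for u C x y
  proof -
    have "\<bar>L u $ x\<bar> \<le> (1 + M / m x) * C" for x
    proof -
      have "m x * L u $ x + (\<Sum>z\<in>UNIV - {x}. m z * L u $ z) = 0"
        using sum_m_L[of u] by (simp add: sum.remove[of UNIV x])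
      moreover have "(\<Sum>z\<in>UNIV - {x}. m z * L u $ z) \<le> (\<Sum>z\<in>UNIV - {x}. m z * C)"
        using L vertex_weight_pos by (intro sum_mono mult_left_mono) (auto simp: less_imp_le)
      moreover have "(\<Sum>z\<in>UNIV - {x}. m z * C) \<le> M * C"
      proof -
        have "(\<Sum>z\<in>UNIV - {x}. m z * C) \<le> (\<Sum>z\<in>UNIV. m z * C)"
          using vertex_weight_pos C by (intro sum_mono2) (auto simp: less_imp_le)
        then show ?thesis by (simp add: M_def sum_distrib_right)
      qed
      ultimately have "- (m x * L u $ x) \<le> M * C" by linarith
      then have lo: "- (L u $ x) \<le> M / m x * C" using vertex_weight_pos[of x] by (simp add: field_simps)
      moreover have "M / m x * C \<ge> 0" using C \<open>M > 0\<close> vertex_weight_pos[of x] by simp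
      ultimately show ?thesis using L[of x] C by (simp add: algebra_simps abs_le_iff)
    qed
    then have "(\<Sum>x\<in>UNIV. \<bar>L u $ x\<bar>) \<le> (\<Sum>x\<in>UNIV. (1 + M / m x) * C)" by (rule sum_mono)
    then have "norm (L u) \<le> B * C"
      using norm_le_l1_cart[of "L u"] by (simp add: B_def sum_distrib_right)
    then have "K * norm (L u) \<le> K * (B * C)" using K(1) by simp
    then show ?thesis using K(2)[of u x y] by (simp add: mult.assoc)
  qed
  then show ?thesis using \<open>K > 0\<close> \<open>B > 0\<close> by (intro exI[of _ "K * B"]) auto
qed

lemma oscillation_bound_lower:
  "\<exists>K>0. \<forall>u C. C \<ge> 0 \<longrightarrow> (\<forall>x. L u $ x \<ge> - C) \<longrightarrow> (\<forall>x y. \<bar>u $ x - u $ y\<bar> \<le> K * C)"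
proof -
  obtain K where K: "K > 0" "\<And>u C x y. C \<ge> 0 \<Longrightarrow> (\<forall>x. L u $ x \<le> C) \<Longrightarrow> \<bar>u $ x - u $ y\<bar> \<le> K * C"
    using oscillation_bound_upper by blast
  have "\<bar>u $ x - u $ y\<bar> \<le> K * C" if "C \<ge> 0" "\<forall>x. L u $ x \<ge> - C" for u C x y
    using K(2)[of C "- u" x y] that by (simp add: L_minus minus_le_iff abs_minus_commute)
  then show ?thesis using K(1) by blast
qed

end

section \<open>A priori bounds and homotopies\<close>

text \<open>The comparison is with affine functions because, once \<open>u\<close> is bounded below,
  \<open>L u\<close> at a vertex grows at most linearly in the value of \<open>u\<close>
  there.\<close>

definition superlinear :: "(real \<Rightarrow> real) \<Rightarrow> bool" where
  "superlinear \<phi> \<longleftrightarrow> (\<forall>A B. \<exists>Y. \<forall>y\<ge>Y. \<phi> y > A * y + B)"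

definition mix :: "real \<Rightarrow> ('v \<Rightarrow> real \<Rightarrow> real) \<Rightarrow> ('v \<Rightarrow> real \<Rightarrow> real) \<Rightarrow> 'v \<Rightarrow> real \<Rightarrow> real" where
  "mix t F G x y = (1 - t) * F x y + t * G x y"

lemma mix_le: "0 \<le> t \<Longrightarrow> t \<le> 1 \<Longrightarrow> F x y \<le> a \<Longrightarrow> G x y \<le> a \<Longrightarrow> mix t F G x y \<le> a"
  unfolding mix_def by (rule convex_bound_le) auto

lemma mix_ge: "0 \<le> t \<Longrightarrow> t \<le> 1 \<Longrightarrow> F x y \<ge> a \<Longrightarrow> G x y \<ge> a \<Longrightarrow> mix t F G x y \<ge> a"
  using convex_bound_le[of "- F x y" "- a" "- G x y" "1 - t" t] by (simp add: mix_def)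

lemma mix_gt: "0 \<le> t \<Longrightarrow> t \<le> 1 \<Longrightarrow> F x y > a \<Longrightarrow> G x y > a \<Longrightarrow> mix t F G x y > a"
  using convex_bound_lt[of "- F x y" "- a" "- G x y" "1 - t" t] by (simp add: mix_def)

lemma finite_uniform_bound:
  fixes P :: "'a::finite \<Rightarrow> real \<Rightarrow> bool"
  assumes "\<And>x. \<exists>C. P x C" "\<And>x C C'. P x C \<Longrightarrow> C \<le> C' \<Longrightarrow> P x C'"
  shows "\<exists>C\<ge>0. \<forall>x. P x C"
proof -
  obtain c where c: "\<And>x. P x (c x)" using assms(1) by metis
  have "\<bar>c x\<bar> \<le> (\<Sum>x\<in>UNIV. \<bar>c x\<bar>)" for x
    by (rule member_le_sum) auto
  then have "c x \<le> (\<Sum>x\<in>UNIV. \<bar>c x\<bar>)" for x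
    by (rule order_trans[OF abs_ge_self])
  then have "P x (\<Sum>x\<in>UNIV. \<bar>c x\<bar>)" for x using assms(2) c by blast
  then show ?thesis by (intro exI[of _ "\<Sum>x\<in>UNIV. \<bar>c x\<bar>"]) (simp add: sum_nonneg)
qed

context finite_connected_weighted_graph
begin

definition H :: "('v \<Rightarrow> real \<Rightarrow> real) \<Rightarrow> real^'v \<Rightarrow> real^'v" where
  "H F u = L u - (\<chi> x. F x (u $ x))"

lemma kw_map_eq: "kw_map E \<omega> m n f c = H (exp_sum n f c)"
  by (auto simp: fun_eq_iff vec_eq_iff kw_map_def H_def exp_sum_def laplacian_eq)

lemma H_eq_0_iff: "H F u = 0 \<longleftrightarrow> (\<forall>x. L u $ x = F x (u $ x))"
  by (auto simp: H_def vec_eq_iff)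

lemma H_mix: "(1 - t) *\<^sub>R H F u + t *\<^sub>R H G u = H (mix t F G) u"
  by (simp add: H_def mix_def vec_eq_iff algebra_simps)

lemma C2_on_H: "(\<And>x. smooth2 (F x)) \<Longrightarrow> C2_on U (H F)"
  using C2_on_linear_minus_diagonal[OF bounded_linear_L, of F U] by (simp add: H_def[abs_def])

lemma continuous_on_H:
  assumes "\<And>x. smooth2 (F x)"
  shows "continuous_on S (H F)"
proof -
  have "C2_on UNIV (H F)" using assms by (rule C2_on_H)
  then have "continuous_on UNIV (H F)"
    by (intro continuous_at_imp_continuous_on ballI has_derivative_continuous) (auto intro: C2_onD(2))
  then show ?thesis using continuous_on_subset by blast
qed

lemma L_mono: "(\<And>y. u $ x - u $ y \<le> v $ x - v $ y) \<Longrightarrow> L u $ x \<le> L v $ x"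
  unfolding L_def using vertex_weight_pos[of x] edge_weight_nonneg
  by (auto intro!: divide_right_mono sum_mono mult_left_mono simp: less_imp_le)

text \<open>The weighted degree of the vertex, which turns one-sided bounds on differences of
  \<open>u\<close> into bounds on \<open>L u\<close>.\<close>

definition D :: "'v \<Rightarrow> real" where
  "D x = (\<Sum>y\<in>UNIV. \<omega> x y) / m x"



lemma L_le: 
  assumes "\<And>y. u $ x - u $ y \<le> B"
  shows "L u $ x \<le> D x * B"
proof -
  have "(\<Sum>y\<in>UNIV. \<omega> x y * (u $ x - u $ y)) \<le> (\<Sum>y\<in>UNIV. \<omega> x y * B)"
    by (intro sum_mono mult_left_mono assms edge_weight_nonneg)
  then have "L u $ x \<le> (\<Sum>y\<in>UNIV. \<omega> x y * B) / m x"
    unfolding L_def using vertex_weight_pos[of x] by (simp add: divide_right_mono)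
  also have "\<dots> = D x * B" by (simp add: D_def sum_distrib_right)
  finally show ?thesis .
qed

lemma L_ge:
  assumes "\<And>y. u $ x - u $ y \<ge> - B"
  shows "L u $ x \<ge> - (D x * B)"
proof -
  have "(- u) $ x - (- u) $ y \<le> B" for y using assms[of y] by simp
  from L_le[of "- u", OF this] show ?thesis by (simp add: L_minus)
qed

definition eventual_degree :: "('v \<Rightarrow> real \<Rightarrow> real) \<Rightarrow> int \<Rightarrow> bool" where
  "eventual_degree F d \<longleftrightarrow> (\<exists>K. \<forall>R>K. brouwer_degree (H F) (interior (sup_ball R)) 0 = d)"

lemma kw_degree_eqI:
  assumes "eventual_degree (exp_sum n f c) d"
  shows "kw_degree E \<omega> m n f c = d"
proof -
  obtain K where K: "\<And>R. R > K \<Longrightarrow> brouwer_degree (H (exp_sum n f c)) (interior (sup_ball R)) 0 = d"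
    using assms unfolding eventual_degree_def by blast
  have "\<forall>\<^sub>F R in at_top. brouwer_degree (kw_map E \<omega> m n f c) (interior (sup_ball R)) 0 = d"
    unfolding kw_map_eq by (rule eventually_mono[OF eventually_gt_at_top[of K] K])
  then have "((\<lambda>R. brouwer_degree (kw_map E \<omega> m n f c) (interior (sup_ball R)) 0) \<longlongrightarrow> d) at_top"
    by (rule tendsto_eventually)
  then show ?thesis unfolding kw_degree_def by (intro tendsto_Lim) auto
qed

text \<open>\<open>P\<close> stands for a one-sided bound. The two sides are kept apart because they
  hold for different reasons, and a proof of the upper one may use the lower one.\<close>

definition bounded_along :: "('v \<Rightarrow> real \<Rightarrow> real) \<Rightarrow> ('v \<Rightarrow> real \<Rightarrow> real) \<Rightarrow> (real \<Rightarrow> real \<Rightarrow> bool) \<Rightarrow> bool" where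
  "bounded_along F G P \<longleftrightarrow> (\<exists>K. \<forall>t u. 0 \<le> t \<longrightarrow> t \<le> 1 \<longrightarrow> (\<forall>x. L u $ x = mix t F G x (u $ x)) \<longrightarrow> (\<forall>x. P K (u $ x)))"

abbreviation "lower_bounded F G \<equiv> bounded_along F G (\<lambda>K y. y \<ge> - K)"
abbreviation "upper_bounded F G \<equiv> bounded_along F G (\<lambda>K y. y \<le> K)"

lemma eventual_degree_homotopy:
  assumes F: "\<And>x. smooth2 (F x)" and G: "\<And>x. smooth2 (G x)"
    and lo: "lower_bounded F G" and up: "upper_bounded F G" and d: "eventual_degree G d"
  shows "eventual_degree F d"
proof -
  obtain K1 where K1: "\<And>t u x. 0 \<le> t \<Longrightarrow> t \<le> 1 \<Longrightarrow> (\<And>x. L u $ x = mix t F G x (u $ x)) \<Longrightarrow> u $ x \<ge> - K1"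
    using lo unfolding bounded_along_def by blast
  obtain K2 where K2: "\<And>t u x. 0 \<le> t \<Longrightarrow> t \<le> 1 \<Longrightarrow> (\<And>x. L u $ x = mix t F G x (u $ x)) \<Longrightarrow> u $ x \<le> K2"
    using up unfolding bounded_along_def by blast
  obtain K3 where K3: "\<And>R. R > K3 \<Longrightarrow> brouwer_degree (H G) (interior (sup_ball R)) 0 = d"
    using d unfolding eventual_degree_def by blast
  \<comment> \<open>The cardinality enters because the sup norm is estimated by the sum of the
    absolute values.\<close>
  define K where "K = max 0 (max K3 (CARD('v) * max K1 K2))"
  have "brouwer_degree (H F) (interior (sup_ball R)) 0 = d" if R: "R > K" for R
  proof -
    have R0: "R > 0" "R > K3" "R > CARD('v) * max K1 K2" using R by (auto simp: K_def)
    note B = sup_ball_interior[where 'n='v, OF R0(1)]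
    have "brouwer_degree (H F) (interior (sup_ball R)) 0 = brouwer_degree (H G) (interior (sup_ball R)) 0"
    proof (rule brouwer_degree_homotopy[OF B(1-3) continuous_on_H[OF F] C2_on_H[OF F] continuous_on_H[OF G] C2_on_H[OF G]])
      show "(1 - t) *\<^sub>R H F u + t *\<^sub>R H G u \<noteq> 0" if t: "0 \<le> t" "t \<le> 1" and u: "u \<in> frontier (interior (sup_ball R))" for t u
      proof
        assume "(1 - t) *\<^sub>R H F u + t *\<^sub>R H G u = 0"
        then have sol: "\<And>x. L u $ x = mix t F G x (u $ x)" by (simp add: H_mix H_eq_0_iff)
        have "\<bar>u $ x\<bar> \<le> max K1 K2" for x using K1[OF t sol, of x] K2[OF t sol, of x] by linarith
        then have "(\<Sum>x\<in>UNIV. \<bar>u $ x\<bar>) \<le> (\<Sum>x\<in>(UNIV::'v set). max K1 K2)" by (rule sum_mono)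
        then have "infnorm u \<le> CARD('v) * max K1 K2"
          using norm_le_l1_cart[of u] infnorm_le_norm[of u] by simp
        then show False using B(4)[OF u] R0(3) by linarith
      qed
    qed
    then show ?thesis using K3[OF R0(2)] by simp
  qed
  then show ?thesis unfolding eventual_degree_def by blast
qed

lemma eventual_degree_no_zeros:
  assumes F: "\<And>x. smooth2 (F x)" and nz: "\<And>u. \<exists>x. L u $ x \<noteq> F x (u $ x)"
  shows "eventual_degree F 0"
proof -
  have H0: "H F u \<noteq> 0" for u using nz[of u] by (auto simp: H_eq_0_iff)
  have "brouwer_degree (H F) (interior (sup_ball R)) 0 = 0" if R: "R > 0" for R
  proof -
    note B = sup_ball_interior[where 'n='v, OF R]
    have "regular_value_on (interior (sup_ball R)) (H F) 0" using H0 by (simp add: regular_value_on_def)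
    from brouwer_degree_regular[OF B(1-3) continuous_on_H[OF F] C2_on_H[OF F] H0 this]
    show ?thesis using H0 by simp
  qed
  then show ?thesis unfolding eventual_degree_def by blast
qed

lemma sum_m_solution:
  assumes "\<And>x. L u $ x = F x (u $ x)"
  shows "(\<Sum>x\<in>UNIV. m x * F x (u $ x)) = 0"
  using sum_m_L[of u] by (simp add: assms)

text \<open>A model that can be solved by hand: summing the equation determines the value at
  \<open>x1\<close>, which makes the source vanish, so a solution is harmonic everywhere.\<close>

definition point_source :: "'v \<Rightarrow> real \<Rightarrow> real \<Rightarrow> 'v \<Rightarrow> real \<Rightarrow> real" where
  "point_source x1 k s x y = (if x = x1 then k + s * exp y else 0)"

lemma smooth2_point_source: "smooth2 (point_source x1 k s x)"
proof -
  have "smooth2 (\<lambda>y. k + s * exp (1 * y))"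
    by (intro smooth2_add smooth2_const smooth2_cmult smooth2_exp)
  then show ?thesis unfolding point_source_def by (cases "x = x1") (auto simp: smooth2_const)
qed

lemma point_source_solution:
  assumes "\<And>x. L u $ x = point_source x1 k s x (u $ x)"
  shows "k + s * exp (u $ x1) = 0"
proof -
  have "(\<Sum>x\<in>UNIV. m x * point_source x1 k s x (u $ x)) = 0"
    using assms by (rule sum_m_solution)
  moreover have "m x * point_source x1 k s x (u $ x) = (if x = x1 then m x1 * (k + s * exp (u $ x1)) else 0)" for x
    by (simp add: point_source_def)
  ultimately have "m x1 * (k + s * exp (u $ x1)) = 0" by simp
  then show ?thesis using vertex_weight_pos[of x1] by auto
qed

lemma eventual_degree_point_source_same_sign:
  assumes "k * s > 0"
  shows "eventual_degree (point_source x1 k s) 0"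
proof (rule eventual_degree_no_zeros[OF smooth2_point_source])
  fix u
  have "k + s * exp (u $ x1) \<noteq> 0"
  proof
    assume "k + s * exp (u $ x1) = 0"
    then have "k * k + (k * s) * exp (u $ x1) = 0"
      by (metis distrib_left mult.assoc mult_zero_right)
    moreover have "(k * s) * exp (u $ x1) > 0" using assms by simp
    moreover have "k * k \<ge> 0" by simp
    ultimately show False by linarith
  qed
  then show "\<exists>x. L u $ x \<noteq> point_source x1 k s x (u $ x)"
    using point_source_solution[of u x1 k s] by blast
qed

lemma eventual_degree_point_source:
  assumes r: "r = 1 \<or> r = (- 1 :: int)"
  shows "eventual_degree (point_source x1 (real_of_int r) (- real_of_int r)) r"
proof -
  let ?F = "point_source x1 (real_of_int r) (- real_of_int r)"
  have sol: "H ?F u = 0 \<longleftrightarrow> u = 0" for u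
  proof
    assume "H ?F u = 0"
    then have s: "\<And>x. L u $ x = ?F x (u $ x)" by (simp add: H_eq_0_iff)
    have "u $ x1 = 0" using point_source_solution[OF s] r by auto
    then have "L u $ x = 0" for x using s[of x] by (auto simp: point_source_def)
    then have "L u = 0" "delta x1 u = 0" using \<open>u $ x1 = 0\<close> by (auto simp: vec_eq_iff delta_def axis_def)
    then show "u = 0" by (intro L_delta_injective[of 1 u x1]) auto
  next
    assume "u = 0"
    then show "H ?F u = 0"
      by (auto simp: H_eq_0_iff point_source_def linear_0[OF linear_L])
  qed
  have comp: "((\<lambda>u :: real^'v. ?F x (u $ x)) has_derivative (\<lambda>h. if x = x1 then - real_of_int r * h $ x else 0)) (at 0)" for x
  proof (cases "x = x1")
    case True
    have "((\<lambda>u :: real^'v. real_of_int r + (- real_of_int r) * exp (u $ x1)) has_derivative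
        (\<lambda>h. - real_of_int r * (h $ x1))) (at 0)"
      by (auto intro!: derivative_eq_intros bounded_linear.has_derivative[OF bounded_linear_vec_nth])
    then show ?thesis by (simp add: True point_source_def)
  qed (simp add: point_source_def)
  have "(H ?F has_derivative (\<lambda>h. L h - (\<chi> x. if x = x1 then - real_of_int r * h $ x else 0))) (at 0)"
    unfolding H_def[abs_def]
    by (intro has_derivative_diff has_derivative_vec_lambda comp bounded_linear_imp_has_derivative bounded_linear_L)
  moreover have "(\<lambda>h. L h - (\<chi> x. if x = x1 then - real_of_int r * h $ x else 0)) = (\<lambda>h. L h + real_of_int r *\<^sub>R delta x1 h)"
    by (auto simp: fun_eq_iff vec_eq_iff delta_def axis_def)
  ultimately have "(H ?F has_derivative (\<lambda>h. L h + real_of_int r *\<^sub>R delta x1 h)) (at 0)" by simp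
  then have J: "jacobian (H ?F) (at 0) = matrix (\<lambda>h. L h + real_of_int r *\<^sub>R delta x1 h)"
    unfolding jacobian_def using frechet_derivative_at by metis
  have sgn: "sgn (det (jacobian (H ?F) (at 0))) = real_of_int r"
    unfolding J det_L_plus_scaled_delta using det_L_plus_delta_pos[of x1] r by (auto simp: sgn_mult)
  have "brouwer_degree (H ?F) (interior (sup_ball R)) 0 = r" if R: "R > 0" for R
  proof -
    note B = sup_ball_interior[where 'n='v, OF R]
    have reg: "regular_value_on (interior (sup_ball R)) (H ?F) 0"
      unfolding regular_value_on_def sol using sgn r by auto
    have nz: "H ?F u \<noteq> 0" if "u \<in> frontier (interior (sup_ball R))" for u
      using B(4)[OF that] R by (auto simp: sol infnorm_0)
    have "{u \<in> interior (sup_ball R). H ?F u = 0} = {0}"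
      using B(5)[of 0] R by (auto simp: sol infnorm_0)
    then show ?thesis
      using brouwer_degree_regular[OF B(1-3) continuous_on_H[OF smooth2_point_source] C2_on_H[OF smooth2_point_source] nz reg] sgn
      by simp
  qed
  then show ?thesis unfolding eventual_degree_def by blast
qed

text \<open>Only one vertex above \<open>- K\<close> is requested, which is what summing the
  equation can give; \<open>lower_boundedI\<close> extends the bound to all vertices.\<close>

definition no_low_solutions :: "('v \<Rightarrow> real \<Rightarrow> real) \<Rightarrow> ('v \<Rightarrow> real \<Rightarrow> real) \<Rightarrow> bool" where
  "no_low_solutions F G \<longleftrightarrow> (\<exists>K. \<forall>t u. 0 \<le> t \<longrightarrow> t \<le> 1 \<longrightarrow> (\<forall>x. L u $ x = mix t F G x (u $ x)) \<longrightarrow> (\<exists>x. u $ x > - K))"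

text \<open>The truncation \<open>v = min u 0\<close> satisfies \<open>L v \<ge> - C\<close> everywhere, so if \<open>u\<close> is very negative somewhere,
  it is very negative everywhere.\<close>

lemma lower_boundedI:
  assumes F: "\<And>x y. y \<le> 0 \<Longrightarrow> F x y \<ge> - C" and G: "\<And>x y. y \<le> 0 \<Longrightarrow> G x y \<ge> - C" and C: "C \<ge> 0"
    and low: "no_low_solutions F G"
  shows "lower_bounded F G"
proof -
  obtain K0 where K0: "K0 > 0" "\<And>u C x y. C \<ge> 0 \<Longrightarrow> (\<And>x. L u $ x \<ge> - C) \<Longrightarrow> \<bar>u $ x - u $ y\<bar> \<le> K0 * C"
    using oscillation_bound_lower by blast
  obtain K1 where K1: "\<And>t u. 0 \<le> t \<Longrightarrow> t \<le> 1 \<Longrightarrow> (\<And>x. L u $ x = mix t F G x (u $ x)) \<Longrightarrow> \<exists>x. u $ x > - K1"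
    using low unfolding no_low_solutions_def by blast
  have "u $ x \<ge> - (K0 * C + \<bar>K1\<bar> + 1)"
    if t: "0 \<le> t" "t \<le> 1" and sol: "\<And>x. L u $ x = mix t F G x (u $ x)" for t u x
  proof (rule ccontr)
    assume "\<not> ?thesis"
    then have ux: "u $ x < - (K0 * C + \<bar>K1\<bar> + 1)" by simp
    have KC: "K0 * C \<ge> 0" using K0(1) C by simp
    define v where "v = (\<chi> x. min (u $ x) 0)"
    have "L v $ z \<ge> - C" for z
    proof (cases "u $ z \<le> 0")
      case True
      \<comment> \<open>Truncation keeps the value at \<open>z\<close> and can only lower the
        others, which raises \<open>L\<close> at \<open>z\<close>.\<close>
      have "L u $ z \<le> L v $ z" using True by (intro L_mono) (auto simp: v_def)
      moreover have "mix t F G z (u $ z) \<ge> - C" using F G True by (intro mix_ge t) auto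
      ultimately show ?thesis using sol[of z] by linarith
    next
      case False
      \<comment> \<open>Here \<open>v\<close> attains its maximum 0 at \<open>z\<close>.\<close>
      have "L 0 $ z \<le> L v $ z" using False by (intro L_mono) (auto simp: v_def)
      then show ?thesis using C linear_0[OF linear_L] by simp
    qed
    from K0(2)[OF C this] have osc: "\<bar>v $ x - v $ y\<bar> \<le> K0 * C" for y .
    have "u $ y \<le> - K1" for y
    proof -
      have "v $ x < - (K0 * C + \<bar>K1\<bar> + 1)" using ux KC by (simp add: v_def)
      then have "v $ y < - \<bar>K1\<bar>" using osc[of y] by linarith
      then have "min (u $ y) 0 < - \<bar>K1\<bar>" by (simp add: v_def)
      then show ?thesis by linarith
    qed
    then show False using K1[OF t sol] by (metis not_less)
  qed
  then show ?thesis unfolding bounded_along_def by blast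
qed

text \<open>At a vertex of \<open>P\<close> the lower bound gives
  \<open>L u \<le> D * (u + K)\<close>, which superlinear growth contradicts beyond
  \<open>Y\<close>. Off \<open>P\<close> the equation bounds \<open>L u\<close> above, so the
  truncation of \<open>u\<close> from below at height \<open>Y\<close> satisfies a one-sided bound
  everywhere; it equals \<open>Y\<close> at \<open>x1\<close>, and its oscillation is
  bounded.\<close>

lemma upper_bounded_superlinear:
  assumes off: "\<And>x y. x \<notin> P \<Longrightarrow> F x y \<le> C" "\<And>x y. x \<notin> P \<Longrightarrow> G x y \<le> C" and C: "C \<ge> 0"
    and on: "\<And>x. x \<in> P \<Longrightarrow> superlinear (F x)" "\<And>x. x \<in> P \<Longrightarrow> superlinear (G x)"
    and P: "x1 \<in> P" and lo: "lower_bounded F G"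
  shows "upper_bounded F G"
proof -
  obtain K0 where K0: "K0 > 0" "\<And>u C x y. C \<ge> 0 \<Longrightarrow> (\<And>x. L u $ x \<le> C) \<Longrightarrow> \<bar>u $ x - u $ y\<bar> \<le> K0 * C"
    using oscillation_bound_upper by blast
  obtain K where K: "\<And>t u x. 0 \<le> t \<Longrightarrow> t \<le> 1 \<Longrightarrow> (\<And>x. L u $ x = mix t F G x (u $ x)) \<Longrightarrow> u $ x \<ge> - K"
    using lo unfolding bounded_along_def by blast
  have ex: "\<exists>Y. x \<in> P \<longrightarrow> (\<forall>y\<ge>Y. F x y > D x * y + D x * K \<and> G x y > D x * y + D x * K)" for x
  proof (cases "x \<in> P")
    case True
    obtain Y1 where "\<forall>y\<ge>Y1. F x y > D x * y + D x * K" using on(1)[OF True] unfolding superlinear_def by blast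
    moreover obtain Y2 where "\<forall>y\<ge>Y2. G x y > D x * y + D x * K" using on(2)[OF True] unfolding superlinear_def by blast
    ultimately show ?thesis by (intro exI[of _ "max Y1 Y2"]) auto
  qed auto
  have "\<exists>Y\<ge>0. \<forall>x. x \<in> P \<longrightarrow> (\<forall>y\<ge>Y. F x y > D x * y + D x * K \<and> G x y > D x * y + D x * K)"
    by (rule finite_uniform_bound, rule ex) auto
  then obtain Y where Y: "Y \<ge> 0"
    "\<And>x. x \<in> P \<longrightarrow> (\<forall>y\<ge>Y. F x y > D x * y + D x * K \<and> G x y > D x * y + D x * K)"
    by blast
  have "u $ x \<le> Y + K0 * C"
    if t: "0 \<le> t" "t \<le> 1" and sol: "\<And>x. L u $ x = mix t F G x (u $ x)" for t u x
  proof -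
    have onP: "u $ z \<le> Y" if z: "z \<in> P" for z
    proof (rule ccontr)
      assume "\<not> ?thesis"
      then have "mix t F G z (u $ z) > D z * (u $ z) + D z * K" using Y(2) z by (intro mix_gt t) auto
      moreover have "L u $ z \<le> D z * (u $ z + K)"
      proof (rule L_le)
        show "u $ z - u $ y \<le> u $ z + K" for y using K[OF t sol, of y] by linarith
      qed
      ultimately show False using sol[of z] by (simp add: distrib_left)
    qed
    define w where "w = (\<chi> x. max (u $ x) Y)"
    have "L w $ z \<le> C" for z
    proof (cases "u $ z \<le> Y")
      case True
      have "L w $ z \<le> L 0 $ z" using True by (intro L_mono) (auto simp: w_def)
      then show ?thesis using C linear_0[OF linear_L] by simp
    next
      case False
      then have "z \<notin> P" using onP by auto
      have "L w $ z \<le> L u $ z" using False by (intro L_mono) (auto simp: w_def)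
      moreover have "mix t F G z (u $ z) \<le> C" using off \<open>z \<notin> P\<close> by (intro mix_le t) auto
      ultimately show ?thesis using sol[of z] by linarith
    qed
    from K0(2)[OF C this] have "\<bar>w $ x - w $ x1\<bar> \<le> K0 * C" .
    moreover have "w $ x1 = Y" using onP[OF P] by (simp add: w_def)
    moreover have "u $ x \<le> w $ x" by (simp add: w_def)
    ultimately show ?thesis by linarith
  qed
  then show ?thesis unfolding bounded_along_def by blast
qed

text \<open>The upper bound on the nonlinearity alone controls the oscillation, and thereby
  \<open>L u\<close> at \<open>x1\<close> from below; a very large value of \<open>u\<close> at
  \<open>x1\<close> would push the nonlinearity under this bound.\<close>

lemma upper_bounded_bounded_above:
  assumes le: "\<And>x y. F x y \<le> C" "\<And>x y. G x y \<le> C" and C: "C \<ge> 0"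
    and x1: "superlinear (\<lambda>y. - F x1 y)" "superlinear (\<lambda>y. - G x1 y)"
  shows "upper_bounded F G"
proof -
  obtain K0 where K0: "K0 > 0" "\<And>u C x y. C \<ge> 0 \<Longrightarrow> (\<And>x. L u $ x \<le> C) \<Longrightarrow> \<bar>u $ x - u $ y\<bar> \<le> K0 * C"
    using oscillation_bound_upper by blast
  define A where "A = D x1 * (K0 * C)"
  obtain Y1 where Y1: "\<forall>y\<ge>Y1. - F x1 y > 0 * y + A" using x1(1) unfolding superlinear_def by blast
  obtain Y2 where Y2: "\<forall>y\<ge>Y2. - G x1 y > 0 * y + A" using x1(2) unfolding superlinear_def by blast
  have "u $ x \<le> max Y1 Y2 + K0 * C"
    if t: "0 \<le> t" "t \<le> 1" and sol: "\<And>x. L u $ x = mix t F G x (u $ x)" for t u x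
  proof -
    have "mix t F G z (u $ z) \<le> C" for z by (intro mix_le t le)
    then have "L u $ z \<le> C" for z using sol[of z] by simp
    from K0(2)[OF C this] have osc: "\<bar>u $ a - u $ b\<bar> \<le> K0 * C" for a b .
    have "u $ x1 < max Y1 Y2"
    proof (rule ccontr)
      assume "\<not> ?thesis"
      then have "- F x1 (u $ x1) > A" "- G x1 (u $ x1) > A" using Y1 Y2 by auto
      then have "mix t (\<lambda>x y. - F x y) (\<lambda>x y. - G x y) x1 (u $ x1) > A" by (intro mix_gt t)
      then have "mix t F G x1 (u $ x1) < - A" by (simp add: mix_def)
      moreover have "L u $ x1 \<ge> - (D x1 * (K0 * C))"
      proof (rule L_ge)
        show "u $ x1 - u $ y \<ge> - (K0 * C)" for y using osc[of x1 y] by linarith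
      qed
      ultimately show False using sol[of x1] by (simp add: A_def)
    qed
    then show ?thesis using osc[of x x1] by linarith
  qed
  then show ?thesis unfolding bounded_along_def by blast
qed

text \<open>The same argument for the nonlinearity with reversed sign: the oscillation bounds
  \<open>L u\<close> at \<open>x1\<close> from above, and growth at \<open>x1\<close> still limits
  \<open>u\<close> from above.\<close>

lemma upper_bounded_bounded_below:
  assumes ge: "\<And>x y. F x y \<ge> - C" "\<And>x y. G x y \<ge> - C" and C: "C \<ge> 0"
    and x1: "superlinear (F x1)" "superlinear (G x1)"
  shows "upper_bounded F G"
proof -
  obtain K0 where K0: "K0 > 0" "\<And>u C x y. C \<ge> 0 \<Longrightarrow> (\<And>x. L u $ x \<ge> - C) \<Longrightarrow> \<bar>u $ x - u $ y\<bar> \<le> K0 * C"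
    using oscillation_bound_lower by blast
  define A where "A = D x1 * (K0 * C)"
  obtain Y1 where Y1: "\<forall>y\<ge>Y1. F x1 y > 0 * y + A" using x1(1) unfolding superlinear_def by blast
  obtain Y2 where Y2: "\<forall>y\<ge>Y2. G x1 y > 0 * y + A" using x1(2) unfolding superlinear_def by blast
  have "u $ x \<le> max Y1 Y2 + K0 * C"
    if t: "0 \<le> t" "t \<le> 1" and sol: "\<And>x. L u $ x = mix t F G x (u $ x)" for t u x
  proof -
    have "mix t F G z (u $ z) \<ge> - C" for z by (intro mix_ge t ge)
    then have "L u $ z \<ge> - C" for z using sol[of z] by simp
    from K0(2)[OF C this] have osc: "\<bar>u $ a - u $ b\<bar> \<le> K0 * C" for a b .
    have "u $ x1 < max Y1 Y2"
    proof (rule ccontr)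
      assume "\<not> ?thesis"
      then have "mix t F G x1 (u $ x1) > A" using Y1 Y2 by (intro mix_gt t) auto
      moreover have "L u $ x1 \<le> D x1 * (K0 * C)"
      proof (rule L_le)
        show "u $ x1 - u $ y \<le> K0 * C" for y using osc[of x1 y] by linarith
      qed
      ultimately show False using sol[of x1] by (simp add: A_def)
    qed
    then show ?thesis using osc[of x x1] by linarith
  qed
  then show ?thesis unfolding bounded_along_def by blast
qed

text \<open>For solutions this weighted sum is 0, so a definite sign excludes very negative
  solutions. For a fixed \<open>s\<close> the condition survives convex combinations; hence
  \<open>s\<close> has to agree at both ends of a deformation.\<close>

definition low_sign :: "real \<Rightarrow> ('v \<Rightarrow> real \<Rightarrow> real) \<Rightarrow> bool" where
  "low_sign s F \<longleftrightarrow> (\<exists>K. \<forall>u. (\<forall>x. u $ x \<le> - K) \<longrightarrow> s * (\<Sum>x\<in>UNIV. m x * F x (u $ x)) > 0)"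

lemma low_signI:
  assumes "\<And>x y. y \<le> - K \<Longrightarrow> s * F x y \<ge> 0" "\<And>y. y \<le> - K \<Longrightarrow> s * F x1 y > 0"
  shows "low_sign s F"
  unfolding low_sign_def
proof (intro exI[of _ K] allI impI)
  fix u :: "real^'v" assume u: "\<forall>x. u $ x \<le> - K"
  have "0 < (\<Sum>x\<in>UNIV. m x * (s * F x (u $ x)))"
  proof (rule sum_pos2[of _ x1])
    show "0 < m x1 * (s * F x1 (u $ x1))" using vertex_weight_pos assms(2) u by simp
    show "0 \<le> m x * (s * F x (u $ x))" for x
      using vertex_weight_pos[of x] assms(1)[of "u $ x" x] u by simp
  qed auto
  then show "s * (\<Sum>x\<in>UNIV. m x * F x (u $ x)) > 0"
    by (simp add: sum_distrib_left mult.left_commute)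
qed

lemma no_low_solutions_sign:
  assumes "low_sign s F" "low_sign s G"
  shows "no_low_solutions F G"
proof -
  obtain K1 where K1: "\<And>u. (\<And>x. u $ x \<le> - K1) \<Longrightarrow> s * (\<Sum>x\<in>UNIV. m x * F x (u $ x)) > 0"
    using assms(1) unfolding low_sign_def by blast
  obtain K2 where K2: "\<And>u. (\<And>x. u $ x \<le> - K2) \<Longrightarrow> s * (\<Sum>x\<in>UNIV. m x * G x (u $ x)) > 0"
    using assms(2) unfolding low_sign_def by blast
  have "\<exists>x. u $ x > - max K1 K2" if t: "0 \<le> t" "t \<le> 1" and sol: "\<And>x. L u $ x = mix t F G x (u $ x)" for t u
  proof (rule ccontr)
    assume "\<not> ?thesis"
    then have u: "u $ x \<le> - max K1 K2" for x by (auto simp: not_less)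
    define SF where "SF = (\<Sum>x\<in>UNIV. m x * F x (u $ x))"
    define SG where "SG = (\<Sum>x\<in>UNIV. m x * G x (u $ x))"
    have "u $ x \<le> - K1" "u $ x \<le> - K2" for x using u[of x] by auto
    then have pos: "s * SF > 0" "s * SG > 0" using K1 K2 unfolding SF_def SG_def by blast+
    have "(\<Sum>x\<in>UNIV. m x * mix t F G x (u $ x)) = 0" using sol by (rule sum_m_solution)
    moreover have "m x * mix t F G x (u $ x) = (1 - t) * (m x * F x (u $ x)) + t * (m x * G x (u $ x))" for x
      by (simp add: mix_def algebra_simps)
    ultimately have "(1 - t) * SF + t * SG = 0"
      by (simp add: SF_def SG_def sum.distrib sum_distrib_left)
    then have "(1 - t) * (s * SF) + t * (s * SG) = 0"
      by (metis (no_types, opaque_lifting) distrib_left mult.left_commute mult_zero_right)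
    moreover have "(1 - t) * (s * SF) + t * (s * SG) > 0"
      using convex_bound_lt[of "- (s * SF)" 0 "- (s * SG)" "1 - t" t] pos t by simp
    ultimately show False by simp
  qed
  then show ?thesis unfolding no_low_solutions_def by blast
qed

end

section \<open>Exponential sums\<close>

definition esum :: "nat \<Rightarrow> (nat \<Rightarrow> real) \<Rightarrow> real \<Rightarrow> real \<Rightarrow> real" where
  "esum n g c y = (\<Sum>i=1..n. g i * exp (real i * y)) + c"

lemma exp_sum_eq_esum: "exp_sum n f c x = esum n (\<lambda>i. f i x) c"
  by (simp add: fun_eq_iff exp_sum_def esum_def)

text \<open>The last nonzero coefficient decides, and not \<open>g n\<close>, because the highest
  coefficients may vanish at a given vertex.\<close>

definition lead_pos :: "nat \<Rightarrow> (nat \<Rightarrow> real) \<Rightarrow> bool" where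
  "lead_pos n g \<longleftrightarrow> (\<exists>k\<in>{1..n}. g k > 0 \<and> (\<forall>i\<in>{k<..n}. g i = 0))"

lemma esum_minus: "esum n (\<lambda>i. - g i) (- c) y = - esum n g c y"
  by (simp add: esum_def sum_negf)

lemma lead_trichotomy: "lead_pos n g \<or> lead_pos n (\<lambda>i. - g i) \<or> (\<forall>i\<in>{1..n}. g i = 0)"
proof (cases "\<forall>i\<in>{1..n}. g i = 0")
  case False
  define k where "k = Max {i\<in>{1..n}. g i \<noteq> 0}"
  have fin: "finite {i\<in>{1..n}. g i \<noteq> 0}" by simp
  have "k \<in> {i\<in>{1..n}. g i \<noteq> 0}" unfolding k_def using False by (intro Max_in fin) auto
  moreover have "g i = 0" if "i \<in> {k<..n}" for i
  proof (rule ccontr)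
    assume "g i \<noteq> 0"
    then have "i \<in> {i\<in>{1..n}. g i \<noteq> 0}" using that by auto
    then have "i \<le> k" unfolding k_def by (rule Max_ge[OF fin])
    then show False using that by simp
  qed
  ultimately have "k \<in> {1..n}" "g k > 0 \<or> - g k > 0" "\<forall>i\<in>{k<..n}. g i = 0" "\<forall>i\<in>{k<..n}. - g i = 0" by auto
  then show ?thesis unfolding lead_pos_def by blast
qed simp

text \<open>For \<open>y \<ge> 1\<close> the terms below the leading index \<open>k\<close> are
  together at most \<open>R * exp ((k - 1) * y)\<close>, so the sum is at least
  \<open>exp ((k - 1) * y) * (a * exp y - R)\<close>. The first factor is at least 1, and
  \<open>exp y \<ge> y^2 / 2\<close> beats every affine function.\<close>

lemma superlinear_esum:
  assumes "lead_pos n g"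
  shows "superlinear (esum n g c)"
proof -
  obtain k where k: "k \<in> {1..n}" "g k > 0" "\<And>i. i \<in> {k<..n} \<Longrightarrow> g i = 0"
    using assms unfolding lead_pos_def by blast
  define a where "a = g k"
  define R where "R = (\<Sum>i=1..n. \<bar>g i\<bar>)"
  have a: "a > 0" using k by (simp add: a_def)
  have R: "R \<ge> 0" by (simp add: R_def sum_nonneg)
  show ?thesis unfolding superlinear_def
  proof (intro allI)
    fix A B :: real
    define M where "M = \<bar>A\<bar> + \<bar>B\<bar> + R + \<bar>c\<bar>"
    have M: "M \<ge> 0" using R by (simp add: M_def)
    \<comment> \<open>From this threshold on \<open>a / 2 * y > M\<close>, so the quadratic lower
      bound of \<open>a * exp y\<close> exceeds \<open>M * y\<close>, which absorbs the affine
      function and all constants.\<close>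
    have "esum n g c y > A * y + B" if y: "y \<ge> 2 / a * M + 1" for y
    proof -
      have y1: "y \<ge> 1" using y M a by (smt (verit) divide_nonneg_pos mult_nonneg_nonneg)
      have "a / 2 * y \<ge> a / 2 * (2 / a * M + 1)" using y a by (intro mult_left_mono) auto
      also have "a / 2 * (2 / a * M + 1) = M + a / 2" using a by (simp add: field_simps)
      finally have ay: "a / 2 * y > M" using a by linarith
      then have "a / 2 * y * y > M * y" using y1 by simp
      moreover have "M * y \<ge> \<bar>A\<bar> * y + \<bar>B\<bar> + R + \<bar>c\<bar>"
      proof -
        have "\<bar>B\<bar> + R + \<bar>c\<bar> \<le> (\<bar>B\<bar> + R + \<bar>c\<bar>) * y"
          using y1 R mult_left_mono[of 1 y "\<bar>B\<bar> + R + \<bar>c\<bar>"] by simp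
        then show ?thesis by (simp add: M_def distrib_right)
      qed
      moreover have "a * exp y \<ge> a / 2 * y * y"
      proof -
        have "y\<^sup>2 / 2 \<le> exp y" using exp_lower_Taylor_quadratic[of y] y1 by linarith
        then have "a * (y\<^sup>2 / 2) \<le> a * exp y" using a by (intro mult_left_mono) auto
        then show ?thesis by (simp add: power2_eq_square)
      qed
      moreover have "\<bar>A\<bar> * y \<ge> A * y" using y1 by (intro mult_right_mono) auto
      moreover have Ay0: "\<bar>A\<bar> * y \<ge> 0" using y1 by simp
      ultimately have big: "a * exp y - R - \<bar>c\<bar> > A * y + \<bar>B\<bar>" and big0: "a * exp y - R \<ge> 0"
        by linarith+
      have "(\<Sum>i=1..n. g i * exp (real i * y)) \<ge>
        (\<Sum>i=1..n. (if i = k then a * exp (real k * y) else 0) - \<bar>g i\<bar> * exp (real (k - 1) * y))"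
      proof (rule sum_mono)
        fix i assume i: "i \<in> {1..n}"
        consider "i < k" | "i = k" | "i > k" by linarith
        then show "(if i = k then a * exp (real k * y) else 0) - \<bar>g i\<bar> * exp (real (k - 1) * y) \<le> g i * exp (real i * y)"
        proof cases
          case 1
          have "exp (real i * y) \<le> exp (real (k - 1) * y)" using 1 y1 by simp
          then have "\<bar>g i\<bar> * exp (real i * y) \<le> \<bar>g i\<bar> * exp (real (k - 1) * y)" by (intro mult_left_mono) auto
          moreover have "- (\<bar>g i\<bar> * exp (real i * y)) \<le> g i * exp (real i * y)"
            using mult_right_mono[of "- \<bar>g i\<bar>" "g i" "exp (real i * y)"] by simp
          ultimately show ?thesis using 1 by simp
        next
          case 2
          then show ?thesis by (simp add: a_def)
        next
          case 3
          then show ?thesis using k(3)[of i] i by simp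
        qed
      qed
      also have "(\<Sum>i=1..n. (if i = k then a * exp (real k * y) else 0) - \<bar>g i\<bar> * exp (real (k - 1) * y))
        = a * exp (real k * y) - R * exp (real (k - 1) * y)"
        using k(1) by (simp add: sum_subtractf R_def sum_distrib_right)
      also have "exp (real k * y) = exp (real (k - 1) * y) * exp y"
      proof -
        have "real k * y = real (k - 1) * y + y" using k(1) by (simp add: of_nat_diff algebra_simps)
        then show ?thesis by (simp add: exp_add)
      qed
      also have "a * (exp (real (k - 1) * y) * exp y) - R * exp (real (k - 1) * y) = exp (real (k - 1) * y) * (a * exp y - R)"
        by (simp add: algebra_simps)
      finally have "(\<Sum>i=1..n. g i * exp (real i * y)) \<ge> exp (real (k - 1) * y) * (a * exp y - R)" .
      moreover have "exp (real (k - 1) * y) * (a * exp y - R) \<ge> 1 * (a * exp y - R)"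
        using big0 y1 by (intro mult_right_mono) auto
      ultimately have "(\<Sum>i=1..n. g i * exp (real i * y)) \<ge> a * exp y - R" by simp
      then have "esum n g c y \<ge> a * exp y - R - \<bar>c\<bar>" unfolding esum_def by linarith
      then show ?thesis using big by linarith
    qed
    then show "\<exists>Y. \<forall>y\<ge>Y. esum n g c y > A * y + B" by blast
  qed
qed

lemma esum_near:
  assumes "y \<le> 0"
  shows "\<bar>esum n g c y - c\<bar> \<le> (\<Sum>i=1..n. \<bar>g i\<bar>) * exp y"
proof -
  have "\<bar>\<Sum>i=1..n. g i * exp (real i * y)\<bar> \<le> (\<Sum>i=1..n. \<bar>g i * exp (real i * y)\<bar>)" by (rule sum_abs)
  also have "\<dots> \<le> (\<Sum>i=1..n. \<bar>g i\<bar> * exp y)"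
  proof (rule sum_mono)
    fix i assume "i \<in> {1..n}"
    then have "real i * y \<le> 1 * y" using assms by (intro mult_right_mono_neg) auto
    then show "\<bar>g i * exp (real i * y)\<bar> \<le> \<bar>g i\<bar> * exp y"
      by (simp add: abs_mult mult_left_mono)
  qed
  finally show ?thesis by (simp add: esum_def sum_distrib_right)
qed

text \<open>With constant term 0 the first coefficient governs the behaviour at minus infinity:
  every other term is of order \<open>exp (2 * y)\<close> or smaller.\<close>

lemma esum_near_first_order:
  assumes "y \<le> 0" "n \<ge> 1"
  shows "\<bar>esum n g 0 y - g 1 * exp y\<bar> \<le> (\<Sum>i=1..n. \<bar>g i\<bar>) * exp (2 * y)"
proof -
  have "(\<Sum>i=1..n. g i * exp (real i * y) - (if i = 1 then g 1 * exp y else 0)) = esum n g 0 y - g 1 * exp y"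
    using assms(2) by (simp add: sum_subtractf esum_def)
  moreover have "\<bar>\<Sum>i=1..n. g i * exp (real i * y) - (if i = 1 then g 1 * exp y else 0)\<bar>
     \<le> (\<Sum>i=1..n. \<bar>g i * exp (real i * y) - (if i = 1 then g 1 * exp y else 0)\<bar>)" by (rule sum_abs)
  moreover have "\<dots> \<le> (\<Sum>i=1..n. \<bar>g i\<bar> * exp (2 * y))"
  proof (rule sum_mono)
    fix i assume i: "i \<in> {1..n}"
    show "\<bar>g i * exp (real i * y) - (if i = 1 then g 1 * exp y else 0)\<bar> \<le> \<bar>g i\<bar> * exp (2 * y)"
    proof (cases "i = 1")
      case False
      then have "real i * y \<le> 2 * y" using assms(1) i by (intro mult_right_mono_neg) auto
      then show ?thesis using False by (simp add: abs_mult mult_left_mono)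
    qed simp
  qed
  ultimately show ?thesis by (simp add: sum_distrib_right)
qed

lemma esum_bounded_above:
  assumes "\<not> lead_pos n g"
  shows "\<exists>C. \<forall>y. esum n g c y \<le> C"
  using lead_trichotomy[of n g] assms
proof (elim disjE)
  assume "lead_pos n (\<lambda>i. - g i)"
  then have "superlinear (\<lambda>y. - esum n g c y)"
    using superlinear_esum[of n "\<lambda>i. - g i" "- c"] by (simp add: esum_minus[abs_def])
  then obtain Y where Y: "\<And>y. y \<ge> Y \<Longrightarrow> - esum n g c y > 0 * y + 0" unfolding superlinear_def by blast
  define C where "C = (\<Sum>i=1..n. \<bar>g i\<bar> * exp (real i * Y)) + \<bar>c\<bar>"
  have "C \<ge> 0" unfolding C_def by (intro add_nonneg_nonneg sum_nonneg) auto
  have "esum n g c y \<le> C" for y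
  proof (cases "y \<ge> Y")
    case True
    then show ?thesis using Y[OF True] \<open>C \<ge> 0\<close> by simp
  next
    case False
    have "(\<Sum>i=1..n. g i * exp (real i * y)) \<le> (\<Sum>i=1..n. \<bar>g i\<bar> * exp (real i * Y))"
      using False by (intro sum_mono mult_mono) (auto intro: mult_left_mono)
    then show ?thesis by (simp add: esum_def C_def)
  qed
  then show ?thesis by blast
next
  assume "\<forall>i\<in>{1..n}. g i = 0"
  then have "esum n g c y \<le> c" for y by (simp add: esum_def)
  then show ?thesis by blast
qed auto

lemma superlinear_tendsto:
  assumes "superlinear \<phi>"
  shows "((\<lambda>y. ereal (\<phi> y)) \<longlongrightarrow> \<infinity>) at_top"
  unfolding tendsto_PInfty
proof
  fix r :: real
  obtain Y where "\<And>y. y \<ge> Y \<Longrightarrow> \<phi> y > 0 * y + r" using assms unfolding superlinear_def by blast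
  then show "\<forall>\<^sub>F y in at_top. ereal r < ereal (\<phi> y)"
    unfolding eventually_at_top_linorder by (intro exI[of _ Y]) auto
qed

text \<open>\<open>Lim\<close> is a definite description and says nothing unless a limit is known to
  exist. The limit is therefore determined in all three cases: plus infinity, minus infinity, or
  \<open>c\<close>.\<close>

lemma Lim_esum_eq_infinity: "Lim at_top (\<lambda>y. ereal (esum n g c y)) = \<infinity> \<longleftrightarrow> lead_pos n g"
proof (cases "lead_pos n g")
  case True
  have "Lim at_top (\<lambda>y. ereal (esum n g c y)) = \<infinity>"
    by (intro tendsto_Lim superlinear_tendsto superlinear_esum True) simp
  then show ?thesis using True by simp
next
  case False
  have "Lim at_top (\<lambda>y. ereal (esum n g c y)) \<noteq> \<infinity>"
    using lead_trichotomy[of n g] False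
  proof (elim disjE)
    assume "lead_pos n (\<lambda>i. - g i)"
    then have "((\<lambda>y. ereal (- esum n g c y)) \<longlongrightarrow> \<infinity>) at_top"
      using superlinear_tendsto[OF superlinear_esum[of n "\<lambda>i. - g i" "- c"]] by (simp add: esum_minus)
    then have "((\<lambda>y. - ereal (- esum n g c y)) \<longlongrightarrow> - \<infinity>) at_top"
      by (rule tendsto_uminus_ereal)
    then have "Lim at_top (\<lambda>y. ereal (esum n g c y)) = - \<infinity>"
      by (intro tendsto_Lim) auto
    then show ?thesis by simp
  next
    assume z: "\<forall>i\<in>{1..n}. g i = 0"
    then have "(\<lambda>y. ereal (esum n g c y)) = (\<lambda>y. ereal c)" by (simp add: esum_def)
    then have "((\<lambda>y. ereal (esum n g c y)) \<longlongrightarrow> ereal c) at_top" by simp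
    then have "Lim at_top (\<lambda>y. ereal (esum n g c y)) = ereal c"
      by (intro tendsto_Lim) auto
    then show ?thesis by simp
  qed auto
  then show ?thesis using False by simp
qed

lemma q_max_eq_infinity_iff:
  fixes f :: "nat \<Rightarrow> 'v::finite \<Rightarrow> real"
  shows "q_max (exp_sum n f c) = \<infinity> \<longleftrightarrow> (\<exists>x. lead_pos n (\<lambda>i. f i x))"
proof -
  let ?l = "\<lambda>x. Lim at_top (\<lambda>y. ereal (exp_sum n f c x y))"
  have l: "?l x = \<infinity> \<longleftrightarrow> lead_pos n (\<lambda>i. f i x)" for x
    unfolding exp_sum_eq_esum by (rule Lim_esum_eq_infinity)
  have "Max (range ?l) \<in> range ?l" by (rule Max_in) auto
  moreover have "?l x \<le> Max (range ?l)" for x by (rule Max_ge) auto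
  ultimately have "Max (range ?l) = \<infinity> \<longleftrightarrow> (\<exists>x. ?l x = \<infinity>)"
    by (metis (no_types, lifting) ereal_infty_less_eq(1) imageE)
  then show ?thesis using l by (simp add: q_max_def)
qed

lemma smooth2_exp_sum: "smooth2 (exp_sum n f c x)"
  unfolding exp_sum_eq_esum esum_def[abs_def]
  by (intro smooth2_add smooth2_sum smooth2_cmult smooth2_exp smooth2_const)

definition coeff_sum :: "nat \<Rightarrow> (nat \<Rightarrow> 'v::finite \<Rightarrow> real) \<Rightarrow> real" where
  "coeff_sum n f = (\<Sum>x\<in>UNIV. \<Sum>i=1..n. \<bar>f i x\<bar>)"

lemma coeff_sum_ge: "(\<Sum>i=1..n. \<bar>f i x\<bar>) \<le> coeff_sum n f"
  unfolding coeff_sum_def by (intro member_le_sum sum_nonneg) auto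

lemma coeff_sum_nonneg: "coeff_sum n f \<ge> 0"
  unfolding coeff_sum_def by (intro sum_nonneg) auto

lemma exp_sum_near:
  assumes "y \<le> 0"
  shows "\<bar>exp_sum n f c x y - c\<bar> \<le> coeff_sum n f * exp y"
  unfolding exp_sum_eq_esum
  by (rule order_trans[OF esum_near[OF assms] mult_right_mono[OF coeff_sum_ge]]) simp

lemma exp_sum_near_first_order:
  assumes "y \<le> 0" "n \<ge> 1"
  shows "\<bar>exp_sum n f 0 x y - f 1 x * exp y\<bar> \<le> coeff_sum n f * exp (2 * y)"
  unfolding exp_sum_eq_esum
  by (rule order_trans[OF esum_near_first_order[OF assms] mult_right_mono[OF coeff_sum_ge]]) simp

lemma exp_sum_bounded_below:
  assumes "y \<le> 0"
  shows "exp_sum n f c x y \<ge> - (coeff_sum n f + \<bar>c\<bar>)"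
proof -
  have "coeff_sum n f * exp y \<le> coeff_sum n f * 1"
    using assms coeff_sum_nonneg by (intro mult_left_mono) auto
  then show ?thesis using exp_sum_near[OF assms, of n f c x] by linarith
qed

lemma superlinear_exp: "superlinear (\<lambda>y. k + exp y)"
proof -
  have "lead_pos 1 (\<lambda>i. 1)" unfolding lead_pos_def by (intro bexI[of _ 1]) auto
  from superlinear_esum[OF this, of k] show ?thesis by (simp add: esum_def[abs_def] add.commute)
qed

lemma exp_sum_uniformly_bounded_above:
  fixes f :: "nat \<Rightarrow> 'v::finite \<Rightarrow> real"
  shows "\<exists>C\<ge>0. \<forall>x. \<not> lead_pos n (\<lambda>i. f i x) \<longrightarrow> (\<forall>y. exp_sum n f c x y \<le> C)"
proof (rule finite_uniform_bound)
  show "\<exists>C. \<not> lead_pos n (\<lambda>i. f i x) \<longrightarrow> (\<forall>y. exp_sum n f c x y \<le> C)" for x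
    using esum_bounded_above[of n "\<lambda>i. f i x" c] by (auto simp: exp_sum_eq_esum)
qed (auto intro: order_trans)

section \<open>Exponential sums with nonzero constant term\<close>

context finite_connected_weighted_graph
begin

lemma low_sign_exp_sum:
  assumes "s = 1 \<or> s = - 1" "s * c > 0"
  shows "low_sign s (exp_sum n f c)"
proof -
  \<comment> \<open>As \<open>exp (- K) \<le> 1 / (1 + K)\<close>, the exponential part is at most
    \<open>K * \<bar>c\<bar> / (1 + K)\<close> and so less than
    \<open>\<bar>c\<bar>\<close>.\<close>
  define K where "K = coeff_sum n f / \<bar>c\<bar>"
  have c: "\<bar>c\<bar> > 0" "s * c = \<bar>c\<bar>" using assms by auto
  have K: "K \<ge> 0" unfolding K_def by (intro divide_nonneg_nonneg coeff_sum_nonneg) simp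
  have pos: "s * exp_sum n f c x y > 0" if y: "y \<le> - K" for x y
  proof -
    have "exp y \<le> exp (- K)" using y by simp
    also have "\<dots> \<le> 1 / (1 + K)"
      using exp_ge_add_one_self[of K] K by (simp add: exp_minus inverse_eq_divide frac_le)
    finally have "coeff_sum n f * exp y \<le> coeff_sum n f * (1 / (1 + K))"
      using coeff_sum_nonneg by (rule mult_left_mono)
    also have "\<dots> < \<bar>c\<bar>"
    proof -
      have "coeff_sum n f = K * \<bar>c\<bar>" using c by (simp add: K_def)
      then have "coeff_sum n f < \<bar>c\<bar> * (1 + K)" using c by (simp add: algebra_simps)
      then show ?thesis using K by (simp add: pos_divide_less_eq)
    qed
    finally have "\<bar>exp_sum n f c x y - c\<bar> < \<bar>c\<bar>"
      using exp_sum_near[of y n f c x] y K by linarith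
    then show ?thesis using assms by (auto simp: abs_if split: if_splits)
  qed
  then show ?thesis by (intro low_signI[of K]) (auto intro: less_imp_le)
qed

lemma one_plus_exp_pos:
  fixes s r y :: real
  assumes "s = 1 \<or> s = - 1" "r = 1 \<or> r = - 1" "y \<le> - 1"
  shows "s * (s + r * exp y) > 0"
proof -
  have "exp y < exp 0" using assms(3) by (subst exp_less_cancel_iff) simp
  then have "exp y < 1" by simp
  then show ?thesis using assms(1,2) exp_gt_zero[of y] by (elim disjE) (auto simp del: exp_gt_zero)
qed

lemma low_sign_point_source:
  assumes "s = 1 \<or> s = - 1" "r = 1 \<or> r = - 1"
  shows "low_sign s (point_source x1 s r)"
  using one_plus_exp_pos[OF assms]
  by (intro low_signI[of 1]) (auto simp: point_source_def less_imp_le)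

lemma point_source_bounded_below:
  assumes "\<bar>k\<bar> \<le> 1" "\<bar>s\<bar> \<le> 1" "y \<le> 0"
  shows "point_source x1 k s x y \<ge> - 2"
proof -
  have "\<bar>s * exp y\<bar> \<le> 1 * 1"
    unfolding abs_mult using assms by (intro mult_mono) auto
  then show ?thesis using assms(1) by (auto simp: point_source_def)
qed

text \<open>The target \<open>point_source x1 s (- 1)\<close> keeps what the bounds rely on: the
  sign \<open>s\<close> at minus infinity, an upper bound at all vertices, and faster than linear
  decrease at \<open>x1\<close>.\<close>

lemma eventual_degree_no_lead_pos:
  assumes np: "\<And>x. \<not> lead_pos n (\<lambda>i. f i x)" and x1: "lead_pos n (\<lambda>i. - f i x1)"
    and s: "s = 1 \<or> s = - 1" "s * c > 0"
  shows "eventual_degree (exp_sum n f c) (if c > 0 then 1 else 0)"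
proof (rule eventual_degree_homotopy[OF smooth2_exp_sum smooth2_point_source])
  let ?F = "exp_sum n f c" and ?G = "point_source x1 s (- 1)"
  show "lower_bounded ?F ?G"
  proof (rule lower_boundedI)
    let ?C = "coeff_sum n f + \<bar>c\<bar> + 2"
    show "?F x y \<ge> - ?C" if "y \<le> 0" for x y using exp_sum_bounded_below[OF that, of n f c x] by linarith
    show "?G x y \<ge> - ?C" if "y \<le> 0" for x y
      using point_source_bounded_below[of s "- 1" y x1 x] that s coeff_sum_nonneg[of n f] by auto
    show "?C \<ge> 0" using coeff_sum_nonneg[of n f] by linarith
    show "no_low_solutions ?F ?G"
      by (intro no_low_solutions_sign[of s] low_sign_exp_sum low_sign_point_source s) auto
  qed
  show "upper_bounded ?F ?G"
  proof -
    obtain C where C: "C \<ge> 0" "\<And>x y. ?F x y \<le> C"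
      using exp_sum_uniformly_bounded_above[of n f c] np by blast
    have G1: "?G x y \<le> 1" for x y
    proof -
      have "s \<le> 1" using s(1) by auto
      then have "s + - 1 * exp y \<le> 1" using exp_gt_zero[of y] by linarith
      then show ?thesis by (simp add: point_source_def)
    qed
    show ?thesis
    proof (rule upper_bounded_bounded_above[where C = "C + 1" and ?x1.0 = x1])
      show "?F x y \<le> C + 1" for x y using C(2)[of x y] by linarith
      show "?G x y \<le> C + 1" for x y using C(1) G1[of x y] by linarith
      show "superlinear (\<lambda>y. - ?F x1 y)"
        using superlinear_esum[OF x1, of "- c"] by (simp add: exp_sum_eq_esum esum_minus[abs_def])
      show "superlinear (\<lambda>y. - ?G x1 y)"
        using superlinear_exp[of "- s"] by (simp add: point_source_def)
    qed (use C(1) in simp)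
  qed
  show "eventual_degree ?G (if c > 0 then 1 else 0)"
  proof (cases "c > 0")
    case True
    then have "s = 1" using s by auto
    then show ?thesis using eventual_degree_point_source[of 1 x1] True by simp
  next
    case False
    then have "s = - 1" using s by auto
    then show ?thesis using eventual_degree_point_source_same_sign[of s "- 1" x1] False by simp
  qed
qed

text \<open>A direct passage to a point source fits no upper bound criterion in general: the
  exponential sum may tend to minus infinity off \<open>P\<close>, and a point source does not grow
  at the other vertices of \<open>P\<close>. The intermediate \<open>F1\<close> grows on all of
  \<open>P\<close> and is bounded below, so each half of the way has its own criterion.\<close>

lemma eventual_degree_lead_pos:
  assumes x1: "lead_pos n (\<lambda>i. f i x1)" and s: "s = 1 \<or> s = - 1" "s * c > 0"
  shows "eventual_degree (exp_sum n f c) (if c < 0 then - 1 else 0)"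
proof -
  define P where "P = {x. lead_pos n (\<lambda>i. f i x)}"
  define F1 where "F1 = (\<lambda>x y. s + (if x \<in> P then exp y else 0))"
  have x1P: "x1 \<in> P" using x1 by (simp add: P_def)
  have smF1: "smooth2 (F1 x)" for x
  proof -
    have "smooth2 (\<lambda>y. s + exp (1 * y))" by (intro smooth2_add smooth2_const smooth2_exp)
    then show ?thesis by (cases "x \<in> P") (auto simp: F1_def smooth2_const)
  qed
  have F1ge: "F1 x y \<ge> - 1" for x y using s by (auto simp: F1_def intro: add_nonneg_nonneg)
  have F1low: "low_sign s F1"
  \<comment> \<open>The sign is strict at every vertex, so an arbitrary one, here
    \<open>undefined\<close>, serves as witness.\<close>
  proof (rule low_signI[of 1 _ _ undefined])
    show pos: "s * F1 x y > 0" if "y \<le> - 1" for x y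
      using one_plus_exp_pos[OF s(1) _ that, of 1] s(1) by (auto simp: F1_def)
    then show "s * F1 x y \<ge> 0" if "y \<le> - 1" for x y using that by (simp add: less_imp_le)
  qed
  have F1deg: "eventual_degree F1 (if c < 0 then - 1 else 0)"
  proof (cases "c < 0")
    case True
    then have s1: "s = - 1" using s by auto
    let ?G = "point_source x1 (- 1) 1"
    have Gge: "?G x y \<ge> - 1" for x y by (simp add: point_source_def)
    have "eventual_degree F1 (- 1)"
    proof (rule eventual_degree_homotopy[OF smF1 smooth2_point_source])
      show "lower_bounded F1 ?G"
        by (rule lower_boundedI[where C = 1])
          (use F1ge Gge F1low low_sign_point_source[of "- 1" 1 x1] no_low_solutions_sign[of "- 1" F1 ?G] s1 in auto)
      show "upper_bounded F1 ?G"
      proof (rule upper_bounded_bounded_below[where C = 1 and ?x1.0 = x1])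
        show "superlinear (F1 x1)" using superlinear_exp[of s] x1P by (simp add: F1_def)
        show "superlinear (?G x1)" using superlinear_exp[of "- 1"] by (simp add: point_source_def[abs_def])
      qed (use F1ge Gge in auto)
      show "eventual_degree ?G (- 1)" using eventual_degree_point_source[of "- 1" x1] by simp
    qed
    then show ?thesis using True by simp
  next
    case False
    then have s1: "s = 1" using s by auto
    have "eventual_degree F1 0"
    proof (rule eventual_degree_no_zeros[OF smF1])
      fix u
      show "\<exists>x. L u $ x \<noteq> F1 x (u $ x)"
      proof (rule ccontr)
        assume "\<not> ?thesis"
        then have "(\<Sum>x\<in>UNIV. m x * F1 x (u $ x)) = 0" by (intro sum_m_solution) auto
        moreover have "(\<Sum>x\<in>UNIV. m x * F1 x (u $ x)) > 0"
          using vertex_weight_pos by (intro sum_pos) (auto simp: F1_def s1 add_pos_pos)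
        ultimately show False by simp
      qed
    qed
    then show ?thesis using False by simp
  qed
  show ?thesis
  proof (rule eventual_degree_homotopy[OF smooth2_exp_sum smF1 _ _ F1deg])
    show lo: "lower_bounded (exp_sum n f c) F1"
    proof (rule lower_boundedI)
      let ?C = "coeff_sum n f + \<bar>c\<bar> + 1"
      show "exp_sum n f c x y \<ge> - ?C" if "y \<le> 0" for x y using exp_sum_bounded_below[OF that, of n f c x] by linarith
      show "F1 x y \<ge> - ?C" for x y using F1ge[of x y] coeff_sum_nonneg[of n f] by linarith
      show "?C \<ge> 0" using coeff_sum_nonneg[of n f] by linarith
      show "no_low_solutions (exp_sum n f c) F1"
        by (intro no_low_solutions_sign[of s] low_sign_exp_sum F1low s)
    qed
    obtain C where C: "C \<ge> 0" "\<And>x y. \<not> lead_pos n (\<lambda>i. f i x) \<Longrightarrow> exp_sum n f c x y \<le> C"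
      using exp_sum_uniformly_bounded_above[of n f c] by blast
    show "upper_bounded (exp_sum n f c) F1"
    proof (rule upper_bounded_superlinear[OF _ _ _ _ _ x1P lo])
      show "exp_sum n f c x y \<le> C + 1" if "x \<notin> P" for x y using C(2)[of x y] that by (simp add: P_def)
      show "F1 x y \<le> C + 1" if "x \<notin> P" for x y using C(1) s that by (auto simp: F1_def)
      show "superlinear (exp_sum n f c x)" if "x \<in> P" for x
        using superlinear_esum that by (simp add: exp_sum_eq_esum P_def)
      show "superlinear (F1 x)" if "x \<in> P" for x using superlinear_exp[of s] that by (simp add: F1_def)
    qed (use C(1) in simp)
  qed
qed

section \<open>The case of zero constant term\<close>

lemma mix_exp_sum_0: "mix t (exp_sum n f 0) (exp_sum n f s) x y = exp_sum n f 0 x y + t * s"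
  by (simp add: mix_def exp_sum_def algebra_simps)

text \<open>A very negative solution is nearly constant, so that \<open>f 1\<close> enters the sum of the equations only through
  its average, which then dominates the remaining terms.\<close>

lemma no_low_solutions_zero:
  assumes n: "n \<ge> 1" and s: "s = 1 \<or> s = - 1" and avg: "s * (\<Sum>x\<in>UNIV. m x * f 1 x) > 0"
  shows "no_low_solutions (exp_sum n f 0) (exp_sum n f s)"
proof -
  define S where "S = coeff_sum n f"
  define \<alpha> where "\<alpha> = s * (\<Sum>x\<in>UNIV. m x * f 1 x)"
  define M where "M = (\<Sum>x\<in>UNIV. m x)"
  obtain K0 where K0: "K0 > 0" "\<And>u x y. \<bar>u $ x - u $ y\<bar> \<le> K0 * norm (L u)"
    using oscillation_bound by blast
  define B where "B = K0 * real CARD('v)"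
  have S: "S \<ge> 0" unfolding S_def by (rule coeff_sum_nonneg)
  have M: "M > 0" unfolding M_def by (rule sum_m_pos)
  have B: "B \<ge> 0" using K0(1) by (simp add: B_def)
  have \<alpha>: "\<alpha> > 0" using avg by (simp add: \<alpha>_def)
  \<comment> \<open>The constants are dictated by the final estimate \<open>\<epsilon> * (\<alpha> -
    T * \<epsilon>) + t * M * (1 - S * B * \<epsilon>) \<le> 0\<close>: for
    \<open>\<epsilon> < \<kappa>\<close> the first term is positive and the second nonnegative.
    \<open>K\<close> brings the exponentials of all values of \<open>u\<close> below
    \<open>\<kappa>\<close>.\<close>
  define T where "T = M * S * (1 + B * S)"
  have T: "T \<ge> 0" using M S B by (simp add: T_def)
  define \<kappa> where "\<kappa> = min 1 (min (\<alpha> / (T + 1)) (1 / (S * B + 1)))"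
  have SB: "S * B \<ge> 0" using S B by simp
  have \<kappa>: "\<kappa> > 0" using \<alpha> T SB by (simp add: \<kappa>_def)
  define K where "K = \<bar>ln \<kappa>\<bar> + 1"
  have "\<exists>x. u $ x > - K"
    if t: "0 \<le> t" "t \<le> 1" and sol: "\<And>x. L u $ x = mix t (exp_sum n f 0) (exp_sum n f s) x (u $ x)" for t u
  proof (rule ccontr)
    assume "\<not> ?thesis"
    then have u: "u $ x \<le> - K" for x by (auto simp: not_less)
    have "K \<ge> 0" unfolding K_def by linarith
    then have u0: "u $ x \<le> 0" for x using u[of x] by linarith
    obtain x0 where x0: "\<And>x. u $ x \<le> u $ x0"
    proof -
      have "Max (range (($) u)) \<in> range (($) u)" by (intro Max_in) auto
      then obtain x0 where "Max (range (($) u)) = u $ x0" by blast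
      moreover have "u $ x \<le> Max (range (($) u))" for x by (intro Max_ge) auto
      ultimately show thesis using that by metis
    qed
    define \<epsilon> where "\<epsilon> = exp (u $ x0)"
    have \<epsilon>: "\<epsilon> > 0" by (simp add: \<epsilon>_def)
    have "u $ x0 < ln \<kappa>" using u[of x0] by (simp add: K_def)
    then have "\<epsilon> < \<kappa>" unfolding \<epsilon>_def using \<kappa> by (metis exp_less_cancel_iff exp_ln)
    then have \<epsilon>1: "\<epsilon> < \<alpha> / (T + 1)" "\<epsilon> < 1 / (S * B + 1)" by (auto simp: \<kappa>_def)
    have ex: "exp (u $ x) \<le> \<epsilon>" for x using x0[of x] by (simp add: \<epsilon>_def)
    have Fx: "\<bar>exp_sum n f 0 x (u $ x)\<bar> \<le> S * \<epsilon>" for x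
    proof -
      have "\<bar>exp_sum n f 0 x (u $ x) - 0\<bar> \<le> S * exp (u $ x)" unfolding S_def by (rule exp_sum_near[OF u0])
      also have "\<dots> \<le> S * \<epsilon>" using S ex by (intro mult_left_mono) auto
      finally show ?thesis by simp
    qed
    have Lx: "\<bar>L u $ x\<bar> \<le> S * \<epsilon> + t" for x
    proof -
      have "\<bar>t * s\<bar> = t" using s t by auto
      then show ?thesis using Fx[of x] sol[of x] by (simp add: mix_exp_sum_0)
    qed
    \<comment> \<open>The bound contains \<open>t\<close> and need not be small. In the error
      \<open>t\<close> occurs only with a further factor \<open>\<epsilon>\<close>, and is absorbed
      by the term \<open>t * M\<close> that the constant \<open>t * s\<close> contributes.\<close>
    define \<delta> where "\<delta> = B * (S * \<epsilon> + t)"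
    have osc: "\<bar>u $ x - u $ x0\<bar> \<le> \<delta>" for x
    proof -
      have "(\<Sum>x\<in>UNIV. \<bar>L u $ x\<bar>) \<le> (\<Sum>x\<in>(UNIV::'v set). S * \<epsilon> + t)" by (intro sum_mono Lx)
      then have "norm (L u) \<le> real CARD('v) * (S * \<epsilon> + t)" using norm_le_l1_cart[of "L u"] by simp
      then have "K0 * norm (L u) \<le> K0 * (real CARD('v) * (S * \<epsilon> + t))" using K0(1) by simp
      then show ?thesis using K0(2)[of u x x0] by (simp add: \<delta>_def B_def mult.assoc)
    qed
    have \<delta>: "\<delta> \<ge> 0" using osc[of x0] by simp
    have near: "\<bar>exp_sum n f 0 x (u $ x) - f 1 x * \<epsilon>\<bar> \<le> S * \<epsilon>\<^sup>2 + S * (\<epsilon> * \<delta>)" for x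
    proof -
      have "\<bar>exp_sum n f 0 x (u $ x) - f 1 x * exp (u $ x)\<bar> \<le> S * exp (2 * (u $ x))"
        unfolding S_def by (rule exp_sum_near_first_order[OF u0 n])
      also have "exp (2 * (u $ x)) = exp (u $ x) * exp (u $ x)" by (simp add: exp_add[symmetric])
      also have "S * (exp (u $ x) * exp (u $ x)) \<le> S * (\<epsilon> * \<epsilon>)"
        using S \<epsilon> ex by (intro mult_left_mono mult_mono) auto
      finally have 1: "\<bar>exp_sum n f 0 x (u $ x) - f 1 x * exp (u $ x)\<bar> \<le> S * \<epsilon>\<^sup>2" by (simp add: power2_eq_square)
      have "exp (u $ x) = \<epsilon> * exp (u $ x - u $ x0)" by (simp add: \<epsilon>_def exp_add[symmetric])
      moreover have "exp (u $ x - u $ x0) \<ge> 1 - \<delta>"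
        using exp_ge_add_one_self[of "u $ x - u $ x0"] osc[of x] by linarith
      ultimately have "exp (u $ x) \<ge> \<epsilon> * (1 - \<delta>)" using \<epsilon> by simp
      then have "\<bar>exp (u $ x) - \<epsilon>\<bar> \<le> \<epsilon> * \<delta>" using ex[of x] by (simp add: algebra_simps)
      moreover have "\<bar>f 1 x\<bar> \<le> S"
      proof -
        have "\<bar>f 1 x\<bar> \<le> (\<Sum>i=1..n. \<bar>f i x\<bar>)" using n by (intro member_le_sum) auto
        also have "\<dots> \<le> S" unfolding S_def by (rule coeff_sum_ge)
        finally show ?thesis .
      qed
      ultimately have "\<bar>f 1 x\<bar> * \<bar>exp (u $ x) - \<epsilon>\<bar> \<le> S * (\<epsilon> * \<delta>)" using S by (intro mult_mono) auto
      then have "\<bar>f 1 x * exp (u $ x) - f 1 x * \<epsilon>\<bar> \<le> S * (\<epsilon> * \<delta>)"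
        by (simp add: abs_mult[symmetric] right_diff_distrib)
      then show ?thesis using 1 by linarith
    qed
    define Q where "Q = (\<Sum>x\<in>UNIV. m x * exp_sum n f 0 x (u $ x))"
    have "\<bar>Q - \<epsilon> * (\<Sum>x\<in>UNIV. m x * f 1 x)\<bar> \<le> M * (S * \<epsilon>\<^sup>2 + S * (\<epsilon> * \<delta>))"
    proof -
      have "Q - \<epsilon> * (\<Sum>x\<in>UNIV. m x * f 1 x) = (\<Sum>x\<in>UNIV. m x * (exp_sum n f 0 x (u $ x) - f 1 x * \<epsilon>))"
        by (simp add: Q_def sum_distrib_left sum_subtractf right_diff_distrib mult_ac)
      also have "\<bar>\<dots>\<bar> \<le> (\<Sum>x\<in>UNIV. \<bar>m x * (exp_sum n f 0 x (u $ x) - f 1 x * \<epsilon>)\<bar>)" by (rule sum_abs)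
      also have "\<dots> \<le> (\<Sum>x\<in>UNIV. m x * (S * \<epsilon>\<^sup>2 + S * (\<epsilon> * \<delta>)))"
        using near vertex_weight_pos by (intro sum_mono) (auto simp: abs_mult less_imp_le intro!: mult_left_mono)
      finally show ?thesis by (simp add: M_def sum_distrib_right)
    qed
    moreover have "s * (Q - \<epsilon> * (\<Sum>x\<in>UNIV. m x * f 1 x)) = s * Q - \<epsilon> * \<alpha>"
      by (simp add: \<alpha>_def algebra_simps)
    moreover have "- \<bar>z\<bar> \<le> s * z" for z using s by (elim disjE) (auto simp: abs_if)
    from this[of "Q - \<epsilon> * (\<Sum>x\<in>UNIV. m x * f 1 x)"]
    have "- \<bar>Q - \<epsilon> * (\<Sum>x\<in>UNIV. m x * f 1 x)\<bar> \<le> s * (Q - \<epsilon> * (\<Sum>x\<in>UNIV. m x * f 1 x))" .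
    ultimately have "s * Q \<ge> \<epsilon> * \<alpha> - M * (S * \<epsilon>\<^sup>2 + S * (\<epsilon> * \<delta>))" by linarith
    moreover have "Q + t * s * M = 0"
    proof -
      have "(\<Sum>x\<in>UNIV. m x * mix t (exp_sum n f 0) (exp_sum n f s) x (u $ x)) = 0"
        using sol by (rule sum_m_solution)
      then show ?thesis
        by (simp add: mix_exp_sum_0 Q_def M_def distrib_left sum.distrib sum_distrib_left mult_ac)
    qed
    then have "s * Q + t * M = 0" using s by auto
    ultimately have "\<epsilon> * \<alpha> - M * (S * \<epsilon>\<^sup>2 + S * (\<epsilon> * \<delta>)) + t * M \<le> 0" by linarith
    moreover have "\<epsilon> * \<alpha> - M * (S * \<epsilon>\<^sup>2 + S * (\<epsilon> * \<delta>)) + t * M = \<epsilon> * (\<alpha> - T * \<epsilon>) + t * M * (1 - S * B * \<epsilon>)"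
      by (simp add: \<delta>_def T_def power2_eq_square algebra_simps)
    moreover have "\<epsilon> * (\<alpha> - T * \<epsilon>) > 0"
    proof -
      have "\<epsilon> * (T + 1) < \<alpha>" using \<epsilon>1(1) T by (simp add: pos_less_divide_eq)
      then have "\<alpha> - T * \<epsilon> > 0" using \<epsilon> by (simp add: algebra_simps)
      then show ?thesis using \<epsilon> by simp
    qed
    moreover have "t * M * (1 - S * B * \<epsilon>) \<ge> 0"
    proof -
      have "\<epsilon> * (S * B + 1) < 1" using \<epsilon>1(2) SB by (simp add: pos_less_divide_eq)
      then have "1 - S * B * \<epsilon> \<ge> 0" using \<epsilon> by (simp add: algebra_simps)
      then show ?thesis using t M by simp
    qed
    ultimately show False by linarith
  qed
  then show ?thesis unfolding no_low_solutions_def by blast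
qed

text \<open>Both ends have the same coefficients and so the same vertices with positive leading
  coefficient. If there are none, \<open>f n x1 \<noteq> 0\<close> makes the leading coefficient at
  \<open>x1\<close> negative, which yields the upper bound.\<close>

lemma eventual_degree_zero:
  assumes n: "n \<ge> 1" and s: "s = 1 \<or> s = - 1" and avg: "s * (\<Sum>x\<in>UNIV. m x * f 1 x) > 0"
    and x1: "f n x1 \<noteq> 0" and d: "eventual_degree (exp_sum n f s) d"
  shows "eventual_degree (exp_sum n f 0) d"
proof (rule eventual_degree_homotopy[OF smooth2_exp_sum smooth2_exp_sum _ _ d])
  let ?F = "exp_sum n f 0" and ?G = "exp_sum n f s"
  show lo: "lower_bounded ?F ?G"
  proof (rule lower_boundedI)
    let ?C = "coeff_sum n f + 1"
    show "?F x y \<ge> - ?C" if "y \<le> 0" for x y using exp_sum_bounded_below[OF that, of n f 0 x] by linarith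
    show "?G x y \<ge> - ?C" if "y \<le> 0" for x y using exp_sum_bounded_below[OF that, of n f s x] s by auto
    show "?C \<ge> 0" using coeff_sum_nonneg[of n f] by linarith
    show "no_low_solutions ?F ?G" by (rule no_low_solutions_zero[of n s f, OF n s avg])
  qed
  obtain C where C: "C \<ge> 0" "\<And>x y. \<not> lead_pos n (\<lambda>i. f i x) \<Longrightarrow> ?F x y \<le> C"
    using exp_sum_uniformly_bounded_above[of n f 0] by blast
  have C': "?G x y \<le> C + 1" if "\<not> lead_pos n (\<lambda>i. f i x)" for x y
    using C(2)[OF that, of y] s by (auto simp: exp_sum_def)
  show "upper_bounded ?F ?G"
  proof (cases "\<exists>x. lead_pos n (\<lambda>i. f i x)")
    case True
    then obtain x2 where x2: "x2 \<in> {x. lead_pos n (\<lambda>i. f i x)}" by blast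
    show ?thesis
    proof (rule upper_bounded_superlinear[OF _ _ _ _ _ x2 lo])
      show "?F x y \<le> C + 1" if "x \<notin> {x. lead_pos n (\<lambda>i. f i x)}" for x y using C(2)[of x y] that by simp
    qed (use C C' superlinear_esum in \<open>auto simp: exp_sum_eq_esum\<close>)
  next
    case False
    then have "lead_pos n (\<lambda>i. - f i x1)" using lead_trichotomy[of n "\<lambda>i. f i x1"] n x1 by auto
    then have sl: "superlinear (\<lambda>y. - exp_sum n f c x1 y)" for c
      using superlinear_esum[of n "\<lambda>i. - f i x1" "- c"] by (simp add: exp_sum_eq_esum esum_minus[abs_def])
    show ?thesis
    proof (rule upper_bounded_bounded_above[where F = ?F and G = ?G and C = "C + 1" and ?x1.0 = x1, OF _ _ _ sl sl])
      show "?F x y \<le> C + 1" for x y using C(2)[of x y] False by simp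
      show "?G x y \<le> C + 1" for x y using C' False by blast
    qed (use C(1) in simp)
  qed
qed

lemma eventual_degree_exp_sum:
  assumes n: "n \<ge> 1" and fn: "\<exists>x. f n x \<noteq> 0"
    and s: "s = 1 \<or> s = - 1" "s * c > 0 \<or> c = 0 \<and> s * (\<Sum>x\<in>UNIV. m x * f 1 x) > 0"
  shows "eventual_degree (exp_sum n f c)
    (if (\<exists>x. lead_pos n (\<lambda>i. f i x)) then (if s = - 1 then - 1 else 0) else (if s = 1 then 1 else 0))"
proof -
  obtain x1 where x1: "f n x1 \<noteq> 0" using fn by blast
  \<comment> \<open>Proved for an arbitrary constant of sign \<open>s\<close>: it is applied to
    \<open>c\<close> itself or, when \<open>c = 0\<close>, to \<open>s\<close>.\<close>
  have nonzero: "eventual_degree (exp_sum n f c)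
    (if (\<exists>x. lead_pos n (\<lambda>i. f i x)) then (if s = - 1 then - 1 else 0) else (if s = 1 then 1 else 0))"
    if sc: "s * c > 0" for c
  proof (cases "\<exists>x. lead_pos n (\<lambda>i. f i x)")
    case True
    then obtain x2 where x2: "lead_pos n (\<lambda>i. f i x2)" by blast
    have "c < 0 \<longleftrightarrow> s = - 1" using s(1) sc by auto
    then show ?thesis using eventual_degree_lead_pos[of n f x2 s c, OF x2 s(1) sc] True by simp
  next
    case False
    then have "lead_pos n (\<lambda>i. - f i x1)" using lead_trichotomy[of n "\<lambda>i. f i x1"] n x1 by auto
    moreover have "c > 0 \<longleftrightarrow> s = 1" using s(1) sc by auto
    ultimately show ?thesis using eventual_degree_no_lead_pos[of n f x1 s c] s(1) sc False by simp
  qed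
  show ?thesis
  proof (cases "s * c > 0")
    case False
    then have c: "c = 0" "s * (\<Sum>x\<in>UNIV. m x * f 1 x) > 0" using s(2) by auto
    have "s * s > 0" using s(1) by auto
    from eventual_degree_zero[where f = f and s = s and ?x1.0 = x1, OF n s(1) c(2) x1 nonzero[OF this]]
    show ?thesis by (simp only: c(1))
  qed (rule nonzero)
qed

lemma average_sign: "s * average m g > 0 \<longleftrightarrow> s * (\<Sum>x\<in>UNIV. m x * g x) > 0"
proof -
  have "s * average m g = (s * (\<Sum>x\<in>UNIV. m x * g x)) / (\<Sum>x\<in>UNIV. m x)"
    by (simp add: average_def)
  then show ?thesis using sum_m_pos by (simp only: zero_less_divide_iff) auto
qed

end

theorem theorem1p4:
  fixes E :: "'v::finite set set" and \<omega> :: "'v \<Rightarrow> 'v \<Rightarrow> real" and m :: "'v \<Rightarrow> real"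
    and n :: nat and f :: "nat \<Rightarrow> 'v \<Rightarrow> real" and c :: real
  assumes "finite_connected_weighted_graph E \<omega> m"
    and "n \<ge> 1"
    and "\<exists>x. f n x \<noteq> 0"
    and "c = 0 \<Longrightarrow> average m (f 1) \<noteq> 0"
  shows "kw_degree E \<omega> m n f c =
    (if q_max (exp_sum n f c) < \<infinity> \<and> (c > 0 \<or> c = 0 \<and> average m (f 1) > 0) then 1
     else if q_max (exp_sum n f c) = \<infinity> \<and> (c < 0 \<or> c = 0 \<and> average m (f 1) < 0) then - 1
     else 0)"
proof -
  interpret finite_connected_weighted_graph E \<omega> m by fact
  define s :: real where "s = (if c > 0 \<or> c = 0 \<and> average m (f 1) > 0 then 1 else - 1)"
  have s: "s = 1 \<or> s = - 1" by (simp add: s_def)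
  have "s * c > 0 \<or> c = 0 \<and> s * average m (f 1) > 0"
    using assms(4) by (auto simp: s_def)
  then have "s * c > 0 \<or> c = 0 \<and> s * (\<Sum>x\<in>UNIV. m x * f 1 x) > 0"
    by (simp add: average_sign)
  from kw_degree_eqI[OF eventual_degree_exp_sum[where f = f and s = s and c = c, OF assms(2,3) s this]]
  show ?thesis
    using assms(4) by (auto simp: q_max_eq_infinity_iff less_top[symmetric] top_ereal_def s_def)
qed

end
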